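(* Let $f: M \to \mathbb{H}^3$ be a surface with Gaussian curvature $K>-1$ and unit normal $n$. Let $F=(f,n): M \to \mathrm{U}\mathbb{H}^3$ and $L = f \wedge n: M \to \mathrm{Geo}(\mathbb{H}^3)$ be the Legendrian and Lagrangian Gauss maps of $f$, respectively. Equip $M$ with the second conformal structure $[\mathrm{I\!I}]$. Then the following statements are mutually equivalent: (1) The Gaussian curvature of $f$ is constant. (2) The Legendrian Gauss map $F$ is harmonic. (3) The Lagrangian Gauss map $L$ is harmonic. (4) The Klotz differential $Q\,\mathrm{d}z^2$ is holomorphic.
   Context: Ambient space. Let $\mathbb{E}^{1,3}=\mathbb{R}^4$ with metric $\langle\cdot,\cdot\rangle=-\mathrm{d}x_0^2+\mathrm{d}x_1^2+\mathrm{d}x_2^2+\mathrm{d}x_3^2$. Identify it with the $2\times2$ complex Hermitian matrices through the orthonormal basis $$e_0=\begin{pmatrix}1&0\\0&1\end{pmatrix},\ e_1=\begin{pmatrix}1&0\\0&-1\end{pmatrix},\ e_2=\begin{pmatrix}0&-i\\i&0\end{pmatrix},\ e_3=\begin{pmatrix}0&1\\1&0\end{pmatrix},$$ so $\langle\xi,\xi\rangle=-\det\xi$. Then $\mathbb{H}^3=\{\xi:\det\xi=1,\ \mathrm{tr}\,\xi>0\}$. The group $\mathrm{SL}_2\mathbb{C}$ (regarded as a real Lie group) acts isometrically by $\xi\mapsto g\xi g^*$, $g^*={}^t\bar g$. Surfaces. A surface $f:M\to\mathbb{H}^3$ is a smooth immersion of a connected 2-manifold; a unit normal is a smooth $n:M\to\mathbb{E}^{1,3}$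 with $\langle n,n\rangle=1$, $\langle n,f\rangle=0$, $\langle n,\mathrm{d}f\rangle=0$. Put $\mathrm{I}=\langle \mathrm{d}f,\mathrm{d}f\rangle$, $\mathrm{I\!I}=-\langle \mathrm{d}f,\mathrm{d}n\rangle$. The Gaussian curvature is $K=-1+\det(\mathrm{I}^{-1}\mathrm{I\!I})$. If $K>-1$, then $\mathrm{I\!I}$ is definite, and $n$ is chosen so that $\mathrm{I\!I}$ is positive definite. The second conformal structure $[\mathrm{I\!I}]$ is the conformal class of $\mathrm{I\!I}$ (with $M$ oriented by $n$), making $M$ a Riemann surface with local conformal coordinates $z=x+iy$. The Klotz differential is $Q\,\mathrm{d}z^2=\langle\partial f,\partial f\rangle\,\mathrm{d}z^2$, where $\partial=\frac12(\partial_x-i\partial_y)$ and $\langle\cdot,\cdot\rangle$ is extended complex bilinearly. Target spaces. $\mathrm{U}\mathbb{H}^3=\{(x,v): x\in\mathbb{H}^3,\ \langle v,v\rangle=1,\ \langle x,v\rangle=0\}$ is the unit tangent sphere bundle; $\mathrm{SL}_2\mathbb{C}$ acts transitively by $g\cdot(x,v)=(gxg^*,gvg^* )$ with isotropy group $\mathrm{U}_1=\{\mathrm{diag}(e^{i\theta},e^{-i\theta})\}$ at $(e_0,e_1)$, so $\mathrm{U}\mathbb{H}^3=\mathrm{SL}_2\mathbb{C}/\mathrm{U}_1$. $\mathrm{Geo}(\mathbb{H}^3)$ is the space of oriented geodesics of $\mathbb{H}^3$, identified with the Grassmannian of oriented timelike planes in $\mathbb{E}^{1,3}$; $x\wedge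 v$ denotes the oriented plane spanned by $x,v$. The isotropy group of $\mathrm{SL}_2\mathbb{C}$ at $e_0\wedge e_1$ is $\mathrm{GL}_1\mathbb{C}=\{\mathrm{diag}(a,a^{-1}):a\in\mathbb{C}^\times\}$, so $\mathrm{Geo}(\mathbb{H}^3)=\mathrm{SL}_2\mathbb{C}/\mathrm{GL}_1\mathbb{C}$. Both carry the $\mathrm{SL}_2\mathbb{C}$-invariant semi-Riemannian metrics induced by the real scalar product $\frac12\mathrm{Re}\,\mathrm{tr}(XY)$ on $\mathfrak{sl}_2\mathbb{C}$. The reductive complements are: for $\mathrm{U}\mathbb{H}^3$, the traceless matrices with real diagonal entries; for $\mathrm{Geo}(\mathbb{H}^3)$, the off-diagonal matrices (a symmetric space). Harmonicity. For a smooth map $\varphi$ from a Riemann surface to such a space $G/H$ with reductive decomposition $\mathfrak g=\mathfrak h\oplus\mathfrak p$, local frame $\Phi$ (i.e. $\Phi H=\varphi$), and $\alpha=\Phi^{-1}\mathrm{d}\Phi=\alpha_{\mathfrak h}+\alpha_{\mathfrak p}$, $\alpha_{\mathfrak p}=\alpha_{\mathfrak p}'+\alpha_{\mathfrak p}''$ ($(1,0)$- and $(0,1)$-parts, in the complexification of the real Lie algebra), harmonicity is characterized by $[\alpha_{\mathfrak p}'\wedge\alpha_{\mathfrak p}'']_{\mathfrak p}=0$ and $\mathrm{d}( *\alpha_{\mathfrak p})+[\alpha\wedge *\alpha_{\mathfrak p}]=0$, with $*$ the Hodge star ($*\mathrm{d}z=-i\,\mathrm{d}z$, $*\mathrm{d}\bar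 z=i\,\mathrm{d}\bar z$). For a symmetric space the first condition is vacuous. *)

theory Defs
  imports "HOL-Analysis.Analysis"
begin

section \<open>Smooth surfaces\<close>

text \<open>On an open subset of a finite-dimensional space this is the usual notion of class \<open>C\<^sup>k\<close>:
  all iterated directional derivatives up to order \<open>k\<close> exist and are continuous.\<close>

primrec Ck_on :: "nat \<Rightarrow> ('a::real_normed_vector \<Rightarrow> 'b::real_normed_vector) \<Rightarrow> 'a set \<Rightarrow> bool" where
  "Ck_on 0 f S \<longleftrightarrow> continuous_on S f"
| "Ck_on (Suc k) f S \<longleftrightarrow>
     (\<forall>x\<in>S. f differentiable (at x)) \<and> (\<forall>v. Ck_on k (\<lambda>x. frechet_derivative f (at x) v) S)"

definition smooth_on :: "('a::real_normed_vector \<Rightarrow> 'b::real_normed_vector) \<Rightarrow> 'a set \<Rightarrow> bool" where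
  "smooth_on f S \<longleftrightarrow> (\<forall>k. Ck_on k f S)"

text \<open>The coordinate plane is \<^typ>\<open>complex\<close>, regarded as \<open>\<real>\<^sup>2\<close> where only real differentiability is
  involved; \<open>\<partial>\<^sub>x\<close> and \<open>\<partial>\<^sub>y\<close> are the derivatives in the directions \<open>1\<close> and \<open>\<i>\<close>.\<close>

type_synonym 'a chart = "'a set \<times> ('a \<Rightarrow> complex)"

definition chart_image :: "'a chart \<Rightarrow> complex set" where
  "chart_image c = snd c ` fst c"

definition in_chart :: "'a chart \<Rightarrow> ('a \<Rightarrow> 'b) \<Rightarrow> complex \<Rightarrow> 'b" where
  "in_chart c f = f \<circ> inv_into (fst c) (snd c)"

definition is_chart :: "'a topology \<Rightarrow> 'a chart \<Rightarrow> bool" where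
  "is_chart X c \<longleftrightarrow> openin X (fst c) \<and> open (chart_image c) \<and>
     homeomorphic_map (subtopology X (fst c)) (top_of_set (chart_image c)) (snd c)"

definition covering_charts :: "'a topology \<Rightarrow> 'a chart set \<Rightarrow> bool" where
  "covering_charts X A \<longleftrightarrow> (\<forall>c\<in>A. is_chart X c) \<and> topspace X = (\<Union>c\<in>A. fst c)"

definition smooth_transition :: "'a chart \<Rightarrow> 'a chart \<Rightarrow> bool" where
  "smooth_transition c d \<longleftrightarrow> smooth_on (in_chart c (snd d)) (snd c ` (fst c \<inter> fst d))"

definition holomorphic_transition :: "'a chart \<Rightarrow> 'a chart \<Rightarrow> bool" where
  "holomorphic_transition c d \<longleftrightarrow> in_chart c (snd d) holomorphic_on (snd c ` (fst c \<inter> fst d))"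

definition connected_smooth_surface :: "'a topology \<Rightarrow> 'a chart set \<Rightarrow> bool" where
  "connected_smooth_surface X A \<longleftrightarrow>
     Hausdorff_space X \<and> second_countable X \<and> connected_space X \<and>
     covering_charts X A \<and> (\<forall>c\<in>A. \<forall>d\<in>A. smooth_transition c d)"

text \<open>A Riemann surface structure on the surface, inducing the given smooth structure.\<close>

definition complex_structure :: "'a topology \<Rightarrow> 'a chart set \<Rightarrow> 'a chart set \<Rightarrow> bool" where
  "complex_structure X A C \<longleftrightarrow>
     covering_charts X C \<and> (\<forall>c\<in>C. \<forall>d\<in>C. holomorphic_transition c d) \<and>
     (\<forall>c\<in>C. \<forall>d\<in>A. smooth_transition c d \<and> smooth_transition d c)"

definition smooth_map :: "'a chart set \<Rightarrow> ('a \<Rightarrow> 'b::real_normed_vector) \<Rightarrow> bool" where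
  "smooth_map A f \<longleftrightarrow> (\<forall>c\<in>A. smooth_on (in_chart c f) (chart_image c))"

section \<open>Minkowski space and hyperbolic space\<close>

text \<open>In the index type \<^typ>\<open>4\<close> the numerals \<open>0\<close> and \<open>4\<close> coincide, so that \<open>x $ 0, x $ 1, x $ 2, x $ 3\<close>
  are the four distinct components of a vector. The form is polymorphic in order to be available on
  the complexification \<^typ>\<open>complex^4\<close> as well, where it is the complex bilinear extension.\<close>

definition mink :: "'a::comm_ring_1 ^ 4 \<Rightarrow> 'a ^ 4 \<Rightarrow> 'a" where
  "mink x y = - (x $ 0 * y $ 0) + x $ 1 * y $ 1 + x $ 2 * y $ 2 + x $ 3 * y $ 3"

type_synonym vec4 = "real ^ 4"
type_synonym mat2 = "complex ^ 2 ^ 2"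

definition E0 :: mat2 where "E0 = vector [vector [1, 0], vector [0, 1]]"
definition E1 :: mat2 where "E1 = vector [vector [1, 0], vector [0, - 1]]"
definition E2 :: mat2 where "E2 = vector [vector [0, - \<i>], vector [\<i>, 0]]"
definition E3 :: mat2 where "E3 = vector [vector [0, 1], vector [1, 0]]"

definition herm :: "vec4 \<Rightarrow> mat2" where
  "herm x = x $ 0 *\<^sub>R E0 + x $ 1 *\<^sub>R E1 + x $ 2 *\<^sub>R E2 + x $ 3 *\<^sub>R E3"

lemma vec_eq_4_iff: "x = y \<longleftrightarrow> x $ 0 = y $ 0 \<and> x $ 1 = y $ 1 \<and> x $ 2 = y $ 2 \<and> x $ 3 = y $ 3"
  for x y :: "'a ^ 4"
proof -
  have "z $ 4 = z $ 0" for z :: "'a ^ 4"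
    by (rule arg_cong[of _ _ "($) z"]) simp
  then show ?thesis by (auto simp: vec_eq_iff forall_4)
qed

lemma det_herm: "det (herm x) = - of_real (mink x x)"
  by (simp add: herm_def mink_def E0_def E1_def E2_def E3_def det_2)
     (simp add: complex_eq_iff algebra_simps)

lemma inj_herm: "inj herm"
proof (rule injI)
  fix x y assume "herm x = herm y"
  then have "herm x $ i $ j = herm y $ i $ j" for i j by simp
  from this[of 1 1] this[of 1 2] this[of 2 2] show "x = y"
    by (simp add: vec_eq_4_iff herm_def E0_def E1_def E2_def E3_def complex_eq_iff)
qed

definition hyperbolic3 :: "(vec4) set" where
  "hyperbolic3 = {\<xi>. det (herm \<xi>) = 1 \<and> Re (trace (herm \<xi>)) > 0}"

section \<open>Surfaces in hyperbolic space\<close>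

abbreviation dd :: "('a::real_normed_vector \<Rightarrow> 'b::real_normed_vector) \<Rightarrow> 'a \<Rightarrow> 'a \<Rightarrow> 'b" where
  "dd f w u \<equiv> frechet_derivative f (at w) u"

definition immersed_surface :: "'a topology \<Rightarrow> 'a chart set \<Rightarrow> ('a \<Rightarrow> vec4) \<Rightarrow> bool" where
  "immersed_surface X A f \<longleftrightarrow>
     smooth_map A f \<and> f ` topspace X \<subseteq> hyperbolic3 \<and>
     (\<forall>c\<in>A. \<forall>w\<in>chart_image c. inj (dd (in_chart c f) w))"

definition unit_normal ::
  "'a topology \<Rightarrow> 'a chart set \<Rightarrow> ('a \<Rightarrow> vec4) \<Rightarrow> ('a \<Rightarrow> vec4) \<Rightarrow> bool" where
  "unit_normal X A f n \<longleftrightarrow>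
     smooth_map A n \<and>
     (\<forall>p\<in>topspace X. mink (n p) (n p) = 1 \<and> mink (n p) (f p) = 0) \<and>
     (\<forall>c\<in>A. \<forall>w\<in>chart_image c. \<forall>u. mink (in_chart c n w) (dd (in_chart c f) w u) = 0)"

text \<open>The fundamental forms in a chart, as bilinear forms on the tangent space of the coordinate
  plane at \<open>w\<close>.\<close>

definition first_form :: "'a chart \<Rightarrow> ('a \<Rightarrow> vec4) \<Rightarrow> complex \<Rightarrow> complex \<Rightarrow> complex \<Rightarrow> real" where
  "first_form c f w u v = mink (dd (in_chart c f) w u) (dd (in_chart c f) w v)"

definition second_form ::
  "'a chart \<Rightarrow> ('a \<Rightarrow> vec4) \<Rightarrow> ('a \<Rightarrow> vec4) \<Rightarrow> complex \<Rightarrow> complex \<Rightarrow> complex \<Rightarrow> real" where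
  "second_form c f n w u v = - mink (dd (in_chart c f) w u) (dd (in_chart c n) w v)"

definition form_matrix :: "(complex \<Rightarrow> complex \<Rightarrow> real) \<Rightarrow> real ^ 2 ^ 2" where
  "form_matrix B = vector [vector [B 1 1, B 1 \<i>], vector [B \<i> 1, B \<i> \<i>]]"

text \<open>The value at \<open>p\<close> does not depend on the chart around \<open>p\<close>.\<close>

definition gauss_curvature ::
  "'a chart \<Rightarrow> ('a \<Rightarrow> vec4) \<Rightarrow> ('a \<Rightarrow> vec4) \<Rightarrow> 'a \<Rightarrow> real" where
  "gauss_curvature c f n p = - 1 +
     det (matrix_inv (form_matrix (first_form c f (snd c p))) **
          form_matrix (second_form c f n (snd c p)))"

definition constant_gauss_curvature ::
  "'a chart set \<Rightarrow> ('a \<Rightarrow> vec4) \<Rightarrow> ('a \<Rightarrow> vec4) \<Rightarrow> bool" where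
  "constant_gauss_curvature A f n \<longleftrightarrow> (\<exists>k. \<forall>c\<in>A. \<forall>p\<in>fst c. gauss_curvature c f n p = k)"

definition second_form_pos_def ::
  "'a chart set \<Rightarrow> ('a \<Rightarrow> vec4) \<Rightarrow> ('a \<Rightarrow> vec4) \<Rightarrow> bool" where
  "second_form_pos_def A f n \<longleftrightarrow>
     (\<forall>c\<in>A. \<forall>w\<in>chart_image c. \<forall>u. u \<noteq> 0 \<longrightarrow> second_form c f n w u u > 0)"

section \<open>The second conformal structure and the Klotz differential\<close>

text \<open>The second fundamental form is a positive multiple of \<open>dx\<^sup>2 + dy\<^sup>2\<close>.\<close>

definition conformal_chart ::
  "'a chart \<Rightarrow> ('a \<Rightarrow> vec4) \<Rightarrow> ('a \<Rightarrow> vec4) \<Rightarrow> bool" where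
  "conformal_chart c f n \<longleftrightarrow>
     (\<forall>w\<in>chart_image c. \<exists>r>0. \<forall>u v. second_form c f n w u v = r * (u \<bullet> v))"

text \<open>The orientation of the surface is the one for which \<open>(\<partial>\<^sub>x f, \<partial>\<^sub>y f, n)\<close> is a positive basis of
  the tangent space of hyperbolic space, i.e. \<open>(f, \<partial>\<^sub>x f, \<partial>\<^sub>y f, n)\<close> is a positive basis with respect
  to \<open>(e\<^sub>0, e\<^sub>1, e\<^sub>2, e\<^sub>3)\<close>. The rows are listed by hand because the index order of
  \<^const>\<open>vector\<close> is \<open>1, 2, 3, 4 = 0\<close>.\<close>

definition oriented_chart ::
  "'a chart \<Rightarrow> ('a \<Rightarrow> vec4) \<Rightarrow> ('a \<Rightarrow> vec4) \<Rightarrow> bool" where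
  "oriented_chart c f n \<longleftrightarrow>
     (\<forall>w\<in>chart_image c.
        det (\<chi> i. if i = 0 then in_chart c f w
                  else if i = 1 then dd (in_chart c f) w 1
                  else if i = 2 then dd (in_chart c f) w \<i>
                  else in_chart c n w) > 0)"

text \<open>\<open>C\<close> is a holomorphic atlas for the Riemann surface determined by the conformal class of the
  second fundamental form and the orientation by \<open>n\<close>.\<close>

definition second_conformal_structure ::
  "'a topology \<Rightarrow> 'a chart set \<Rightarrow> ('a \<Rightarrow> vec4) \<Rightarrow> ('a \<Rightarrow> vec4) \<Rightarrow> 'a chart set \<Rightarrow> bool" where
  "second_conformal_structure X A f n C \<longleftrightarrow>
     complex_structure X A C \<and> (\<forall>c\<in>C. conformal_chart c f n \<and> oriented_chart c f n)"

definition wirtinger :: "(complex \<Rightarrow> vec4) \<Rightarrow> complex \<Rightarrow> complex ^ 4" where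
  "wirtinger g w =
     (\<chi> k. (complex_of_real (dd g w 1 $ k) - \<i> * complex_of_real (dd g w \<i> $ k)) / 2)"

definition klotz :: "'a chart \<Rightarrow> ('a \<Rightarrow> vec4) \<Rightarrow> complex \<Rightarrow> complex" where
  "klotz c f w = mink (wirtinger (in_chart c f) w) (wirtinger (in_chart c f) w)"

definition klotz_holomorphic :: "'a chart set \<Rightarrow> ('a \<Rightarrow> vec4) \<Rightarrow> bool" where
  "klotz_holomorphic C f \<longleftrightarrow> (\<forall>c\<in>C. klotz c f holomorphic_on chart_image c)"

section \<open>The homogeneous target spaces\<close>

definition conj_transpose :: "mat2 \<Rightarrow> mat2" where
  "conj_transpose g = (\<chi> i j. cnj (g $ j $ i))"

definition sl2_act :: "mat2 \<Rightarrow> vec4 \<Rightarrow> vec4" where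
  "sl2_act g x = (THE y. herm y = g ** herm x ** conj_transpose g)"

text \<open>An oriented plane is represented by the set of its positively oriented bases.\<close>

definition oriented_plane :: "vec4 \<Rightarrow> vec4 \<Rightarrow> (vec4 \<times> vec4) set" where
  "oriented_plane x v =
     {(a *\<^sub>R x + b *\<^sub>R v, c *\<^sub>R x + d *\<^sub>R v) | a b c d. a * d - b * c > 0}"

text \<open>A reductive homogeneous space of the group of complex \<open>2 \<times> 2\<close> matrices of determinant one is
  given by its action, a base point, the Lie algebra of the isotropy group of the base point, and a
  reductive complement.\<close>

record 'x homogeneous =
  action :: "mat2 \<Rightarrow> 'x \<Rightarrow> 'x"
  base_point :: 'x
  isotropy_algebra :: "mat2 set"
  reductive_complement :: "mat2 set"

definition UH3 :: "(vec4 \<times> vec4) homogeneous" where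
  "UH3 = \<lparr> action = (\<lambda>g (x, v). (sl2_act g x, sl2_act g v)),
           base_point = (axis 0 1, axis 1 1),
           isotropy_algebra = {X. \<exists>t::real. X = vector [vector [\<i> * t, 0], vector [0, - \<i> * t]]},
           reductive_complement = {X. trace X = 0 \<and> (\<forall>i. X $ i $ i \<in> \<real>)} \<rparr>"

definition Geo :: "(vec4 \<times> vec4) set homogeneous" where
  "Geo = \<lparr> action = (\<lambda>g P. (\<lambda>(x, v). (sl2_act g x, sl2_act g v)) ` P),
           base_point = oriented_plane (axis 0 1) (axis 1 1),
           isotropy_algebra = {X. \<exists>a. X = vector [vector [a, 0], vector [0, - a]]},
           reductive_complement = {X. \<forall>i. X $ i $ i = 0} \<rparr>"

definition legendrian_gauss_map ::
  "('a \<Rightarrow> vec4) \<Rightarrow> ('a \<Rightarrow> vec4) \<Rightarrow> 'a \<Rightarrow> vec4 \<times> vec4" where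
  "legendrian_gauss_map f n p = (f p, n p)"

definition lagrangian_gauss_map ::
  "('a \<Rightarrow> vec4) \<Rightarrow> ('a \<Rightarrow> vec4) \<Rightarrow> 'a \<Rightarrow> (vec4 \<times> vec4) set" where
  "lagrangian_gauss_map f n p = oriented_plane (f p) (n p)"

section \<open>Harmonic maps\<close>

text \<open>Vector-valued differential forms on the coordinate plane are functions of a point and of one or
  two tangent vectors; the complex structure on tangent vectors is multiplication by \<open>\<i>\<close>.\<close>

type_synonym 'v form1 = "complex \<Rightarrow> complex \<Rightarrow> 'v"
type_synonym 'v form2 = "complex \<Rightarrow> complex \<Rightarrow> complex \<Rightarrow> 'v"

definition ext_deriv :: "'v::real_normed_vector form1 \<Rightarrow> 'v form2" where
  "ext_deriv \<omega> w u v = dd (\<lambda>z. \<omega> z v) w u - dd (\<lambda>z. \<omega> z u) w v"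

definition wedge_bracket :: "('v \<Rightarrow> 'v \<Rightarrow> 'v::minus) \<Rightarrow> 'v form1 \<Rightarrow> 'v form1 \<Rightarrow> 'v form2" where
  "wedge_bracket br \<alpha> \<beta> w u v = br (\<alpha> w u) (\<beta> w v) - br (\<alpha> w v) (\<beta> w u)"

text \<open>This is the star operator with \<open>*dz = - i dz\<close> and \<open>*d\<bar>z = i d\<bar>z\<close>, i.e. \<open>*dx = dy\<close> and
  \<open>*dy = - dx\<close>.\<close>

definition hodge_star :: "'v::uminus form1 \<Rightarrow> 'v form1" where
  "hodge_star \<omega> w u = - \<omega> w (\<i> * u)"

definition commutator :: "mat2 \<Rightarrow> mat2 \<Rightarrow> mat2" where
  "commutator X Y = X ** Y - Y ** X"

text \<open>The complexification of the \<^emph>\<open>real\<close> Lie algebra: the pair \<open>(X, Y)\<close> stands for \<open>X + I Y\<close>, where the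
  new imaginary unit \<open>I\<close> is unrelated to the scalar \<open>\<i>\<close> in the entries of the matrices.\<close>

type_synonym cmat2 = "mat2 \<times> mat2"

definition ccommutator :: "cmat2 \<Rightarrow> cmat2 \<Rightarrow> cmat2" where
  "ccommutator P Q =
     (commutator (fst P) (fst Q) - commutator (snd P) (snd Q),
      commutator (fst P) (snd Q) + commutator (snd P) (fst Q))"

text \<open>\<open>\<alpha>' = (\<alpha> - I \<alpha> \<circ> J) / 2\<close> and \<open>\<alpha>'' = (\<alpha> + I \<alpha> \<circ> J) / 2\<close>.\<close>

definition part10 :: "mat2 form1 \<Rightarrow> cmat2 form1" where
  "part10 \<alpha> w u = ((1/2) *\<^sub>R \<alpha> w u, - (1/2) *\<^sub>R \<alpha> w (\<i> * u))"

definition part01 :: "mat2 form1 \<Rightarrow> cmat2 form1" where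
  "part01 \<alpha> w u = ((1/2) *\<^sub>R \<alpha> w u, (1/2) *\<^sub>R \<alpha> w (\<i> * u))"

definition p_part :: "('x, 'y) homogeneous_scheme \<Rightarrow> mat2 \<Rightarrow> mat2" where
  "p_part N X = (THE Y. Y \<in> reductive_complement N \<and> X - Y \<in> isotropy_algebra N)"

definition maurer_cartan :: "(complex \<Rightarrow> mat2) \<Rightarrow> mat2 form1" where
  "maurer_cartan \<Phi> w u = matrix_inv (\<Phi> w) ** dd \<Phi> w u"

definition local_frame ::
  "('x, 'y) homogeneous_scheme \<Rightarrow> (complex \<Rightarrow> 'x) \<Rightarrow> complex set \<Rightarrow> (complex \<Rightarrow> mat2) \<Rightarrow> bool" where
  "local_frame N \<psi> W \<Phi> \<longleftrightarrow>
     smooth_on \<Phi> W \<and> (\<forall>w\<in>W. det (\<Phi> w) = 1 \<and> action N (\<Phi> w) (base_point N) = \<psi> w)"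

text \<open>The harmonic map equations for the invariant semi-Riemannian metric induced by
  \<open>Re (tr (X Y)) / 2\<close>, for which the reductive complement is orthogonal to the isotropy algebra:
  \<open>[\<alpha>\<^sub>p' \<and> \<alpha>\<^sub>p'']\<^sub>p = 0\<close> and \<open>d(*\<alpha>\<^sub>p) + [\<alpha> \<and> *\<alpha>\<^sub>p] = 0\<close>.\<close>

definition harmonic_frame ::
  "('x, 'y) homogeneous_scheme \<Rightarrow> complex set \<Rightarrow> (complex \<Rightarrow> mat2) \<Rightarrow> bool" where
  "harmonic_frame N W \<Phi> \<longleftrightarrow>
     (let \<alpha> = maurer_cartan \<Phi>; \<alpha>p = (\<lambda>w u. p_part N (\<alpha> w u)) in
      \<forall>w\<in>W. \<forall>u v.
        map_prod (p_part N) (p_part N)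
          (wedge_bracket ccommutator (part10 \<alpha>p) (part01 \<alpha>p) w u v) = 0 \<and>
        ext_deriv (hodge_star \<alpha>p) w u v + wedge_bracket commutator \<alpha> (hodge_star \<alpha>p) w u v = 0)"

text \<open>Smoothness of a map into the homogeneous space means that it has smooth local frames. The
  harmonicity equations do not depend on the choice of the frame, so they are required of every
  local frame.\<close>

definition harmonic_on ::
  "('x, 'y) homogeneous_scheme \<Rightarrow> (complex \<Rightarrow> 'x) \<Rightarrow> complex set \<Rightarrow> bool" where
  "harmonic_on N \<psi> S \<longleftrightarrow>
     (\<forall>w\<in>S. \<exists>W. open W \<and> w \<in> W \<and> W \<subseteq> S \<and> (\<exists>\<Phi>. local_frame N \<psi> W \<Phi>)) \<and>
     (\<forall>W \<Phi>. open W \<and> W \<subseteq> S \<and> local_frame N \<psi> W \<Phi> \<longrightarrow> harmonic_frame N W \<Phi>)"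

definition harmonic_map ::
  "('x, 'y) homogeneous_scheme \<Rightarrow> 'a chart set \<Rightarrow> ('a \<Rightarrow> 'x) \<Rightarrow> bool" where
  "harmonic_map N C \<phi> \<longleftrightarrow> (\<forall>c\<in>C. harmonic_on N (in_chart c \<phi>) (chart_image c))"

end

theory Submission
  imports Defs
begin

text \<open>Choose a frame \<open>\<Phi>\<close> of the Legendrian Gauss map in a conformal chart. Its Maurer--Cartan form has
  imaginary diagonal and off-diagonal entries \<open>\<beta> = p dz + q d\<bar>z\<close> and \<open>\<gamma> = r dz + s d\<bar>z\<close>. That \<open>z\<close> is
  an oriented conformal coordinate of the second fundamental form means exactly that \<open>q\<close> and \<open>s\<close> are the
  multiples of the conjugates of \<open>r\<close> and \<open>p\<close> by one real function \<open>m\<close> with \<open>|m| < 1\<close>, and that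
  \<open>|r| < |p|\<close>. Then \<open>K + 1 = ((1 - m) / (1 + m))\<^sup>2\<close> and \<open>Q = (1 + m)\<^sup>2 p r\<close>, while either Gauss map is
  harmonic iff the covariant \<open>d\<bar>z\<close>-derivatives of \<open>p\<close> and \<open>r\<close> vanish. The structure equations
  express these two derivatives through each other and \<open>dm\<close>; solving them shows that harmonicity,
  the Cauchy--Riemann equation for \<open>Q\<close>, and \<open>dm = 0\<close> are equivalent at every single point. A frame
  of the Lagrangian Gauss map becomes a frame of the Legendrian one after a real diagonal gauge
  transformation, which only rescales the tension.\<close>

section \<open>Smooth maps between open sets\<close>

text \<open>The delicate implication runs from \<open>Q\<close> back to \<open>m\<close>, since
  holomorphy is a single complex equation. After the structure equations are solved for the
  derivatives of \<open>p\<close> and \<open>r\<close> (possible because m^2 < 1), it reads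
  \<open>2 * \<mu> * p * r + cnj \<mu> * (|p|^2 + |r|^2) = 0\<close>, where \<mu> is twice the
  dbar-derivative of \<open>m\<close>. Taking moduli gives
  \<open>|\<mu>| * (|p| - |r|)^2 = 0\<close>, so the strict inequality between |r| and |p|, which
  comes from the orientation, is what makes the conclusion possible. The first harmonic map equation
  carries no information. For oriented geodesics the bracket of off-diagonal matrices is diagonal
  and is projected away; for the unit tangent bundle the only surviving term is a real part, and it
  vanishes because the second fundamental form is symmetric. Frames exist only locally, but all
  comparisons are made with the differential of K + 1, which mentions no frame. Hence frames on
  overlapping domains never have to be matched, and connectedness is used only to pass from a
  vanishing differential to one constant on the whole surface.\<close>

lemma has_derivative_dd: "f differentiable at x \<Longrightarrow> (f has_derivative dd f x) (at x)"
  using frechet_derivative_works by blast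

lemma dd_eq: "(f has_derivative f') (at x) \<Longrightarrow> dd f x v = f' v"
  using frechet_derivative_at by metis

section \<open>Closure properties of the classes C^k on open sets\<close>

lemma Ck_on_cong:
  assumes "open S" "\<And>x. x \<in> S \<Longrightarrow> f x = g x" "Ck_on k f S"
  shows "Ck_on k g S"
  using assms(2,3)
proof (induction k arbitrary: f g)
  case 0
  then show ?case by (simp cong: continuous_on_cong)
next
  case (Suc k)
  have d: "f differentiable at x" if "x \<in> S" for x using Suc.prems that by simp
  have 1: "g differentiable at x" if "x \<in> S" for x
    using d[OF that] assms(1) Suc.prems(1) that
    by (metis differentiable_def has_derivative_transform_within_open)
  have 2: "frechet_derivative f (at x) v = frechet_derivative g (at x) v" if "x \<in> S" for x v
    using frechet_derivative_transform_within_open[OF d[OF that] assms(1) that] Suc.prems(1) by metis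
  have "Ck_on k (\<lambda>x. frechet_derivative g (at x) v) S" for v
    by (rule Suc.IH[where f="\<lambda>x. frechet_derivative f (at x) v"]) (use 2 Suc.prems in auto)
  with 1 show ?case by simp
qed

lemma Ck_on_subset: "Ck_on k f S \<Longrightarrow> T \<subseteq> S \<Longrightarrow> Ck_on k f T"
  by (induction k arbitrary: f) (auto intro: continuous_on_subset)

lemma Ck_on_SucD: "Ck_on (Suc k) f S \<Longrightarrow> Ck_on k f S"
proof (induction k arbitrary: f)
  case 0
  then show ?case
    by (auto intro!: continuous_at_imp_continuous_on differentiable_imp_continuous_within)
next
  case (Suc k)
  then show ?case by (metis Ck_on.simps(2))
qed

lemma Ck_on_local:
  assumes "\<And>x. x \<in> S \<Longrightarrow> \<exists>T. open T \<and> x \<in> T \<and> Ck_on k f T"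
  shows "Ck_on k f S"
  using assms
proof (induction k arbitrary: f)
  case 0
  show ?case
    unfolding Ck_on.simps
  proof (rule continuous_at_imp_continuous_on, rule ballI)
    fix x assume "x \<in> S"
    then obtain T where "open T" "x \<in> T" "continuous_on T f" using 0 by auto
    then show "isCont f x" by (simp add: continuous_on_eq_continuous_at)
  qed
next
  case (Suc k)
  have "f differentiable at x" if "x \<in> S" for x using Suc.prems[OF that] by auto
  moreover have "Ck_on k (\<lambda>x. frechet_derivative f (at x) v) S" for v
  proof (rule Suc.IH)
    fix x assume "x \<in> S"
    from Suc.prems[OF this] show "\<exists>T. open T \<and> x \<in> T \<and> Ck_on k (\<lambda>x. frechet_derivative f (at x) v) T"
      by auto
  qed
  ultimately show ?case by simp
qed

lemma Ck_on_const [simp]: "Ck_on k (\<lambda>x. c) S"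
  by (induction k arbitrary: c) auto

lemma Ck_on_bounded_linear_compose:
  assumes "bounded_linear L" "open S" "Ck_on k h S"
  shows "Ck_on k (\<lambda>x. L (h x)) S"
  using assms(3)
proof (induction k arbitrary: h)
  case 0
  then show ?case using assms(1) by (simp add: bounded_linear.continuous_on)
next
  case (Suc k)
  have D: "((\<lambda>x. L (h x)) has_derivative (\<lambda>v. L (frechet_derivative h (at x) v))) (at x)"
    if "x \<in> S" for x
    using Suc.prems that by (intro bounded_linear.has_derivative[OF assms(1)] has_derivative_dd) auto
  have "Ck_on k (\<lambda>x. frechet_derivative (\<lambda>x. L (h x)) (at x) v) S" for v
    by (rule Ck_on_cong[OF assms(2) _ Suc.IH[of "\<lambda>x. frechet_derivative h (at x) v"]])
      (use Suc.prems in \<open>auto simp: dd_eq[OF D]\<close>)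
  with D show ?case by (auto simp: differentiable_def)
qed

lemma Ck_on_add:
  assumes "open S" "Ck_on k f S" "Ck_on k g S"
  shows "Ck_on k (\<lambda>x. f x + g x) S"
  using assms(2,3)
proof (induction k arbitrary: f g)
  case 0
  then show ?case by (simp add: continuous_on_add)
next
  case (Suc k)
  have D: "((\<lambda>x. f x + g x) has_derivative
      (\<lambda>v. frechet_derivative f (at x) v + frechet_derivative g (at x) v)) (at x)"
    if "x \<in> S" for x
    using Suc.prems that by (intro has_derivative_add has_derivative_dd) auto
  have "Ck_on k (\<lambda>x. frechet_derivative (\<lambda>x. f x + g x) (at x) v) S" for v
    by (rule Ck_on_cong[OF assms(1) _
          Suc.IH[of "\<lambda>x. frechet_derivative f (at x) v" "\<lambda>x. frechet_derivative g (at x) v"]])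
      (use Suc.prems in \<open>auto simp: dd_eq[OF D]\<close>)
  with D show ?case by (auto simp: differentiable_def)
qed

lemma Ck_on_sum:
  assumes "open S" "\<And>i. i \<in> I \<Longrightarrow> Ck_on k (f i) S"
  shows "Ck_on k (\<lambda>x. \<Sum>i\<in>I. f i x) S"
  using assms(2) by (induction I rule: infinite_finite_induct) (auto intro: Ck_on_add assms(1))

text \<open>Each term of the product rule keeps one factor undifferentiated. That factor is lowered
  by one order, so that the induction hypothesis covers both factors.\<close>

lemma Ck_on_bilinear:
  assumes "bounded_bilinear pr" "open S" "Ck_on k f S" "Ck_on k g S"
  shows "Ck_on k (\<lambda>x. pr (f x) (g x)) S"
  using assms(3,4)
proof (induction k arbitrary: f g)
  case 0
  then show ?case using assms(1) by (simp add: bounded_bilinear.continuous_on)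
next
  case (Suc k)
  have D: "((\<lambda>x. pr (f x) (g x)) has_derivative
      (\<lambda>v. pr (f x) (frechet_derivative g (at x) v) + pr (frechet_derivative f (at x) v) (g x))) (at x)"
    if "x \<in> S" for x
    using Suc.prems that by (intro bounded_bilinear.FDERIV[OF assms(1)] has_derivative_dd) auto
  have "Ck_on k (\<lambda>x. frechet_derivative (\<lambda>x. pr (f x) (g x)) (at x) v) S" for v
    by (rule Ck_on_cong[OF assms(2) _ Ck_on_add[OF assms(2)
          Suc.IH[of "f" "\<lambda>x. frechet_derivative g (at x) v"]
          Suc.IH[of "\<lambda>x. frechet_derivative f (at x) v" "g"]]])
      (use Suc.prems Ck_on_SucD in \<open>auto simp: dd_eq[OF D] simp del: Ck_on.simps(1)\<close>)
  with D show ?case by (auto simp: differentiable_def)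
qed

lemmas Ck_on_mult = Ck_on_bilinear[OF bounded_bilinear_mult]
lemmas Ck_on_scaleR = Ck_on_bilinear[OF bounded_bilinear_scaleR]

text \<open>The chain rule evaluates the derivative of \<open>g\<close> in a direction that moves
  with the point, whereas \<open>Ck_on\<close> controls only fixed directions. Expanding the moving
  direction in an orthonormal basis, which is why the middle space is Euclidean, leaves a finite sum
  of scalar products to which the induction applies.\<close>

lemma Ck_on_compose:
  fixes g :: "'b::euclidean_space \<Rightarrow> 'c::real_normed_vector"
  assumes "open S" "open T" "h ` S \<subseteq> T" "Ck_on k g T" "Ck_on k h S"
  shows "Ck_on k (\<lambda>x. g (h x)) S"
  using assms(4,5)
proof (induction k arbitrary: g)
  case 0
  then show ?case using assms(3) by (auto intro: continuous_on_compose2)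
next
  case (Suc k)
  have D: "((\<lambda>x. g (h x)) has_derivative
      (\<lambda>v. frechet_derivative g (at (h x)) (frechet_derivative h (at x) v))) (at x)" if "x \<in> S" for x
    using Suc.prems that assms(3)
    by (intro diff_chain_at[of h _ x g, unfolded o_def] has_derivative_dd) auto
  have E: "frechet_derivative (\<lambda>x. g (h x)) (at x) v =
      (\<Sum>b\<in>Basis. (frechet_derivative h (at x) v \<bullet> b) *\<^sub>R frechet_derivative g (at (h x)) b)"
    if "x \<in> S" for x v
  proof -
    have l: "linear (frechet_derivative g (at (h x)))"
      using Suc.prems assms(3) that by (auto intro: linear_frechet_derivative)
    have "frechet_derivative (\<lambda>x. g (h x)) (at x) v =
        frechet_derivative g (at (h x)) (frechet_derivative h (at x) v)"
      by (rule dd_eq[OF D[OF that]])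
    also have "\<dots> = frechet_derivative g (at (h x))
        (\<Sum>b\<in>Basis. (frechet_derivative h (at x) v \<bullet> b) *\<^sub>R b)"
      by (simp add: euclidean_representation)
    finally show ?thesis by (simp add: linear_sum[OF l] linear_cmul[OF l])
  qed
  have "Ck_on k (\<lambda>x. frechet_derivative (\<lambda>x. g (h x)) (at x) v) S" for v
  proof (rule Ck_on_cong[OF assms(1)])
    show "Ck_on k (\<lambda>x. \<Sum>b\<in>Basis. (frechet_derivative h (at x) v \<bullet> b) *\<^sub>R
        frechet_derivative g (at (h x)) b) S"
      using Suc.prems Suc.IH Ck_on_SucD[OF Suc.prems(2)]
      by (intro Ck_on_sum Ck_on_scaleR assms(1)
            Ck_on_bounded_linear_compose[OF bounded_linear_inner_left]) auto
  qed (simp add: E)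
  with D show ?case by (auto simp: differentiable_def)
qed

text \<open>The family of all real powers is closed under differentiation up to constants, so the
  exponent varies in the induction. Exponents 1/2, -1/2 and -1 later supply square roots and
  inverses alike.\<close>

lemma Ck_on_powr: "Ck_on k (\<lambda>x::real. x powr a) {0<..}"
proof (induction k arbitrary: a)
  case 0
  then show ?case by (auto intro!: continuous_intros)
next
  case (Suc k)
  have D: "((\<lambda>x::real. x powr a) has_derivative (\<lambda>v. v * (a * x powr (a - 1)))) (at x)"
    if "x \<in> {0<..}" for x
    using has_real_derivative_powr[of x a] that by (simp add: has_field_derivative_def mult_commute_abs)
  have "Ck_on k (\<lambda>x::real. frechet_derivative (\<lambda>x. x powr a) (at x) v) {0<..}" for v
    by (rule Ck_on_cong[OF open_greaterThan _
          Ck_on_mult[OF open_greaterThan Ck_on_const[of k v] Ck_on_mult[OF open_greaterThan Ck_on_const[of k a] Suc.IH[of "a-1"]]]])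
      (auto simp: dd_eq[OF D])
  with D show ?case by (auto simp: differentiable_def)
qed

section \<open>Closure properties of smooth maps\<close>

lemma smooth_on_cong:
  "open S \<Longrightarrow> (\<And>x. x \<in> S \<Longrightarrow> f x = g x) \<Longrightarrow> smooth_on f S \<Longrightarrow> smooth_on g S"
  unfolding smooth_on_def using Ck_on_cong by blast

lemma smooth_on_subset: "smooth_on f S \<Longrightarrow> T \<subseteq> S \<Longrightarrow> smooth_on f T"
  unfolding smooth_on_def using Ck_on_subset by blast

lemma smooth_on_differentiable: "smooth_on f S \<Longrightarrow> x \<in> S \<Longrightarrow> f differentiable at x"
  unfolding smooth_on_def using Ck_on.simps(2) by blast

lemma smooth_on_derivative: "smooth_on f S \<Longrightarrow> smooth_on (\<lambda>x. frechet_derivative f (at x) v) S"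
  unfolding smooth_on_def using Ck_on.simps(2) by blast

lemma smooth_on_continuous: "smooth_on f S \<Longrightarrow> continuous_on S f"
  unfolding smooth_on_def using Ck_on.simps(1) by blast

lemma smooth_on_const: "smooth_on (\<lambda>x. c) S"
  by (simp add: smooth_on_def)

lemma smooth_on_bounded_linear:
  "bounded_linear L \<Longrightarrow> open S \<Longrightarrow> smooth_on h S \<Longrightarrow> smooth_on (\<lambda>x. L (h x)) S"
  unfolding smooth_on_def using Ck_on_bounded_linear_compose by blast

lemma smooth_on_add:
  "open S \<Longrightarrow> smooth_on f S \<Longrightarrow> smooth_on g S \<Longrightarrow> smooth_on (\<lambda>x. f x + g x) S"
  unfolding smooth_on_def using Ck_on_add by blast

lemma smooth_on_mult:
  fixes f g :: "'a::real_normed_vector \<Rightarrow> 'b::real_normed_algebra"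
  shows "open S \<Longrightarrow> smooth_on f S \<Longrightarrow> smooth_on g S \<Longrightarrow> smooth_on (\<lambda>x. f x * g x) S"
  unfolding smooth_on_def using Ck_on_mult by blast

lemma smooth_on_minus:
  fixes f :: "'a::real_normed_vector \<Rightarrow> 'b::real_normed_vector"
  shows "open S \<Longrightarrow> smooth_on f S \<Longrightarrow> smooth_on (\<lambda>x. - f x) S"
  by (rule smooth_on_bounded_linear[OF bounded_linear_minus[OF bounded_linear_ident]])

lemma smooth_on_diff:
  "open S \<Longrightarrow> smooth_on f S \<Longrightarrow> smooth_on g S \<Longrightarrow> smooth_on (\<lambda>x. f x - g x) S"
  using smooth_on_add[OF _ _ smooth_on_minus, of S f g] by simp

lemma smooth_on_compose:
  fixes g :: "'b::euclidean_space \<Rightarrow> 'c::real_normed_vector"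
  shows "open S \<Longrightarrow> open T \<Longrightarrow> h ` S \<subseteq> T \<Longrightarrow> smooth_on g T \<Longrightarrow> smooth_on h S \<Longrightarrow>
    smooth_on (\<lambda>x. g (h x)) S"
  unfolding smooth_on_def using Ck_on_compose by blast

lemma smooth_on_powr:
  fixes h :: "'a::real_normed_vector \<Rightarrow> real"
  assumes "open S" "smooth_on h S" "\<And>x. x \<in> S \<Longrightarrow> h x > 0"
  shows "smooth_on (\<lambda>x. h x powr a) S"
  by (rule smooth_on_compose[of S "{0<..}" h "\<lambda>x. x powr a"])
    (use assms Ck_on_powr in \<open>auto simp: smooth_on_def\<close>)

lemma smooth_on_local:
  assumes "\<And>x. x \<in> S \<Longrightarrow> \<exists>T. open T \<and> x \<in> T \<and> smooth_on f T"
  shows "smooth_on f S"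
  unfolding smooth_on_def
proof
  fix k show "Ck_on k f S" by (rule Ck_on_local) (use assms smooth_on_def in blast)
qed

text \<open>By the mean value theorem, the second difference of \<open>g\<close> over a square of side \<open>h\<close> is
  \<open>h\<^sup>2\<close> times the value of either mixed partial derivative somewhere in the square.\<close>

lemma mixed_partials_real:
  fixes g :: "complex \<Rightarrow> real"
  assumes "open U" "w \<in> U" "smooth_on g U"
  shows "dd (\<lambda>z. dd g z 1) w \<i> = dd (\<lambda>z. dd g z \<i>) w 1"
proof -
  define gx where "gx = (\<lambda>z. dd g z 1)"
  define gy where "gy = (\<lambda>z. dd g z \<i>)"
  define gxy where "gxy = (\<lambda>z. dd gx z \<i>)"
  define gyx where "gyx = (\<lambda>z. dd gy z 1)"
  have sx: "smooth_on gx U" and sy: "smooth_on gy U"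
    unfolding gx_def gy_def by (intro smooth_on_derivative assms)+
  have line: "((\<lambda>t. h (a + of_real t * v)) has_real_derivative dd h (a + of_real t * v) v) (at t)"
    if "smooth_on h U" "a + of_real t * v \<in> U" for h :: "complex \<Rightarrow> real" and a v and t :: real
  proof -
    have 1: "(h has_derivative dd h (a + of_real t * v)) (at (a + of_real t * v))"
      using smooth_on_differentiable[OF that] frechet_derivative_works by blast
    have 2: "((\<lambda>t. a + of_real t * v) has_derivative (\<lambda>s. of_real s * v)) (at t)"
      by (auto intro!: derivative_eq_intros)
    have 3: "linear (dd h (a + of_real t * v))"
      using smooth_on_differentiable[OF that] by (rule linear_frechet_derivative)
    have "dd h (a + of_real t * v) (of_real s * v) = dd h (a + of_real t * v) v * s" for s :: real
      using linear_cmul[OF 3, of s v] by (simp add: scaleR_conv_of_real mult.commute)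
    with diff_chain_at[OF 2 1] show ?thesis by (simp add: has_field_derivative_def o_def)
  qed
  have cx: "continuous_on U gxy" and cy: "continuous_on U gyx"
    unfolding gxy_def gyx_def by (intro smooth_on_continuous smooth_on_derivative sx sy)+
  have "gxy w = gyx w"
  proof (rule ccontr)
    assume ne: "gxy w \<noteq> gyx w"
    \<comment> \<open>Half the gap: one common value cannot be closer than \<open>e\<close> to both
      \<open>gxy w\<close> and \<open>gyx w\<close>.\<close>
    define e where "e = \<bar>gxy w - gyx w\<bar> / 2"
    have e: "e > 0" using ne by (simp add: e_def)
    from assms(1,2) obtain d0 where d0: "d0 > 0" "ball w d0 \<subseteq> U" by (meson open_contains_ball)
    from cx assms(2) e obtain d1 where d1: "d1 > 0" "\<And>z. z \<in> U \<Longrightarrow> dist z w < d1 \<Longrightarrow> dist (gxy z) (gxy w) < e"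
      unfolding continuous_on_iff by blast
    from cy assms(2) e obtain d2 where d2: "d2 > 0" "\<And>z. z \<in> U \<Longrightarrow> dist z w < d2 \<Longrightarrow> dist (gyx z) (gyx w) < e"
      unfolding continuous_on_iff by blast
    \<comment> \<open>A point of the square of side \<open>h\<close> is at distance at most 2h from
      the corner \<open>w\<close>; dividing by 3 keeps 2h below all three radii.\<close>
    define h where "h = min d0 (min d1 d2) / 3"
    have h: "h > 0" "2 * h < d0" "2 * h < d1" "2 * h < d2" using d0(1) d1(1) d2(1) by (auto simp: h_def)
    have near: "dist (w + of_real s + of_real t * \<i>) w \<le> 2 * h" if "0 \<le> s" "s \<le> h" "0 \<le> t" "t \<le> h" for s t
    proof -
      have "norm (of_real s + of_real t * \<i>) \<le> norm (of_real s :: complex) + norm (of_real t * \<i>)"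
        by (rule norm_triangle_ineq)
      also have "\<dots> = s + t" using that by (simp add: norm_mult)
      finally show ?thesis using that by (simp add: dist_norm algebra_simps)
    qed
    have inU: "w + of_real s + of_real t * \<i> \<in> U" if "0 \<le> s" "s \<le> h" "0 \<le> t" "t \<le> h" for s t
      using near[OF that] h d0(2) by (auto simp: subset_iff dist_commute)
    have inU': "w + of_real t * \<i> + of_real s \<in> U" if "0 \<le> s" "s \<le> h" "0 \<le> t" "t \<le> h" for s t
      using inU[OF that] by (simp add: algebra_simps)
    define \<Delta> where "\<Delta> = g (w + of_real h + of_real h * \<i>) - g (w + of_real h) - g (w + of_real h * \<i>) + g w"
    have "\<exists>s t. 0 \<le> s \<and> s \<le> h \<and> 0 \<le> t \<and> t \<le> h \<and> \<Delta> = h * (h * gxy (w + of_real s + of_real t * \<i>))"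
    proof -
      have "((\<lambda>t. g (w + of_real h * \<i> + of_real t * 1) - g (w + of_real t * 1)) has_real_derivative
          gx (w + of_real h * \<i> + of_real t * 1) - gx (w + of_real t * 1)) (at t)" if "0 \<le> t" "t \<le> h" for t
        unfolding gx_def using inU'[of t h] inU[of t 0] that h
        by (intro DERIV_diff line assms) auto
      from MVT2[OF h(1) this] obtain s where s: "0 < s" "s < h" and
        1: "\<Delta> = h * (gx (w + of_real h * \<i> + of_real s) - gx (w + of_real s))"
        unfolding \<Delta>_def by (auto simp: algebra_simps)
      have "((\<lambda>t. gx (w + of_real s + of_real t * \<i>)) has_real_derivative
          gxy (w + of_real s + of_real t * \<i>)) (at t)" if "0 \<le> t" "t \<le> h" for t
        unfolding gxy_def using inU[of s t] that s by (intro line sx) auto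
      from MVT2[OF h(1) this] obtain t where t: "0 < t" "t < h" and
        2: "gx (w + of_real s + of_real h * \<i>) - gx (w + of_real s) = h * gxy (w + of_real s + of_real t * \<i>)"
        by auto
      from 1 2 s t show ?thesis
        by (intro exI[of _ s] exI[of _ t]) (simp add: algebra_simps)
    qed
    then obtain s t where st: "0 \<le> s" "s \<le> h" "0 \<le> t" "t \<le> h"
      and 1: "\<Delta> = h * (h * gxy (w + of_real s + of_real t * \<i>))" by blast
    have "\<exists>s t. 0 \<le> s \<and> s \<le> h \<and> 0 \<le> t \<and> t \<le> h \<and> \<Delta> = h * (h * gyx (w + of_real s + of_real t * \<i>))"
    proof -
      have "((\<lambda>t. g (w + of_real h + of_real t * \<i>) - g (w + of_real t * \<i>)) has_real_derivative
          gy (w + of_real h + of_real t * \<i>) - gy (w + of_real t * \<i>)) (at t)" if "0 \<le> t" "t \<le> h" for t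
        unfolding gy_def using inU[of h t] inU[of 0 t] that h
        by (intro DERIV_diff line assms) auto
      from MVT2[OF h(1) this] obtain t where t: "0 < t" "t < h" and
        1: "\<Delta> = h * (gy (w + of_real h + of_real t * \<i>) - gy (w + of_real t * \<i>))"
        unfolding \<Delta>_def by (auto simp: algebra_simps)
      have "((\<lambda>s. gy (w + of_real t * \<i> + of_real s * 1)) has_real_derivative
          gyx (w + of_real t * \<i> + of_real s * 1)) (at s)" if "0 \<le> s" "s \<le> h" for s
        unfolding gyx_def using inU'[of s t] that t by (intro line sy) auto
      from MVT2[OF h(1) this] obtain s where s: "0 < s" "s < h" and
        2: "gy (w + of_real t * \<i> + of_real h) - gy (w + of_real t * \<i>) = h * gyx (w + of_real t * \<i> + of_real s)"
        by auto
      from 1 2 s t show ?thesis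
        by (intro exI[of _ s] exI[of _ t]) (simp add: algebra_simps)
    qed
    then obtain s' t' where st': "0 \<le> s'" "s' \<le> h" "0 \<le> t'" "t' \<le> h"
      and 2: "\<Delta> = h * (h * gyx (w + of_real s' + of_real t' * \<i>))" by blast
    from 1 2 h(1) have 3: "gxy (w + of_real s + of_real t * \<i>) = gyx (w + of_real s' + of_real t' * \<i>)" by simp
    have "dist (gxy (w + of_real s + of_real t * \<i>)) (gxy w) < e"
      using near[OF st] h by (intro d1 inU st) auto
    moreover have "dist (gyx (w + of_real s' + of_real t' * \<i>)) (gyx w) < e"
      using near[OF st'] h by (intro d2 inU st') auto
    ultimately have "\<bar>gxy w - gyx w\<bar> < 2 * e" using 3 by (simp add: dist_real_def)
    then show False by (simp add: e_def)
  qed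
  then show ?thesis by (simp add: gxy_def gyx_def gx_def gy_def)
qed

lemma dd_bounded_linear:
  assumes "bounded_linear L" "h differentiable at w"
  shows "dd (\<lambda>z. L (h z)) w u = L (dd h w u)"
proof -
  show ?thesis
    by (rule dd_eq) (intro bounded_linear.has_derivative[OF assms(1)] has_derivative_dd assms(2))
qed

lemma mixed_partials:
  fixes g :: "complex \<Rightarrow> complex"
  assumes "open U" "w \<in> U" "smooth_on g U"
  shows "dd (\<lambda>z. dd g z 1) w \<i> = dd (\<lambda>z. dd g z \<i>) w 1"
proof -
  \<comment> \<open>The mean value argument needs real values, so it is applied after a real linear
    functional, which commutes with both derivatives; \<open>Re\<close> and \<open>Im\<close>
    suffice.\<close>
  have *: "L (dd (\<lambda>z. dd g z 1) w \<i>) = L (dd (\<lambda>z. dd g z \<i>) w 1)" if L: "bounded_linear L" for L :: "complex \<Rightarrow> real"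
  proof -
    have d: "(\<lambda>z. dd g z u) differentiable at w" for u
      by (rule smooth_on_differentiable[OF smooth_on_derivative[OF assms(3)] assms(2)])
    have e: "dd (\<lambda>z. L (dd g z u)) w v = dd (\<lambda>z. dd (\<lambda>z. L (g z)) z u) w v" for u v
    proof -
      have "dd (\<lambda>z. L (dd g z u)) w = dd (\<lambda>z. dd (\<lambda>z. L (g z)) z u) w"
        by (rule frechet_derivative_transform_within_open[OF _ assms(1,2)])
          (auto simp: dd_bounded_linear[OF L smooth_on_differentiable[OF assms(3)]]
              intro!: smooth_on_differentiable[OF smooth_on_bounded_linear[OF L assms(1)] assms(2)]
                smooth_on_derivative[OF assms(3)])
      then show ?thesis by simp
    qed
    show ?thesis
      using mixed_partials_real[OF assms(1,2) smooth_on_bounded_linear[OF L assms(1,3)]]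
      by (simp add: dd_bounded_linear[OF L d, symmetric] e)
  qed
  show ?thesis using *[OF bounded_linear_Re] *[OF bounded_linear_Im] by (simp add: complex_eq_iff)
qed

section \<open>The action of the special linear group on Minkowski space\<close>

lemma mat2_eq_iff: "A = B \<longleftrightarrow> A $ 1 $ 1 = B $ 1 $ 1 \<and> A $ 1 $ 2 = B $ 1 $ 2 \<and> A $ 2 $ 1 = B $ 2 $ 1 \<and> A $ 2 $ 2 = B $ 2 $ 2"
  for A B :: "'a ^ 2 ^ 2"
  by (auto simp: vec_eq_iff forall_2)

lemma mult2_entry: "(A ** B) $ i $ j = A $ i $ 1 * B $ 1 $ j + A $ i $ 2 * B $ 2 $ j"
  for A B :: "'a::comm_ring_1 ^ 2 ^ 2"
  by (simp add: matrix_matrix_mult_def UNIV_2)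

lemma conj_transpose_entry [simp]: "conj_transpose g $ i $ j = cnj (g $ j $ i)"
  by (simp add: conj_transpose_def)

lemma herm_entry:
  "herm x $ 1 $ 1 = of_real (x $ 0 + x $ 1)"
  "herm x $ 1 $ 2 = of_real (x $ 3) - \<i> * of_real (x $ 2)"
  "herm x $ 2 $ 1 = of_real (x $ 3) + \<i> * of_real (x $ 2)"
  "herm x $ 2 $ 2 = of_real (x $ 0 - x $ 1)"
  by (simp_all add: herm_def E0_def E1_def E2_def E3_def, simp_all add: scaleR_conv_of_real)

lemma herm_add: "herm (x + y) = herm x + herm y"
  by (simp add: mat2_eq_iff herm_entry algebra_simps)

lemma herm_scaleR: "herm (r *\<^sub>R x) = r *\<^sub>R herm x"
  by (simp add: mat2_eq_iff herm_entry) (simp add: scaleR_conv_of_real algebra_simps)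

lemma bounded_linear_herm: "bounded_linear herm"
  by (intro linear_conv_bounded_linear[THEN iffD1] linearI herm_add herm_scaleR)

lemma conj_transpose_herm: "conj_transpose (herm x) = herm x"
  by (simp add: mat2_eq_iff herm_entry)

lemma axis_entry:
  "(axis 0 1 :: vec4) $ 0 = 1" "(axis 0 1 :: vec4) $ 1 = 0" "(axis 0 1 :: vec4) $ 2 = 0" "(axis 0 1 :: vec4) $ 3 = 0"
  "(axis 1 1 :: vec4) $ 0 = 0" "(axis 1 1 :: vec4) $ 1 = 1" "(axis 1 1 :: vec4) $ 2 = 0" "(axis 1 1 :: vec4) $ 3 = 0"
  by (simp_all add: axis_def)

lemma herm_surj:
  assumes "conj_transpose M = M"
  shows "\<exists>y. herm y = M"
proof -
  define y :: vec4 where "y = (\<chi> i. if i = 0 then (Re (M $ 1 $ 1) + Re (M $ 2 $ 2)) / 2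
     else if i = 1 then (Re (M $ 1 $ 1) - Re (M $ 2 $ 2)) / 2
     else if i = 2 then Im (M $ 2 $ 1) else Re (M $ 2 $ 1))"
  have y: "y $ 0 = (Re (M $ 1 $ 1) + Re (M $ 2 $ 2)) / 2" "y $ 1 = (Re (M $ 1 $ 1) - Re (M $ 2 $ 2)) / 2"
     "y $ 2 = Im (M $ 2 $ 1)" "y $ 3 = Re (M $ 2 $ 1)"
    by (simp_all add: y_def)
  from assms have "cnj (M $ j $ i) = M $ i $ j" for i j
    by (metis conj_transpose_entry)
  from this[of 1 1] this[of 2 2] this[of 1 2]
  have "herm y = M"
    by (auto simp: mat2_eq_iff herm_entry y complex_eq_iff field_simps)
  then show ?thesis ..
qed

lemma conj_transpose_mult: "conj_transpose (A ** B) = conj_transpose B ** conj_transpose A"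
  by (simp add: mat2_eq_iff mult2_entry mult.commute)

lemma conj_transpose_conj_transpose [simp]: "conj_transpose (conj_transpose A) = A"
  by (simp add: mat2_eq_iff)

lemma det_conj_transpose: "det (conj_transpose A) = cnj (det A)"
  by (simp add: det_2)

text \<open>This discharges the definite description in \<open>sl2_act\<close>:
  \<open>g ** herm x ** conj_transpose g\<close> is again Hermitian, which gives existence, and
  \<open>inj_herm\<close> gives uniqueness.\<close>

lemma herm_sl2_act: "herm (sl2_act g x) = g ** herm x ** conj_transpose g"
proof -
  have "conj_transpose (g ** herm x ** conj_transpose g) = g ** herm x ** conj_transpose g"
    by (simp add: conj_transpose_mult conj_transpose_herm matrix_mul_assoc)
  from herm_surj[OF this] obtain y where y: "herm y = g ** herm x ** conj_transpose g" ..
  have "sl2_act g x = y"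
    unfolding sl2_act_def using y by (intro the_equality) (auto intro!: injD[OF inj_herm])
  with y show ?thesis by simp
qed

lemma sl2_act_eq_iff: "sl2_act g x = y \<longleftrightarrow> g ** herm x ** conj_transpose g = herm y"
  using herm_sl2_act[of g x] inj_herm by (metis injD)

lemma sl2_act_add: "sl2_act g (x + y) = sl2_act g x + sl2_act g y"
  by (simp add: sl2_act_eq_iff herm_add herm_sl2_act) (simp add: mat2_eq_iff mult2_entry algebra_simps)

lemma sl2_act_scaleR: "sl2_act g (r *\<^sub>R x) = r *\<^sub>R sl2_act g x"
  by (simp add: sl2_act_eq_iff herm_scaleR herm_sl2_act)
     (simp add: mat2_eq_iff mult2_entry, simp add: scaleR_conv_of_real algebra_simps)

lemma mink_add_left: "mink (x + y) z = mink x z + mink y z"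
  and mink_add_right: "mink z (x + y) = mink z x + mink z y"
  by (simp_all add: mink_def algebra_simps)

lemma mink_scaleR_left: "mink (r *\<^sub>R x) z = r * mink x z"
  and mink_scaleR_right: "mink z (r *\<^sub>R x) = r * mink z x"
  for x z :: vec4
  by (simp_all add: mink_def algebra_simps)

lemma mink_commute: "mink x y = mink y x"
  by (simp add: mink_def algebra_simps)

lemma mink_polarization:
  "2 * complex_of_real (mink x y) = det (herm x) + det (herm y) - det (herm (x + y))"
  by (simp add: det_herm mink_add_left mink_add_right mink_commute)

text \<open>The quadratic form is minus the determinant, which is multiplicative; polarization
  extends its invariance to the bilinear form.\<close>

lemma mink_sl2_act:
  assumes "det g = 1"
  shows "mink (sl2_act g x) (sl2_act g y) = mink x y"
proof -
  have "det (herm (sl2_act g z)) = det (herm z)" for z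
    by (simp add: herm_sl2_act det_mul det_conj_transpose assms)
  then have "2 * complex_of_real (mink (sl2_act g x) (sl2_act g y)) = 2 * complex_of_real (mink x y)"
    unfolding mink_polarization by (simp flip: sl2_act_add)
  then show ?thesis by simp
qed

lemma mink_axis:
  "mink (axis 0 1 :: vec4) (axis 0 1) = - 1" "mink (axis 1 1 :: vec4) (axis 1 1) = 1"
  "mink (axis 1 1 :: vec4) (axis 0 1) = 0" "mink (axis 0 1 :: vec4) (axis 1 1) = 0"
  by (simp_all add: mink_def axis_entry)

lemma hyperbolic3_iff: "x \<in> hyperbolic3 \<longleftrightarrow> mink x x = - 1 \<and> x $ 0 > 0"
proof -
  have "det (herm x) = 1 \<longleftrightarrow> complex_of_real (mink x x) = complex_of_real (- 1)"
    unfolding det_herm by (auto simp: minus_equation_iff)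
  moreover have "Re (trace (herm x)) = 2 * x $ 0"
    by (simp add: trace_def UNIV_2 herm_entry)
  ultimately show ?thesis unfolding hyperbolic3_def by (auto simp del: of_real_minus)
qed

text \<open>For \<open>|n\<^sub>0| < f\<^sub>0\<close>, multiply out \<open>f\<^sub>0\<^sup>2 n\<^sub>0\<^sup>2 \<le> (f\<^sub>0\<^sup>2 - 1) (n\<^sub>0\<^sup>2 + 1)\<close>, which is the Cauchy--Schwarz inequality
  for the spatial parts.\<close>

lemma timelike_dominates:
  fixes f n :: vec4
  assumes "mink f f = - 1" "f $ 0 > 0" "mink n n = 1" "mink n f = 0"
  shows "\<bar>n $ 0\<bar> < f $ 0"
proof -
  define s where "s = f $ 1 * n $ 1 + f $ 2 * n $ 2 + f $ 3 * n $ 3"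
  have s: "f $ 0 * n $ 0 = s" using assms(4) by (simp add: mink_def s_def algebra_simps)
  have F: "(f$1)^2 + (f$2)^2 + (f$3)^2 = (f$0)^2 - 1"
    and N: "(n$1)^2 + (n$2)^2 + (n$3)^2 = (n$0)^2 + 1"
    using assms(1,3) by (simp_all add: mink_def power2_eq_square)
  have "((f$1)^2 + (f$2)^2 + (f$3)^2) * ((n$1)^2 + (n$2)^2 + (n$3)^2) - s^2
      = (f$1 * n$2 - f$2 * n$1)^2 + (f$1 * n$3 - f$3 * n$1)^2 + (f$2 * n$3 - f$3 * n$2)^2"
    by (simp add: s_def power2_eq_square algebra_simps)
  also have "\<dots> \<ge> 0" by simp
  finally have "s^2 \<le> ((f$0)^2 - 1) * ((n$0)^2 + 1)" using F N by simp
  then have "(n$0)^2 < (f$0)^2" unfolding s[symmetric] by (simp add: power_mult_distrib algebra_simps)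
  then show ?thesis using assms(2) abs_le_square_iff[of "f $ 0" "n $ 0"] by linarith
qed

section \<open>Smoothness of matrix-valued maps\<close>

definition mat2_of :: "complex \<Rightarrow> complex \<Rightarrow> complex \<Rightarrow> complex \<Rightarrow> mat2" where
  "mat2_of a b c d = vector [vector [a, b], vector [c, d]]"

lemma mat2_of_entry [simp]:
  "mat2_of a b c d $ 1 $ 1 = a" "mat2_of a b c d $ 1 $ 2 = b"
  "mat2_of a b c d $ 2 $ 1 = c" "mat2_of a b c d $ 2 $ 2 = d"
  by (simp_all add: mat2_of_def)

lemma bounded_linear_mat2_of:
  "bounded_linear (\<lambda>z. mat2_of z 0 0 0)" "bounded_linear (\<lambda>z. mat2_of 0 z 0 0)"
  "bounded_linear (\<lambda>z. mat2_of 0 0 z 0)" "bounded_linear (\<lambda>z. mat2_of 0 0 0 z)"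
  by (intro linear_conv_bounded_linear[THEN iffD1] linearI; simp add: mat2_eq_iff)+

lemma mat2_of_sum: "mat2_of a b c d = mat2_of a 0 0 0 + mat2_of 0 b 0 0 + mat2_of 0 0 c 0 + mat2_of 0 0 0 d"
  by (simp add: mat2_eq_iff)

lemma smooth_on_mat2_of:
  assumes "open S" "smooth_on a S" "smooth_on b S" "smooth_on c S" "smooth_on d S"
  shows "smooth_on (\<lambda>w. mat2_of (a w) (b w) (c w) (d w)) S"
  by (rule smooth_on_cong[OF assms(1) mat2_of_sum[symmetric]])
    (intro smooth_on_add assms(1) smooth_on_bounded_linear[OF bounded_linear_mat2_of(1)]
      smooth_on_bounded_linear[OF bounded_linear_mat2_of(2)] smooth_on_bounded_linear[OF bounded_linear_mat2_of(3)]
      smooth_on_bounded_linear[OF bounded_linear_mat2_of(4)] assms)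

lemma bounded_linear_entry: "bounded_linear (\<lambda>M :: mat2. M $ i $ j)"
  by (intro bounded_linear_compose[OF bounded_linear_vec_nth] bounded_linear_vec_nth)

lemma smooth_on_entry: "open S \<Longrightarrow> smooth_on M S \<Longrightarrow> smooth_on (\<lambda>w. (M w :: mat2) $ i $ j) S"
  by (rule smooth_on_bounded_linear[OF bounded_linear_entry])

lemma smooth_on_cnj: "open S \<Longrightarrow> smooth_on h S \<Longrightarrow> smooth_on (\<lambda>w. cnj (h w)) S"
  by (rule smooth_on_bounded_linear[OF bounded_linear_cnj])

lemma smooth_on_of_real: "open S \<Longrightarrow> smooth_on h S \<Longrightarrow> smooth_on (\<lambda>w. complex_of_real (h w)) S"
  by (rule smooth_on_bounded_linear[OF bounded_linear_of_real])

lemma smooth_on_vec_nth: "open S \<Longrightarrow> smooth_on h S \<Longrightarrow> smooth_on (\<lambda>w. (h w :: vec4) $ i) S"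
  by (rule smooth_on_bounded_linear[OF bounded_linear_vec_nth])

lemmas smooth_intros = smooth_on_mat2_of smooth_on_add smooth_on_diff smooth_on_minus smooth_on_mult
  smooth_on_cnj smooth_on_of_real smooth_on_vec_nth smooth_on_const smooth_on_entry

lemma action_UH3_iff:
  "action UH3 g (base_point UH3) = (x, v) \<longleftrightarrow> sl2_act g (axis 0 1) = x \<and> sl2_act g (axis 1 1) = v"
  by (simp add: UH3_def)

text \<open>The base vectors \<open>axis 0 1\<close> and \<open>axis 1 1\<close> are the identity
  and diag(1, -1). If a and b are the columns of \<open>g\<close>, their images are therefore a a* +
  b b* and a a* - b b*, so half the sum and half the difference of the images have rank one.\<close>

lemma sl2_act_axis0_iff:
  "sl2_act g (axis 0 1) = x \<longleftrightarrow>
    g$1$1 * cnj (g$1$1) + g$1$2 * cnj (g$1$2) = herm x $ 1 $ 1 \<and>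
    g$1$1 * cnj (g$2$1) + g$1$2 * cnj (g$2$2) = herm x $ 1 $ 2 \<and>
    g$2$1 * cnj (g$1$1) + g$2$2 * cnj (g$1$2) = herm x $ 2 $ 1 \<and>
    g$2$1 * cnj (g$2$1) + g$2$2 * cnj (g$2$2) = herm x $ 2 $ 2"
  by (simp add: sl2_act_eq_iff mat2_eq_iff mult2_entry herm_entry(1-4)[of "axis 0 1"] axis_entry)

lemma sl2_act_axis1_iff:
  "sl2_act g (axis 1 1) = x \<longleftrightarrow>
    g$1$1 * cnj (g$1$1) - g$1$2 * cnj (g$1$2) = herm x $ 1 $ 1 \<and>
    g$1$1 * cnj (g$2$1) - g$1$2 * cnj (g$2$2) = herm x $ 1 $ 2 \<and>
    g$2$1 * cnj (g$1$1) - g$2$2 * cnj (g$1$2) = herm x $ 2 $ 1 \<and>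
    g$2$1 * cnj (g$2$1) - g$2$2 * cnj (g$2$2) = herm x $ 2 $ 2"
  by (simp add: sl2_act_eq_iff mat2_eq_iff mult2_entry herm_entry(1-4)[of "axis 1 1"] axis_entry)

text \<open>The determinant conditions in entries, in the polynomial form that
  \<open>algebra\<close> can use. The third is the mixed term of the determinant and says that f + n
  is a null vector.\<close>

lemma herm_constraints:
  assumes "mink f f = - 1" "mink n n = 1" "mink n f = 0"
  shows "herm f $ 1 $ 1 * herm f $ 2 $ 2 - herm f $ 1 $ 2 * herm f $ 2 $ 1 = 1"
    and "herm n $ 1 $ 1 * herm n $ 2 $ 2 - herm n $ 1 $ 2 * herm n $ 2 $ 1 = - 1"
    and "herm f $ 1 $ 1 * herm n $ 2 $ 2 + herm f $ 2 $ 2 * herm n $ 1 $ 1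
       - herm f $ 1 $ 2 * herm n $ 2 $ 1 - herm f $ 2 $ 1 * herm n $ 1 $ 2 = 0"
proof -
  show 1: "herm f $ 1 $ 1 * herm f $ 2 $ 2 - herm f $ 1 $ 2 * herm f $ 2 $ 1 = 1"
    using det_herm[of f] assms by (simp add: det_2)
  show 2: "herm n $ 1 $ 1 * herm n $ 2 $ 2 - herm n $ 1 $ 2 * herm n $ 2 $ 1 = - 1"
    using det_herm[of n] assms by (simp add: det_2)
  have "det (herm f + herm n) = 0"
    using mink_polarization[of n f] assms by (simp add: det_herm herm_add add.commute)
  then show "herm f $ 1 $ 1 * herm n $ 2 $ 2 + herm f $ 2 $ 2 * herm n $ 1 $ 1
       - herm f $ 1 $ 2 * herm n $ 2 $ 1 - herm f $ 2 $ 1 * herm n $ 1 $ 2 = 0"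
    using 1 2 unfolding det_2 vector_add_component by algebra
qed

text \<open>The first column \<open>a\<close> of a frame satisfies \<open>a a\<^sup>* = (f + n)/2\<close>; the second one is then determined:
  it is orthogonal to \<open>a\<close> with respect to \<open>f\<^sup>-\<^sup>1\<close>.\<close>

lemma frame_of_column:
  assumes "mink f f = - 1" "mink n n = 1" "mink n f = 0"
    and a: "2 * (a1 * cnj a1) = herm f $ 1 $ 1 + herm n $ 1 $ 1"
      "2 * (a1 * cnj a2) = herm f $ 1 $ 2 + herm n $ 1 $ 2"
      "2 * (a2 * cnj a2) = herm f $ 2 $ 2 + herm n $ 2 $ 2"
    and g: "g = mat2_of a1 (herm f $ 1 $ 2 * cnj a1 - herm f $ 1 $ 1 * cnj a2)
             a2 (herm f $ 2 $ 2 * cnj a1 - herm f $ 2 $ 1 * cnj a2)"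
  shows "det g = 1 \<and> sl2_act g (axis 0 1) = f \<and> sl2_act g (axis 1 1) = n"
proof -
  define F11 F12 F21 F22 N11 N12 N21 N22 where d: "F11 = herm f $ 1 $ 1" "F12 = herm f $ 1 $ 2" "F21 = herm f $ 2 $ 1" "F22 = herm f $ 2 $ 2"
    "N11 = herm n $ 1 $ 1" "N12 = herm n $ 1 $ 2" "N21 = herm n $ 2 $ 1" "N22 = herm n $ 2 $ 2"
  have c: "cnj F11 = F11" "cnj F12 = F21" "cnj F21 = F12" "cnj F22 = F22" "cnj N11 = N11" "cnj N12 = N21"
     "cnj N21 = N12" "cnj N22 = N22"
    unfolding d by (simp_all add: herm_entry)
  note k = herm_constraints[OF assms(1-3), folded d]
  note a' = a[folded d]
  have a21: "2 * (a2 * cnj a1) = F21 + N21"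
    using arg_cong[OF a'(2), of cnj] c by (simp add: mult.commute)
  \<comment> \<open>With the conjugates of \<open>a1\<close> and \<open>a2\<close> named as
    independent unknowns, the claims become polynomial consequences of \<open>k\<close>,
    \<open>a'\<close> and \<open>a21\<close>, free of conjugation.\<close>
  define b1 b2 where b: "b1 = cnj a1" "b2 = cnj a2"
  have cb: "cnj b1 = a1" "cnj b2 = a2" by (simp_all add: b)
  have 1: "a1 * (F22 * b1 - F21 * b2) - (F12 * b1 - F11 * b2) * a2 = 1"
    using k a' a21 unfolding b[symmetric] by algebra
  have 2: "2 * ((F12 * b1 - F11 * b2) * (F21 * a1 - F11 * a2)) = F11 - N11"
    using k a' a21 unfolding b[symmetric] by algebra
  have 3: "2 * ((F12 * b1 - F11 * b2) * (F22 * a1 - F12 * a2)) = F12 - N12"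
    using k a' a21 unfolding b[symmetric] by algebra
  have 4: "2 * ((F22 * b1 - F21 * b2) * (F21 * a1 - F11 * a2)) = F21 - N21"
    using k a' a21 unfolding b[symmetric] by algebra
  have 5: "2 * ((F22 * b1 - F21 * b2) * (F22 * a1 - F12 * a2)) = F22 - N22"
    using k a' a21 unfolding b[symmetric] by algebra
  show ?thesis
    unfolding sl2_act_axis0_iff sl2_act_axis1_iff det_2 g mat2_of_entry d[symmetric] complex_cnj_diff complex_cnj_mult
      c complex_cnj_cnj b[symmetric] cb
    using 1 2 3 4 5 a' a21 unfolding b[symmetric] by (intro conjI; algebra)
qed

text \<open>\<open>h1\<close>, \<open>h2\<close> and \<open>k\<close> are the entries (1,1), (2,2)
  and (2,1) of the Hermitian matrix (f + n)/2. It has determinant zero because f + n is null, so it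
  equals a a* for a column a. Extracting a smoothly means dividing by the square root of a positive
  diagonal entry; which entry is positive depends on the point, so the frame is only local.\<close>

lemma ex_legendrian_frame:
  assumes "open U" "smooth_on f U" "smooth_on n U"
    and c: "\<And>w. w \<in> U \<Longrightarrow> mink (f w) (f w) = - 1" "\<And>w. w \<in> U \<Longrightarrow> f w $ 0 > 0"
      "\<And>w. w \<in> U \<Longrightarrow> mink (n w) (n w) = 1" "\<And>w. w \<in> U \<Longrightarrow> mink (n w) (f w) = 0"
    and "w \<in> U"
  shows "\<exists>W. open W \<and> w \<in> W \<and> W \<subseteq> U \<and> (\<exists>\<Phi>. local_frame UH3 (\<lambda>z. (f z, n z)) W \<Phi>)"
proof -
  define h1 where "h1 = (\<lambda>z. (f z $ 0 + f z $ 1 + n z $ 0 + n z $ 1) / 2)"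
  define h2 where "h2 = (\<lambda>z. (f z $ 0 - f z $ 1 + n z $ 0 - n z $ 1) / 2)"
  define k where "k = (\<lambda>z. (of_real (f z $ 3 + n z $ 3) + \<i> * of_real (f z $ 2 + n z $ 2)) / 2)"
  have h: "herm (f z) $ 1 $ 1 + herm (n z) $ 1 $ 1 = 2 * of_real (h1 z)"
    "herm (f z) $ 2 $ 2 + herm (n z) $ 2 $ 2 = 2 * of_real (h2 z)"
    "herm (f z) $ 1 $ 2 + herm (n z) $ 1 $ 2 = 2 * cnj (k z)" for z
    by (simp_all add: herm_entry h1_def h2_def k_def algebra_simps)
  have null: "k z * cnj (k z) = of_real (h1 z * h2 z)" if "z \<in> U" for z
  proof -
    have "mink (f z + n z) (f z + n z) = 0"
      using c(1,3,4)[OF that] by (simp add: mink_add_left mink_add_right mink_commute)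
    then have "(f z $ 3 + n z $ 3)^2 + (f z $ 2 + n z $ 2)^2 = (2 * h1 z) * (2 * h2 z)"
      by (simp add: mink_def h1_def h2_def algebra_simps power2_eq_square)
    from arg_cong[OF this, of complex_of_real] show ?thesis unfolding complex_mult_cnj k_def
      by (simp add: power_divide field_simps)
  qed
  have sh: "smooth_on h1 U" "smooth_on h2 U" "smooth_on k U"
    unfolding h1_def h2_def k_def divide_inverse
    by (intro smooth_intros assms)+
  \<comment> \<open>\<open>h1 + h2\<close> is the time component of f + n, which is positive because
    |n0| < f0.\<close>
  have pos: "h1 w > 0 \<or> h2 w > 0"
    using timelike_dominates[OF c[OF assms(8)]] by (auto simp: h1_def h2_def)
  have frame: "\<exists>\<Phi>. local_frame UH3 (\<lambda>z. (f z, n z)) W \<Phi>"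
    if W: "open W" "W \<subseteq> U" and s: "smooth_on a1 W" "smooth_on a2 W"
      and a: "\<And>z. z \<in> W \<Longrightarrow> a1 z * cnj (a1 z) = of_real (h1 z)" "\<And>z. z \<in> W \<Longrightarrow> a2 z * cnj (a2 z) = of_real (h2 z)"
       "\<And>z. z \<in> W \<Longrightarrow> a1 z * cnj (a2 z) = cnj (k z)" for W a1 a2
  proof -
    define \<Phi> where "\<Phi> = (\<lambda>z. mat2_of (a1 z) (herm (f z) $ 1 $ 2 * cnj (a1 z) - herm (f z) $ 1 $ 1 * cnj (a2 z))
             (a2 z) (herm (f z) $ 2 $ 2 * cnj (a1 z) - herm (f z) $ 2 $ 1 * cnj (a2 z)))"
    have "smooth_on \<Phi> W"
      unfolding \<Phi>_def herm_entry
      by (intro smooth_intros W s smooth_on_subset[OF assms(2) W(2)])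
    moreover have "det (\<Phi> z) = 1 \<and> sl2_act (\<Phi> z) (axis 0 1) = f z \<and> sl2_act (\<Phi> z) (axis 1 1) = n z"
      if "z \<in> W" for z
      using that W(2) unfolding \<Phi>_def
      by (intro frame_of_column[of "f z" "n z" "a1 z" "a2 z"]) (auto simp: c a h)
    ultimately show ?thesis unfolding local_frame_def action_UH3_iff by blast
  qed
  have pw: "x powr (1/2) * x powr (1/2) = x" "x powr (1/2) * x powr (-1/2) = 1" "x powr (-1/2) * x powr (-1/2) = 1 / x"
    if "x > 0" for x :: real
    using that by (simp_all flip: powr_add add: powr_minus_divide)
  show ?thesis using pos
  proof
    assume p: "h1 w > 0"
    define W where "W = U \<inter> h1 -` {0<..}"
    have W: "open W" "w \<in> W" "W \<subseteq> U" "\<And>z. z \<in> W \<Longrightarrow> h1 z > 0"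
      using continuous_open_preimage[OF smooth_on_continuous[OF sh(1)] assms(1) open_greaterThan[of 0]] p assms(8)
      by (auto simp: W_def)
    have "\<exists>\<Phi>. local_frame UH3 (\<lambda>z. (f z, n z)) W \<Phi>"
    proof (rule frame[OF W(1,3), of "\<lambda>z. of_real (h1 z powr (1/2))" "\<lambda>z. k z * of_real (h1 z powr (-1/2))"])
      show "smooth_on (\<lambda>z. complex_of_real (h1 z powr (1/2))) W"
        "smooth_on (\<lambda>z. k z * complex_of_real (h1 z powr (-1/2))) W"
        by (intro smooth_intros smooth_on_powr smooth_on_subset[OF _ W(3)] sh W; assumption)+
      fix z assume z: "z \<in> W"
      show "complex_of_real (h1 z powr (1/2)) * cnj (of_real (h1 z powr (1/2))) = of_real (h1 z)"
        using pw(1)[OF W(4)[OF z]] by (simp flip: of_real_mult)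
      have "k z * complex_of_real (h1 z powr (- 1 / 2)) * cnj (k z * complex_of_real (h1 z powr (- 1 / 2))) =
         (k z * cnj (k z)) * of_real (h1 z powr (- 1 / 2) * h1 z powr (- 1 / 2))" by simp
      also have "\<dots> = of_real (h1 z * h2 z) * of_real (1 / h1 z)"
        unfolding pw(3)[OF W(4)[OF z]] using null z W(3) by auto
      also have "\<dots> = of_real (h2 z)" using W(4)[OF z] by simp
      finally show "k z * complex_of_real (h1 z powr (- 1 / 2)) * cnj (k z * complex_of_real (h1 z powr (- 1 / 2))) = of_real (h2 z)" .
      have "complex_of_real (h1 z powr (1/2)) * cnj (k z * complex_of_real (h1 z powr (- 1 / 2)))
        = cnj (k z) * of_real (h1 z powr (1/2) * h1 z powr (-1/2))" by simp
      then show "complex_of_real (h1 z powr (1/2)) * cnj (k z * complex_of_real (h1 z powr (- 1 / 2))) = cnj (k z)"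
        unfolding pw(2)[OF W(4)[OF z]] by simp
    qed
    with W show ?thesis by blast
  next
    assume p: "h2 w > 0"
    define W where "W = U \<inter> h2 -` {0<..}"
    have W: "open W" "w \<in> W" "W \<subseteq> U" "\<And>z. z \<in> W \<Longrightarrow> h2 z > 0"
      using continuous_open_preimage[OF smooth_on_continuous[OF sh(2)] assms(1) open_greaterThan[of 0]] p assms(8)
      by (auto simp: W_def)
    have "\<exists>\<Phi>. local_frame UH3 (\<lambda>z. (f z, n z)) W \<Phi>"
    proof (rule frame[OF W(1,3), of "\<lambda>z. cnj (k z) * of_real (h2 z powr (-1/2))" "\<lambda>z. of_real (h2 z powr (1/2))"])
      show "smooth_on (\<lambda>z. complex_of_real (h2 z powr (1/2))) W"
        "smooth_on (\<lambda>z. cnj (k z) * complex_of_real (h2 z powr (-1/2))) W"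
        by (intro smooth_intros smooth_on_powr smooth_on_subset[OF _ W(3)] sh W; assumption)+
      fix z assume z: "z \<in> W"
      show "complex_of_real (h2 z powr (1/2)) * cnj (of_real (h2 z powr (1/2))) = of_real (h2 z)"
        using pw(1)[OF W(4)[OF z]] by (simp flip: of_real_mult)
      have "cnj (k z) * complex_of_real (h2 z powr (- 1 / 2)) * cnj (cnj (k z) * complex_of_real (h2 z powr (- 1 / 2))) =
         (k z * cnj (k z)) * of_real (h2 z powr (- 1 / 2) * h2 z powr (- 1 / 2))" by simp
      also have "\<dots> = of_real (h1 z * h2 z) * of_real (1 / h2 z)"
        unfolding pw(3)[OF W(4)[OF z]] using null z W(3) by auto
      also have "\<dots> = of_real (h1 z)" using W(4)[OF z] by simp
      finally show "cnj (k z) * complex_of_real (h2 z powr (- 1 / 2)) * cnj (cnj (k z) * complex_of_real (h2 z powr (- 1 / 2))) = of_real (h1 z)" .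
      have "cnj (k z) * complex_of_real (h2 z powr (- 1 / 2)) * cnj (complex_of_real (h2 z powr (1/2)))
        = cnj (k z) * of_real (h2 z powr (1/2) * h2 z powr (-1/2))" by simp
      then show "cnj (k z) * complex_of_real (h2 z powr (- 1 / 2)) * cnj (complex_of_real (h2 z powr (1/2))) = cnj (k z)"
        unfolding pw(2)[OF W(4)[OF z]] by simp
    qed
    with W show ?thesis by blast
  qed
qed

section \<open>Orientation and pointwise algebra\<close>

definition rows4 :: "vec4 \<Rightarrow> vec4 \<Rightarrow> vec4 \<Rightarrow> vec4 \<Rightarrow> real ^ 4 ^ 4" where
  "rows4 x0 x1 x2 x3 = (\<chi> i. if i = 0 then x0 else if i = 1 then x1 else if i = 2 then x2 else x3)"

text \<open>The expansion lists the indices as 0, 1, 2, 3, with 0 in the role of 4. Rows and columns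
  are relabelled together, so no sign appears.\<close>

lemma det_4:
  fixes M :: "'a::comm_ring_1 ^ 4 ^ 4"
  shows "det M =
    M$0$0 * (M$1$1 * (M$2$2 * M$3$3 - M$2$3 * M$3$2) - M$1$2 * (M$2$1 * M$3$3 - M$2$3 * M$3$1) + M$1$3 * (M$2$1 * M$3$2 - M$2$2 * M$3$1))
  - M$0$1 * (M$1$0 * (M$2$2 * M$3$3 - M$2$3 * M$3$2) - M$1$2 * (M$2$0 * M$3$3 - M$2$3 * M$3$0) + M$1$3 * (M$2$0 * M$3$2 - M$2$2 * M$3$0))
  + M$0$2 * (M$1$0 * (M$2$1 * M$3$3 - M$2$3 * M$3$1) - M$1$1 * (M$2$0 * M$3$3 - M$2$3 * M$3$0) + M$1$3 * (M$2$0 * M$3$1 - M$2$1 * M$3$0))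
  - M$0$3 * (M$1$0 * (M$2$1 * M$3$2 - M$2$2 * M$3$1) - M$1$1 * (M$2$0 * M$3$2 - M$2$2 * M$3$0) + M$1$2 * (M$2$0 * M$3$1 - M$2$1 * M$3$0))"
proof -
  have U: "(UNIV :: 4 set) = {0, 1, 2, 3}"
  proof -
    have "(4 :: 4) = 0" by simp
    then show ?thesis using UNIV_4 by (metis insert_commute)
  qed
  have f: "finite {1::4, 2, 3}" "0 \<notin> {1::4, 2, 3}" "finite {2::4, 3}" "1 \<notin> {2::4, 3}" "finite {3::4}" "2 \<notin> {3::4}" "finite ({}::4 set)" "3 \<notin> ({}::4 set)"
    by auto
  show ?thesis
    unfolding det_def U
    unfolding sum_over_permutations_insert[OF f(1,2)]
    unfolding sum_over_permutations_insert[OF f(3,4)]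
    unfolding sum_over_permutations_insert[OF f(5,6)]
    unfolding permutes_sing
    by (simp add: sign_swap_id permutation_swap_id sign_compose sign_id Transposition.transpose_def permutation_compose) (simp add: algebra_simps)
qed

text \<open>The adjugate. It reverses products of arbitrary matrices, singular ones included, and
  inverts those of determinant one; this makes the Maurer-Cartan form polynomial in a frame and its
  derivatives.\<close>

definition adj2 :: "mat2 \<Rightarrow> mat2" where
  "adj2 X = mat2_of (X $ 2 $ 2) (- X $ 1 $ 2) (- X $ 2 $ 1) (X $ 1 $ 1)"

lemma adj2_mult: "adj2 (A ** B) = adj2 B ** adj2 A"
  by (simp add: adj2_def mat2_eq_iff mult2_entry algebra_simps)

lemma mat_1_entry: "(mat 1 :: mat2) $ 1 $ 1 = 1" "(mat 1 :: mat2) $ 1 $ 2 = 0"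
  "(mat 1 :: mat2) $ 2 $ 1 = 0" "(mat 1 :: mat2) $ 2 $ 2 = 1"
  by (simp_all add: mat_def)

lemma mult_adj2: "det A = 1 \<Longrightarrow> A ** adj2 A = mat 1"
  and adj2_mult_self: "det A = 1 \<Longrightarrow> adj2 A ** A = mat 1"
  by (simp_all add: adj2_def mat2_eq_iff mult2_entry mat_1_entry det_2 algebra_simps)

lemma matrix_inv_left:
  fixes A :: "'a::semiring_1 ^ 'n ^ 'm"
  assumes "invertible A"
  shows "matrix_inv A ** A = mat 1"
  using assms unfolding invertible_def matrix_inv_def by (rule someI2_ex) simp

lemma matrix_inv_eq_adj2:
  assumes "det A = 1"
  shows "matrix_inv A = adj2 A"
proof -
  have "invertible A"
    using mult_adj2[OF assms] adj2_mult_self[OF assms] by (auto simp: invertible_def)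
  then have "matrix_inv A ** A = mat 1" by (rule matrix_inv_left)
  then show ?thesis
    by (metis matrix_mul_assoc matrix_mul_lid matrix_mul_rid mult_adj2[OF assms])
qed

text \<open>Since \<open>adj2 (g X g\<^sup>*) = adj2 g\<^sup>* adj2 X adj2 g\<close>, the trace is visibly invariant under \<open>g\<close> with
  determinant one.\<close>

lemma det_rows4_trace:
  "Im (trace (herm x0 ** adj2 (herm x1) ** herm x2 ** adj2 (herm x3))) = - 2 * det (rows4 x0 x1 x2 x3)"
proof -
  have "det (rows4 x0 x1 x2 x3) =
    x0$0 * (x1$1 * (x2$2 * x3$3 - x2$3 * x3$2) - x1$2 * (x2$1 * x3$3 - x2$3 * x3$1) + x1$3 * (x2$1 * x3$2 - x2$2 * x3$1))
  - x0$1 * (x1$0 * (x2$2 * x3$3 - x2$3 * x3$2) - x1$2 * (x2$0 * x3$3 - x2$3 * x3$0) + x1$3 * (x2$0 * x3$2 - x2$2 * x3$0))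
  + x0$2 * (x1$0 * (x2$1 * x3$3 - x2$3 * x3$1) - x1$1 * (x2$0 * x3$3 - x2$3 * x3$0) + x1$3 * (x2$0 * x3$1 - x2$1 * x3$0))
  - x0$3 * (x1$0 * (x2$1 * x3$2 - x2$2 * x3$1) - x1$1 * (x2$0 * x3$2 - x2$2 * x3$0) + x1$2 * (x2$0 * x3$1 - x2$1 * x3$0))"
    unfolding det_4 rows4_def by simp
  then show ?thesis
    by (simp add: trace_def UNIV_2 mult2_entry adj2_def herm_entry) (simp add: algebra_simps)
qed

lemma det_rows4_sl2_act:
  assumes "det g = 1"
  shows "det (rows4 (sl2_act g x0) (sl2_act g x1) (sl2_act g x2) (sl2_act g x3)) = det (rows4 x0 x1 x2 x3)"
proof -
  let ?s = "conj_transpose g"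
  have s: "det ?s = 1" using assms by (simp add: det_conj_transpose)
  have "herm (sl2_act g x0) ** adj2 (herm (sl2_act g x1)) ** herm (sl2_act g x2) ** adj2 (herm (sl2_act g x3)) =
    g ** herm x0 ** (?s ** adj2 ?s) ** adj2 (herm x1) ** (adj2 g ** g) ** herm x2 ** (?s ** adj2 ?s) ** adj2 (herm x3) ** adj2 g"
    by (simp add: herm_sl2_act adj2_mult matrix_mul_assoc)
  also have "\<dots> = g ** (herm x0 ** adj2 (herm x1) ** herm x2 ** adj2 (herm x3) ** adj2 g)"
    by (simp add: mult_adj2 adj2_mult_self assms s matrix_mul_assoc)
  finally have "trace (herm (sl2_act g x0) ** adj2 (herm (sl2_act g x1)) ** herm (sl2_act g x2) ** adj2 (herm (sl2_act g x3)))
    = trace (g ** (herm x0 ** adj2 (herm x1) ** herm x2 ** adj2 (herm x3) ** adj2 g))"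
    by (rule arg_cong)
  also have "\<dots> = trace (herm x0 ** adj2 (herm x1) ** herm x2 ** adj2 (herm x3) ** (adj2 g ** g))"
    by (subst trace_mul_sym) (simp add: matrix_mul_assoc)
  also have "\<dots> = trace (herm x0 ** adj2 (herm x1) ** herm x2 ** adj2 (herm x3))"
    by (simp add: adj2_mult_self assms)
  finally show ?thesis
    using det_rows4_trace[of "sl2_act g x0" "sl2_act g x1" "sl2_act g x2" "sl2_act g x3"] det_rows4_trace[of x0 x1 x2 x3]
    by simp
qed

section \<open>Algebra of the Maurer-Cartan coefficients at one point\<close>

lemma cmod_sum_sq: "(cmod (a + b))\<^sup>2 = (cmod a)\<^sup>2 + (cmod b)\<^sup>2 + 2 * Re (a * cnj b)"
  unfolding cmod_power2 by (simp add: power2_eq_square algebra_simps)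

text \<open>The hypotheses encode the second form and the orientation: 1 is the vanishing of its
  dz^2-coefficient, 2 its symmetry, 3 the positivity of its trace, and 4 the positivity of the
  Jacobian. From 1 one gets \<open>q * cnj p = cnj r * s\<close>, and with 2 the product p s turns
  out to be real, so \<open>s\<close> is a real multiple of \<open>cnj p\<close>. Then 4 reads (1 +
  m)^2 (|p|^2 - |r|^2) > 0 and 3 reads (1 - m^2) (|p|^2 - |r|^2) > 0.\<close>

lemma conformal_coefficients:
  fixes p q r s :: complex and \<rho> :: real
  assumes 1: "p * cnj q = r * cnj s" and 2: "Im (p * s - q * r) = 0"
    and 3: "(cmod p)\<^sup>2 + (cmod q)\<^sup>2 - (cmod r)\<^sup>2 - (cmod s)\<^sup>2 > 0"
    and 4: "cmod (p + cnj s) > cmod (q + cnj r)"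
  defines "m \<equiv> Re (s * p) / (cmod p)\<^sup>2"
  shows "s = m * cnj p" "q = m * cnj r" "\<bar>m\<bar> < 1" "cmod r < cmod p"
proof -
  have o4: "(cmod p)\<^sup>2 + (cmod s)\<^sup>2 + 2 * Re (p * s) > (cmod q)\<^sup>2 + (cmod r)\<^sup>2 + 2 * Re (q * r)"
    using power_strict_mono[OF 4, of 2] by (simp add: cmod_sum_sq)
  have p: "p \<noteq> 0"
  proof
    assume p: "p = 0"
    with 1 consider "r = 0" | "s = 0" by auto
    then show False
    proof cases
      case 1 then show False using 3 o4 p by simp
    next
      case 2 then show False using 4 p by simp
    qed
  qed
  have n: "z * cnj z = of_real ((cmod z)\<^sup>2)" for z by (rule complex_norm_square[symmetric])
  have q: "q * cnj p = cnj r * s" using arg_cong[OF 1, of cnj] by (simp add: mult.commute)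
  have "q * r * of_real ((cmod p)\<^sup>2) = (q * cnj p) * r * p"
    unfolding n[symmetric] by (simp add: mult_ac)
  also have "\<dots> = p * s * of_real ((cmod r)\<^sup>2)"
    unfolding q n[symmetric] by (simp add: mult_ac)
  finally have "(p * s - q * r) * of_real ((cmod p)\<^sup>2) = p * s * of_real ((cmod p)\<^sup>2 - (cmod r)\<^sup>2)"
    by (simp add: algebra_simps)
  from arg_cong[OF this, of Im] have "Im (p * s) * ((cmod p)\<^sup>2 - (cmod r)\<^sup>2) = Im (p * s - q * r) * (cmod p)\<^sup>2"
    by (metis Im_complex_of_real Re_complex_of_real add_cancel_left_left mult_zero_right times_complex.sel(2))
  then have im: "Im (p * s) * ((cmod p)\<^sup>2 - (cmod r)\<^sup>2) = 0" unfolding 2 by simp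
  have qs: "cmod q * cmod p = cmod r * cmod s"
    using arg_cong[OF q, of cmod] by (simp add: norm_mult)
  \<comment> \<open>Equality would force |q| = |s| through \<open>qs\<close> and make the left side
    of 3 vanish.\<close>
  have "(cmod p)\<^sup>2 \<noteq> (cmod r)\<^sup>2"
  proof
    assume "(cmod p)\<^sup>2 = (cmod r)\<^sup>2"
    then have "cmod p = cmod r" by (simp add: power2_eq_iff_nonneg)
    with qs p have "cmod q = cmod s" by auto
    with 3 \<open>cmod p = cmod r\<close> show False by simp
  qed
  with im have "Im (p * s) = 0" by simp
  then have "s * p = of_real (Re (s * p))" by (simp add: complex_eq_iff mult.commute)
  also have "\<dots> = of_real m * (p * cnj p)"
    unfolding n m_def using p by simp
  finally show s: "s = m * cnj p" using p by simp
  have "q * cnj p = (m * cnj r) * cnj p" using q unfolding s by (simp add: mult_ac)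
  then show q': "q = m * cnj r" using p by (metis complex_cnj_zero_iff mult_right_cancel)
  have "(1 + m)\<^sup>2 * ((cmod p)\<^sup>2 - (cmod r)\<^sup>2) > 0"
  proof -
    have "(cmod q)\<^sup>2 = m\<^sup>2 * (cmod r)\<^sup>2" "(cmod s)\<^sup>2 = m\<^sup>2 * (cmod p)\<^sup>2"
      by (simp_all add: s q' norm_mult power_mult_distrib)
    moreover have "Re (p * s) = m * (cmod p)\<^sup>2" "Re (q * r) = m * (cmod r)\<^sup>2"
      unfolding s q' cmod_power2 by (simp_all add: power2_eq_square algebra_simps)
    ultimately show ?thesis using o4 by (simp add: power2_eq_square algebra_simps)
  qed
  then have pr: "(cmod p)\<^sup>2 - (cmod r)\<^sup>2 > 0" by (simp add: zero_less_mult_iff)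
  then show "cmod r < cmod p" using power2_less_imp_less[of "cmod r" "cmod p"] by simp
  have "(1 - m\<^sup>2) * ((cmod p)\<^sup>2 - (cmod r)\<^sup>2) > 0"
    using 3 unfolding s q' by (simp add: norm_mult power_mult_distrib algebra_simps)
  with pr have "m\<^sup>2 < 1" by (simp add: zero_less_mult_iff)
  then show "\<bar>m\<bar> < 1" by (simp add: abs_square_less_1)
qed

text \<open>\<open>X\<close> and \<open>Y\<close> stand for the covariant dbar-derivatives of p and
  r, and \<mu> for that of m, all doubled. Inserting the conjugate of each equation into the other
  gives \<open>X'\<close> and \<open>Y'\<close>, which express both unknowns through \<mu>. The
  expression in the second claim is the dbar-derivative of (1 + m)^2 p r.\<close>

lemma structure_equations_rigidity:
  fixes X Y \<mu> p r :: complex and m :: real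
  assumes X: "X = cnj (\<mu> * r + m * Y)" and Y: "Y = cnj (\<mu> * p + m * X)"
    and m: "\<bar>m\<bar> < 1" and pr: "cmod r < cmod p"
  shows "X = 0 \<and> Y = 0 \<longleftrightarrow> \<mu> = 0"
    and "2 * (1 + m) * \<mu> * p * r + (1 + m)\<^sup>2 * (Y * p + r * X) = 0 \<longleftrightarrow> \<mu> = 0"
proof -
  have p: "p \<noteq> 0" using pr by auto
  have m2: "1 - m\<^sup>2 \<noteq> 0" using m by (simp add: abs_square_less_1[symmetric])
  define M where "M = complex_of_real m"
  have M: "1 - M * M \<noteq> 0" "cnj M = M" "1 + M \<noteq> 0" "1 - M \<noteq> 0"
    using m2 m unfolding M_def by (auto simp: complex_eq_iff power2_eq_square)
  have Xd: "X = cnj \<mu> * cnj r + M * cnj Y" and Yd: "Y = cnj \<mu> * cnj p + M * cnj X"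
    using X Y unfolding M_def[symmetric] by (simp_all only: complex_cnj_add complex_cnj_mult M(2))
  have Xc: "cnj X = \<mu> * r + M * Y"
    using arg_cong[OF X, of cnj] unfolding M_def complex_cnj_cnj .
  have Yc: "cnj Y = \<mu> * p + M * X"
    using arg_cong[OF Y, of cnj] unfolding M_def complex_cnj_cnj .
  have X': "X * (1 - M * M) = cnj \<mu> * cnj r + M * \<mu> * p"
    using Xc Yc Xd by algebra
  have Y': "Y * (1 - M * M) = cnj \<mu> * cnj p + M * \<mu> * r"
    using Xc Yc Yd by algebra
  show a: "X = 0 \<and> Y = 0 \<longleftrightarrow> \<mu> = 0"
  proof
    assume "X = 0 \<and> Y = 0" then show "\<mu> = 0" using Yc p by auto
  next
    assume "\<mu> = 0" then show "X = 0 \<and> Y = 0" using X' Y' M(1) by simp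
  qed
  show "2 * (1 + m) * \<mu> * p * r + (1 + m)\<^sup>2 * (Y * p + r * X) = 0 \<longleftrightarrow> \<mu> = 0"
  proof
    assume "\<mu> = 0" then show "2 * (1 + m) * \<mu> * p * r + (1 + m)\<^sup>2 * (Y * p + r * X) = 0" using a by simp
  next
    assume "2 * (1 + m) * \<mu> * p * r + (1 + m)\<^sup>2 * (Y * p + r * X) = 0"
    then have "(1 + M) * (2 * \<mu> * p * r + (1 + M) * (Y * p + r * X)) = 0"
      by (simp add: M_def power2_eq_square algebra_simps)
    \<comment> \<open>The factor 1 - M completes 1 - M^2, so that \<open>X'\<close> and
      \<open>Y'\<close> can be inserted; all terms containing \<open>M\<close> then cancel.\<close>
    then have "(1 - M) * (2 * \<mu> * p * r + (1 + M) * (Y * p + r * X)) = 0" using M(3) by simp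
    then have "2 * \<mu> * p * r + cnj \<mu> * (p * cnj p + r * cnj r) = 0"
      using X' Y' by algebra
    then have "cnj \<mu> * of_real ((cmod p)\<^sup>2 + (cmod r)\<^sup>2) = - (2 * \<mu> * p * r)"
      unfolding of_real_add complex_norm_square by (simp add: eq_neg_iff_add_eq_0 add.commute)
    from arg_cong[OF this, of cmod]
    have "cmod \<mu> * ((cmod p)\<^sup>2 + (cmod r)\<^sup>2) = 2 * cmod \<mu> * cmod p * cmod r"
      by (simp add: norm_mult flip: of_real_add of_real_power)
    then have "cmod \<mu> * (cmod p - cmod r)\<^sup>2 = 0" by (simp add: power2_eq_square algebra_simps)
    then show "\<mu> = 0" using pr by auto
  qed
qed

section \<open>Maurer--Cartan form and tension field\<close>

text \<open>\<open>frechet_derivative\<close> is a choice from the predicate of being a derivative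
  at \<open>w\<close>, and that predicate depends only on the germ. Hence no differentiability has
  to be known.\<close>

lemma dd_cong:
  assumes "open W" "w \<in> W" "\<And>z. z \<in> W \<Longrightarrow> f z = g z"
  shows "dd f w = dd g w"
proof -
  have "(f has_derivative D) (at w) \<longleftrightarrow> (g has_derivative D) (at w)" for D
    using has_derivative_transform_within_open[OF _ assms(1,2), of f D UNIV g]
      has_derivative_transform_within_open[OF _ assms(1,2), of g D UNIV f] assms(3) by auto
  then show ?thesis by (simp add: frechet_derivative_def)
qed

lemma dd_add: "f differentiable at w \<Longrightarrow> g differentiable at w \<Longrightarrow>
    dd (\<lambda>z. f z + g z) w u = dd f w u + dd g w u"
  by (rule dd_eq) (intro has_derivative_add has_derivative_dd)

lemma dd_diff: "f differentiable at w \<Longrightarrow> g differentiable at w \<Longrightarrow>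
    dd (\<lambda>z. f z - g z) w u = dd f w u - dd g w u"
  by (rule dd_eq) (intro has_derivative_diff has_derivative_dd)

lemma dd_minus: "f differentiable at w \<Longrightarrow> dd (\<lambda>z. - f z) w u = - dd f w u"
  by (rule dd_eq) (intro has_derivative_minus has_derivative_dd)

lemma dd_mult:
  fixes f g :: "'a::real_normed_vector \<Rightarrow> 'b::real_normed_algebra"
  shows "f differentiable at w \<Longrightarrow> g differentiable at w \<Longrightarrow>
    dd (\<lambda>z. f z * g z) w u = f w * dd g w u + dd f w u * g w"
  by (rule dd_eq) (intro has_derivative_mult has_derivative_dd)

lemma dd_entry: "M differentiable at w \<Longrightarrow> dd (\<lambda>z. (M z :: mat2) $ i $ j) w u = dd M w u $ i $ j"
  by (rule dd_bounded_linear[OF bounded_linear_entry])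

lemma dd_coordinates:
  fixes h :: "complex \<Rightarrow> 'b::real_normed_vector"
  assumes "h differentiable at w"
  shows "dd h w u = Re u *\<^sub>R dd h w 1 + Im u *\<^sub>R dd h w \<i>"
proof -
  have l: "linear (dd h w)" using assms by (rule linear_frechet_derivative)
  have "u = Re u *\<^sub>R 1 + Im u *\<^sub>R \<i>" by (simp add: complex_eq_iff)
  then have "dd h w u = dd h w (Re u *\<^sub>R 1 + Im u *\<^sub>R \<i>)" by simp
  then show ?thesis by (simp add: linear_add[OF l] linear_cmul[OF l])
qed

lemma dd_mat2_of:
  assumes "a differentiable at w" "b differentiable at w" "c differentiable at w" "d differentiable at w"
  shows "dd (\<lambda>z. mat2_of (a z) (b z) (c z) (d z)) w u = mat2_of (dd a w u) (dd b w u) (dd c w u) (dd d w u)"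
proof (rule dd_eq)
  have "((\<lambda>z. mat2_of (a z) 0 0 0 + mat2_of 0 (b z) 0 0 + mat2_of 0 0 (c z) 0 + mat2_of 0 0 0 (d z)) has_derivative
    (\<lambda>u. mat2_of (dd a w u) 0 0 0 + mat2_of 0 (dd b w u) 0 0 + mat2_of 0 0 (dd c w u) 0 + mat2_of 0 0 0 (dd d w u))) (at w)"
    by (intro has_derivative_add has_derivative_dd assms bounded_linear.has_derivative[OF bounded_linear_mat2_of(1)]
      bounded_linear.has_derivative[OF bounded_linear_mat2_of(2)] bounded_linear.has_derivative[OF bounded_linear_mat2_of(3)]
      bounded_linear.has_derivative[OF bounded_linear_mat2_of(4)])
  then show "((\<lambda>z. mat2_of (a z) (b z) (c z) (d z)) has_derivative
      (\<lambda>u. mat2_of (dd a w u) (dd b w u) (dd c w u) (dd d w u))) (at w)"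
    by (simp flip: mat2_of_sum)
qed

abbreviation mc :: "(complex \<Rightarrow> mat2) \<Rightarrow> complex \<Rightarrow> 2 \<Rightarrow> 2 \<Rightarrow> complex \<Rightarrow> complex" where
  "mc \<Phi> u i j \<equiv> \<lambda>z. maurer_cartan \<Phi> z u $ i $ j"

text \<open>A frame without its target space: frames of both Gauss maps are instances, so
  Maurer-Cartan form and tension are developed once for both.\<close>

locale sl2_map =
  fixes W :: "complex set" and \<Phi> :: "complex \<Rightarrow> mat2"
  assumes open_W: "open W" and smooth: "smooth_on \<Phi> W" and det_1: "z \<in> W \<Longrightarrow> det (\<Phi> z) = 1"
begin

lemma diff: "z \<in> W \<Longrightarrow> \<Phi> differentiable at z"
  using smooth smooth_on_differentiable by blast

lemma smooth_entry: "smooth_on (\<lambda>z. \<Phi> z $ i $ j) W"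
  by (intro smooth_intros open_W smooth)

lemma maurer_cartan_eq: "z \<in> W \<Longrightarrow> maurer_cartan \<Phi> z u = adj2 (\<Phi> z) ** dd \<Phi> z u"
  by (simp add: maurer_cartan_def matrix_inv_eq_adj2 det_1)

lemma dd_eq_mult: "z \<in> W \<Longrightarrow> dd \<Phi> z u = \<Phi> z ** maurer_cartan \<Phi> z u"
  by (simp add: maurer_cartan_eq matrix_mul_assoc mult_adj2 det_1)

lemma smooth_mc: "smooth_on (mc \<Phi> u i j) W"
proof (rule smooth_on_cong[OF open_W])
  show "smooth_on (\<lambda>z. adj2 (\<Phi> z) $ i $ 1 * dd \<Phi> z u $ 1 $ j + adj2 (\<Phi> z) $ i $ 2 * dd \<Phi> z u $ 2 $ j) W"
    unfolding adj2_def
    by (intro smooth_intros open_W smooth smooth_on_derivative)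
qed (simp add: maurer_cartan_eq mult2_entry)

lemma diff_mc: "z \<in> W \<Longrightarrow> mc \<Phi> u i j differentiable at z"
  using smooth_mc smooth_on_differentiable by blast

lemma maurer_cartan_coordinates:
  assumes "z \<in> W"
  shows "maurer_cartan \<Phi> z u = Re u *\<^sub>R maurer_cartan \<Phi> z 1 + Im u *\<^sub>R maurer_cartan \<Phi> z \<i>"
  unfolding maurer_cartan_eq[OF assms] dd_coordinates[OF diff[OF assms], of u]
  by (simp add: mat2_eq_iff mult2_entry) (simp add: scaleR_conv_of_real algebra_simps)

lemma mc_coordinates:
  "z \<in> W \<Longrightarrow> mc \<Phi> u i j z = of_real (Re u) * mc \<Phi> 1 i j z + of_real (Im u) * mc \<Phi> \<i> i j z"
  by (subst maurer_cartan_coordinates) (simp_all add: scaleR_conv_of_real[where 'a=complex])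

lemma det_entries: "z \<in> W \<Longrightarrow> \<Phi> z $ 1 $ 1 * \<Phi> z $ 2 $ 2 - \<Phi> z $ 1 $ 2 * \<Phi> z $ 2 $ 1 = 1"
  using det_1[of z] by (simp add: det_2)

lemma dd_det:
  assumes "z \<in> W"
  shows "\<Phi> z $ 1 $ 1 * dd \<Phi> z u $ 2 $ 2 + dd \<Phi> z u $ 1 $ 1 * \<Phi> z $ 2 $ 2
    - (\<Phi> z $ 1 $ 2 * dd \<Phi> z u $ 2 $ 1 + dd \<Phi> z u $ 1 $ 2 * \<Phi> z $ 2 $ 1) = 0"
proof -
  have "dd (\<lambda>z. \<Phi> z $ 1 $ 1 * \<Phi> z $ 2 $ 2 - \<Phi> z $ 1 $ 2 * \<Phi> z $ 2 $ 1) z u = dd (\<lambda>z. 1 :: complex) z u"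
    using dd_cong[OF open_W assms det_entries] by simp
  moreover have "(\<lambda>z. \<Phi> z $ i $ j) differentiable at z" for i j
    using smooth_entry assms smooth_on_differentiable by blast
  ultimately show ?thesis
    by (simp add: dd_diff dd_mult differentiable_mult dd_entry diff assms)
qed

lemma trace_maurer_cartan:
  assumes "z \<in> W"
  shows "mc \<Phi> u 2 2 z = - mc \<Phi> u 1 1 z"
  using dd_det[OF assms, of u]
  by (simp add: maurer_cartan_eq assms mult2_entry adj2_def algebra_simps)

text \<open>The off-diagonal entries of d\<alpha> + \<alpha> \<and> \<alpha> = 0, evaluated on the
  vectors 1 and \<i>. The factors 2 and -2 arise because the trace vanishes, so the two diagonal
  entries are opposite. Second derivatives cancel by symmetry; the rest follows from det = 1 and its
  derivative.\<close>

lemma structure_equations: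
  assumes w: "w \<in> W"
  shows "dd (mc \<Phi> \<i> 1 2) w 1 - dd (mc \<Phi> 1 1 2) w \<i>
      + 2 * (mc \<Phi> 1 1 1 w * mc \<Phi> \<i> 1 2 w - mc \<Phi> \<i> 1 1 w * mc \<Phi> 1 1 2 w) = 0" (is ?th1)
    and "dd (mc \<Phi> \<i> 2 1) w 1 - dd (mc \<Phi> 1 2 1) w \<i>
      - 2 * (mc \<Phi> 1 1 1 w * mc \<Phi> \<i> 2 1 w - mc \<Phi> \<i> 1 1 w * mc \<Phi> 1 2 1 w) = 0" (is ?th2)
proof -
  have d0: "(\<lambda>z. \<Phi> z $ i $ j) differentiable at w" for i j
    using smooth_entry w smooth_on_differentiable by blast
  have d1: "(\<lambda>z. dd \<Phi> z u $ i $ j) differentiable at w" for u i j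
    by (rule smooth_on_differentiable[OF _ w]) (intro smooth_intros open_W smooth_on_derivative smooth)
  have sym: "dd (\<lambda>z. dd \<Phi> z 1 $ i $ j) w \<i> = dd (\<lambda>z. dd \<Phi> z \<i> $ i $ j) w 1" for i j
  proof -
    have "dd (\<lambda>z. dd \<Phi> z u $ i $ j) w = dd (\<lambda>z. dd (\<lambda>z. \<Phi> z $ i $ j) z u) w" for u
      by (rule dd_cong[OF open_W w]) (simp add: dd_entry diff)
    then show ?thesis using mixed_partials[OF open_W w smooth_entry[of i j]] by simp
  qed
  have b: "dd (mc \<Phi> u 1 2) w v = \<Phi> w $ 2 $ 2 * dd (\<lambda>z. dd \<Phi> z u $ 1 $ 2) w v + dd \<Phi> w v $ 2 $ 2 * dd \<Phi> w u $ 1 $ 2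
      - (\<Phi> w $ 1 $ 2 * dd (\<lambda>z. dd \<Phi> z u $ 2 $ 2) w v + dd \<Phi> w v $ 1 $ 2 * dd \<Phi> w u $ 2 $ 2)" for u v
  proof -
    have "dd (mc \<Phi> u 1 2) w = dd (\<lambda>z. \<Phi> z $ 2 $ 2 * dd \<Phi> z u $ 1 $ 2 - \<Phi> z $ 1 $ 2 * dd \<Phi> z u $ 2 $ 2) w"
      by (rule dd_cong[OF open_W w]) (simp add: maurer_cartan_eq mult2_entry adj2_def)
    then show ?thesis
      by (simp add: dd_diff dd_mult differentiable_mult d0 d1) (simp add: dd_entry diff w)
  qed
  have c: "dd (mc \<Phi> u 2 1) w v = \<Phi> w $ 1 $ 1 * dd (\<lambda>z. dd \<Phi> z u $ 2 $ 1) w v + dd \<Phi> w v $ 1 $ 1 * dd \<Phi> w u $ 2 $ 1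
      - (\<Phi> w $ 2 $ 1 * dd (\<lambda>z. dd \<Phi> z u $ 1 $ 1) w v + dd \<Phi> w v $ 2 $ 1 * dd \<Phi> w u $ 1 $ 1)" for u v
  proof -
    have "dd (mc \<Phi> u 2 1) w = dd (\<lambda>z. \<Phi> z $ 1 $ 1 * dd \<Phi> z u $ 2 $ 1 - \<Phi> z $ 2 $ 1 * dd \<Phi> z u $ 1 $ 1) w"
      by (rule dd_cong[OF open_W w]) (simp add: maurer_cartan_eq mult2_entry adj2_def)
    then show ?thesis
      by (simp add: dd_diff dd_mult differentiable_mult d0 d1) (simp add: dd_entry diff w)
  qed
  have m: "maurer_cartan \<Phi> w u $ 1 $ 1 = \<Phi> w $ 2 $ 2 * dd \<Phi> w u $ 1 $ 1 - \<Phi> w $ 1 $ 2 * dd \<Phi> w u $ 2 $ 1"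
    "maurer_cartan \<Phi> w u $ 1 $ 2 = \<Phi> w $ 2 $ 2 * dd \<Phi> w u $ 1 $ 2 - \<Phi> w $ 1 $ 2 * dd \<Phi> w u $ 2 $ 2"
    "maurer_cartan \<Phi> w u $ 2 $ 1 = \<Phi> w $ 1 $ 1 * dd \<Phi> w u $ 2 $ 1 - \<Phi> w $ 2 $ 1 * dd \<Phi> w u $ 1 $ 1" for u
    by (simp_all add: maurer_cartan_eq w mult2_entry adj2_def)
  show ?th1 unfolding b m sym using det_entries[OF w] dd_det[OF w, of 1] dd_det[OF w, of \<i>] by algebra
  show ?th2 unfolding c m sym using det_entries[OF w] dd_det[OF w, of 1] dd_det[OF w, of \<i>] by algebra
qed

text \<open>The (1,2)-entry of the second harmonic map equation on the pair 1, \<i>, for an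
  off-diagonal \<alpha>p. The term with factor 2 is the adjoint action of the diagonal part.\<close>

definition tension12 :: "complex \<Rightarrow> complex" where
  "tension12 w = dd (mc \<Phi> 1 1 2) w 1 + dd (mc \<Phi> \<i> 1 2) w \<i>
    + 2 * (mc \<Phi> 1 1 1 w * mc \<Phi> 1 1 2 w + mc \<Phi> \<i> 1 1 w * mc \<Phi> \<i> 1 2 w)"

definition tension21 :: "complex \<Rightarrow> complex" where
  "tension21 w = dd (mc \<Phi> 1 2 1) w 1 + dd (mc \<Phi> \<i> 2 1) w \<i>
    - 2 * (mc \<Phi> 1 1 1 w * mc \<Phi> 1 2 1 w + mc \<Phi> \<i> 1 1 w * mc \<Phi> \<i> 2 1 w)"

lemma dd_p_part:
  assumes p: "\<And>z u. z \<in> W \<Longrightarrow> p_part N (maurer_cartan \<Phi> z u) = mat2_of 0 (mc \<Phi> u 1 2 z) (mc \<Phi> u 2 1 z) 0"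
    and w: "w \<in> W"
  shows "dd (\<lambda>z. - p_part N (maurer_cartan \<Phi> z v)) w u =
    mat2_of 0 (- dd (mc \<Phi> v 1 2) w u) (- dd (mc \<Phi> v 2 1) w u) 0"
proof -
  have "dd (\<lambda>z. - p_part N (maurer_cartan \<Phi> z v)) w =
     dd (\<lambda>z. mat2_of 0 (- mc \<Phi> v 1 2 z) (- mc \<Phi> v 2 1 z) 0) w"
    by (rule dd_cong[OF open_W w]) (simp add: p mat2_eq_iff)
  then show ?thesis using diff_mc[OF w] by (simp add: dd_mat2_of dd_minus differentiable_minus)
qed

lemma dd_mc_coordinates:
  assumes w: "w \<in> W"
  shows "dd (mc \<Phi> v i j) w u =
    of_real (Re u) * (of_real (Re v) * dd (mc \<Phi> 1 i j) w 1 + of_real (Im v) * dd (mc \<Phi> \<i> i j) w 1) +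
    of_real (Im u) * (of_real (Re v) * dd (mc \<Phi> 1 i j) w \<i> + of_real (Im v) * dd (mc \<Phi> \<i> i j) w \<i>)"
proof -
  have "dd (mc \<Phi> v i j) w = dd (\<lambda>z. of_real (Re v) * mc \<Phi> 1 i j z + of_real (Im v) * mc \<Phi> \<i> i j z) w"
    by (rule dd_cong[OF open_W w mc_coordinates])
  then have "dd (mc \<Phi> v i j) w u = of_real (Re v) * dd (mc \<Phi> 1 i j) w u + of_real (Im v) * dd (mc \<Phi> \<i> i j) w u" for u
    using diff_mc[OF w] by (simp add: dd_add dd_mult differentiable_mult)
  then show ?thesis
    by (subst dd_coordinates[OF diff_mc[OF w]]) (simp add: scaleR_conv_of_real)
qed

text \<open>The hypothesis \<open>p\<close> says that projecting the Maurer-Cartan form removes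
  exactly its diagonal. The bracket of off-diagonal matrices is diagonal, and \<open>p0\<close> says
  that the projection kills the diagonals which occur. What remains is the second equation, and
  being a 2-form on the plane it is determined by one value.\<close>

lemma harmonic_frame_iff_tension:
  assumes p: "\<And>z u. z \<in> W \<Longrightarrow> p_part N (maurer_cartan \<Phi> z u) = mat2_of 0 (mc \<Phi> u 1 2 z) (mc \<Phi> u 2 1 z) 0"
    and p0: "\<And>z t d. z \<in> W \<Longrightarrow>
      d = of_real t * (mc \<Phi> 1 1 2 z * mc \<Phi> \<i> 2 1 z - mc \<Phi> \<i> 1 2 z * mc \<Phi> 1 2 1 z) \<Longrightarrow>
      p_part N (mat2_of d 0 0 (- d)) = 0"
  shows "harmonic_frame N W \<Phi> \<longleftrightarrow> (\<forall>w\<in>W. tension12 w = 0 \<and> tension21 w = 0)"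
proof -
  define \<alpha>p where "\<alpha>p = (\<lambda>w u. p_part N (maurer_cartan \<Phi> w u))"
  have c1: "map_prod (p_part N) (p_part N) (wedge_bracket ccommutator (part10 \<alpha>p) (part01 \<alpha>p) w u v) = 0"
    if w: "w \<in> W" for w u v
  proof -
    \<comment> \<open>The first factor is the area form on (u, v). The component of the bracket
      along the new imaginary unit cancels, so the pair below ends in 0.\<close>
    define d where "d = of_real (Re u * Im v - Im u * Re v) * (mc \<Phi> 1 1 2 w * mc \<Phi> \<i> 2 1 w - mc \<Phi> \<i> 1 2 w * mc \<Phi> 1 2 1 w)"
    have "wedge_bracket ccommutator (part10 \<alpha>p) (part01 \<alpha>p) w u v = (mat2_of d 0 0 (- d), 0)"
      unfolding wedge_bracket_def ccommutator_def part10_def part01_def commutator_def \<alpha>p_def p[OF w]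
        mc_coordinates[OF w, of u] mc_coordinates[OF w, of v] mc_coordinates[OF w, of "\<i> * u"]
        mc_coordinates[OF w, of "\<i> * v"] d_def prod_eq_iff mat2_eq_iff
      by (simp add: mult2_entry) (simp add: scaleR_conv_of_real algebra_simps)
    moreover have "p_part N (mat2_of d 0 0 (- d)) = 0" by (rule p0[OF w, of _ "Re u * Im v - Im u * Re v"]) (simp add: d_def)
    moreover have "p_part N 0 = 0"
      using p0[OF w, of 0 0] by (simp add: mat2_eq_iff[of "mat2_of 0 0 0 0" 0, simplified])
    ultimately show ?thesis by (simp add: zero_prod_def)
  qed
  have dd_p: "dd (\<lambda>z. - p_part N (maurer_cartan \<Phi> z v)) w u =
     mat2_of 0 (- dd (mc \<Phi> v 1 2) w u) (- dd (mc \<Phi> v 2 1) w u) 0" if "w \<in> W" for w u v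
    by (rule dd_p_part) (use p that in auto)
  have c2: "ext_deriv (hodge_star \<alpha>p) w u v + wedge_bracket commutator (maurer_cartan \<Phi>) (hodge_star \<alpha>p) w u v =
     (Re u * Im v - Im u * Re v) *\<^sub>R mat2_of 0 (tension12 w) (tension21 w) 0" if w: "w \<in> W" for w u v
    unfolding ext_deriv_def \<alpha>p_def hodge_star_def dd_p[OF w] mat2_eq_iff wedge_bracket_def commutator_def
      p[OF w] dd_mc_coordinates[OF w, of "\<i> * u"] dd_mc_coordinates[OF w, of "\<i> * v"]
    by (simp add: mult2_entry trace_maurer_cartan[OF w] mc_coordinates[OF w, of u] mc_coordinates[OF w, of v]
       mc_coordinates[OF w, of "\<i> * u"] mc_coordinates[OF w, of "\<i> * v"])
      (simp add: scaleR_conv_of_real tension12_def tension21_def algebra_simps)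
  have c3: "(\<forall>u v. (Re u * Im v - Im u * Re v) *\<^sub>R mat2_of 0 (tension12 w) (tension21 w) 0 = 0) \<longleftrightarrow>
     tension12 w = 0 \<and> tension21 w = 0" (is "?l = ?r") for w
  proof
    assume ?l
    from this[rule_format, of 1 \<i>] show ?r by (simp add: mat2_eq_iff)
  next
    assume ?r then show ?l by (simp add: mat2_eq_iff)
  qed
  show ?thesis
    unfolding harmonic_frame_def Let_def \<alpha>p_def[symmetric] using c1 c2 c3 by simp
qed

end

section \<open>Frames of the Legendrian Gauss map\<close>

definition vec4_of :: "real \<Rightarrow> real \<Rightarrow> real \<Rightarrow> real \<Rightarrow> vec4" where
  "vec4_of a b c d = (\<chi> i. if i = 0 then a else if i = 1 then b else if i = 2 then c else d)"

lemma vec4_of_entry [simp]: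
  "vec4_of a b c d $ 0 = a" "vec4_of a b c d $ 1 = b" "vec4_of a b c d $ 2 = c" "vec4_of a b c d $ 3 = d"
  by (simp_all add: vec4_of_def)

lemma bounded_bilinear_mat2_mult: "bounded_bilinear ((**) :: mat2 \<Rightarrow> mat2 \<Rightarrow> mat2)"
  unfolding bilinear_conv_bounded_bilinear[symmetric] bilinear_def
  by (auto intro!: linearI simp: mat2_eq_iff mult2_entry, simp_all add: scaleR_conv_of_real algebra_simps)

lemma bounded_linear_conj_transpose: "bounded_linear conj_transpose"
  by (intro linear_conv_bounded_linear[THEN iffD1] linearI) (simp_all add: mat2_eq_iff)

text \<open>Differentiating \<Phi> y \<Phi>* and factoring out \<Phi> leaves \<alpha> y + y
  \<alpha>*. Since the action is isometric, inner products of derivatives become expressions in the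
  entries of \<alpha>.\<close>

lemma (in sl2_map) dd_orbit:
  assumes w: "w \<in> W" and x: "\<And>z. z \<in> W \<Longrightarrow> sl2_act (\<Phi> z) y = x z" and dx: "x differentiable at w"
    and \<xi>: "herm \<xi> = maurer_cartan \<Phi> w u ** herm y + herm y ** conj_transpose (maurer_cartan \<Phi> w u)"
  shows "dd x w u = sl2_act (\<Phi> w) \<xi>"
proof -
  note D = has_derivative_dd[OF diff[OF w]]
  have "herm (dd x w u) = dd (\<lambda>z. herm (x z)) w u"
    by (rule dd_bounded_linear[OF bounded_linear_herm dx, symmetric])
  also have "\<dots> = dd (\<lambda>z. \<Phi> z ** herm y ** conj_transpose (\<Phi> z)) w u"
    by (intro fun_cong[OF dd_cong[OF open_W w]]) (simp add: x[symmetric] herm_sl2_act)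
  also have "\<dots> = \<Phi> w ** herm y ** conj_transpose (dd \<Phi> w u) + dd \<Phi> w u ** herm y ** conj_transpose (\<Phi> w)"
    by (rule dd_eq)
      (intro bounded_bilinear.FDERIV[OF bounded_bilinear_mat2_mult] D
        bounded_linear.has_derivative[OF bounded_linear_conj_transpose]
        bounded_linear.has_derivative[OF bounded_bilinear.bounded_linear_left[OF bounded_bilinear_mat2_mult]])
  also have "\<dots> = \<Phi> w ** herm \<xi> ** conj_transpose (\<Phi> w)"
    unfolding \<xi> dd_eq_mult[OF w] conj_transpose_mult matrix_mul_assoc
    by (simp add: bounded_bilinear.add_left[OF bounded_bilinear_mat2_mult]
        bounded_bilinear.add_right[OF bounded_bilinear_mat2_mult] matrix_mul_assoc)
  also have "\<dots> = herm (sl2_act (\<Phi> w) \<xi>)" by (simp add: herm_sl2_act)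
  finally show ?thesis by (rule injD[OF inj_herm])
qed

locale conformal_patch =
  fixes U :: "complex set" and f n :: "complex \<Rightarrow> vec4"
  assumes open_U: "open U" and smooth_f: "smooth_on f U" and smooth_n: "smooth_on n U"
    and mink_ff: "w \<in> U \<Longrightarrow> mink (f w) (f w) = - 1" and f0_pos: "w \<in> U \<Longrightarrow> f w $ 0 > 0"
    and mink_nn: "w \<in> U \<Longrightarrow> mink (n w) (n w) = 1" and mink_nf: "w \<in> U \<Longrightarrow> mink (n w) (f w) = 0"
    and mink_ndf: "w \<in> U \<Longrightarrow> mink (n w) (dd f w u) = 0"
    and conformal: "w \<in> U \<Longrightarrow> \<exists>r>0. \<forall>u v. - mink (dd f w u) (dd n w v) = r * (u \<bullet> v)"
    and oriented: "w \<in> U \<Longrightarrow> det (rows4 (f w) (dd f w 1) (dd f w \<i>) (n w)) > 0"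
begin

definition ext_curvature :: "complex \<Rightarrow> real" where
  "ext_curvature w = det (form_matrix (\<lambda>u v. - mink (dd f w u) (dd n w v))) /
     det (form_matrix (\<lambda>u v. mink (dd f w u) (dd f w v)))"

text \<open>Phrased by \<open>has_derivative\<close> and not by a value of
  \<open>frechet_derivative\<close>, so that differentiability is part of the statement. Each of the
  four properties is reduced to this condition.\<close>

definition stationary :: "complex \<Rightarrow> bool" where
  "stationary w \<longleftrightarrow> (ext_curvature has_derivative (\<lambda>_. 0)) (at w)"

definition klotz_coeff :: "complex \<Rightarrow> complex" where
  "klotz_coeff w = mink (wirtinger f w) (wirtinger f w)"

end

locale legendrian_frame = conformal_patch U f n + sl2_map W \<Phi> for U f n W \<Phi> +
  assumes W_sub: "W \<subseteq> U"
    and frame_f: "z \<in> W \<Longrightarrow> sl2_act (\<Phi> z) (axis 0 1) = f z"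
    and frame_n: "z \<in> W \<Longrightarrow> sl2_act (\<Phi> z) (axis 1 1) = n z"
begin

text \<open>The (1,2)-entries of the Hermitian matrices of df and dn, transported to the base point.
  They are complex coordinates on the plane of \<open>axis 2 1\<close> and \<open>axis 3 1\<close>,
  on which the Minkowski form is \<open>Re (x * cnj y)\<close>.\<close>

abbreviation \<zeta> :: "complex \<Rightarrow> complex \<Rightarrow> complex" where "\<zeta> u z \<equiv> mc \<Phi> u 1 2 z + cnj (mc \<Phi> u 2 1 z)"
abbreviation \<eta> :: "complex \<Rightarrow> complex \<Rightarrow> complex" where "\<eta> u z \<equiv> cnj (mc \<Phi> u 2 1 z) - mc \<Phi> u 1 2 z"

lemma dd_f: 
  assumes "w \<in> W"
  shows "dd f w u = sl2_act (\<Phi> w) (vec4_of 0 (2 * Re (mc \<Phi> u 1 1 w)) (- Im (\<zeta> u w)) (Re (\<zeta> u w)))"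
proof (rule dd_orbit[OF assms frame_f])
  show "f differentiable at w" using smooth_f assms W_sub smooth_on_differentiable by blast
  show "herm (vec4_of 0 (2 * Re (mc \<Phi> u 1 1 w)) (- Im (\<zeta> u w)) (Re (\<zeta> u w))) =
    maurer_cartan \<Phi> w u ** herm (axis 0 1) + herm (axis 0 1) ** conj_transpose (maurer_cartan \<Phi> w u)"
    by (simp add: mat2_eq_iff mult2_entry herm_entry(1-4)[of "axis 0 1"] herm_entry(1-4)[of "vec4_of _ _ _ _"] axis_entry
       trace_maurer_cartan[OF assms]) (simp add: complex_eq_iff)
qed

lemma dd_n: 
  assumes "w \<in> W"
  shows "dd n w u = sl2_act (\<Phi> w) (vec4_of (2 * Re (mc \<Phi> u 1 1 w)) 0 (- Im (\<eta> u w)) (Re (\<eta> u w)))"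
proof (rule dd_orbit[OF assms frame_n])
  show "n differentiable at w" using smooth_n assms W_sub smooth_on_differentiable by blast
  show "herm (vec4_of (2 * Re (mc \<Phi> u 1 1 w)) 0 (- Im (\<eta> u w)) (Re (\<eta> u w))) =
    maurer_cartan \<Phi> w u ** herm (axis 1 1) + herm (axis 1 1) ** conj_transpose (maurer_cartan \<Phi> w u)"
    by (simp add: mat2_eq_iff mult2_entry herm_entry(1-4)[of "axis 1 1"] herm_entry(1-4)[of "vec4_of _ _ _ _"] axis_entry
       trace_maurer_cartan[OF assms]) (simp add: complex_eq_iff)
qed

text \<open>Here the condition that n is normal to df enters: the component of df along n is twice
  this real part.\<close>

lemma Re_mc_11:
  assumes w: "w \<in> W"
  shows "Re (mc \<Phi> u 1 1 w) = 0"
proof -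
  have "mink (n w) (dd f w u) = 2 * Re (mc \<Phi> u 1 1 w)"
    unfolding dd_f[OF w] frame_n[OF w, symmetric] mink_sl2_act[OF det_1[OF w]]
    by (simp add: mink_def axis_entry)
  then show ?thesis using mink_ndf W_sub w by auto
qed

lemma first_fundamental:
  assumes w: "w \<in> W"
  shows "mink (dd f w u) (dd f w v) = Re (\<zeta> u w * cnj (\<zeta> v w))"
  unfolding dd_f[OF w] mink_sl2_act[OF det_1[OF w]] Re_mc_11[OF w]
  by (simp add: mink_def algebra_simps)

lemma second_fundamental:
  assumes w: "w \<in> W"
  shows "mink (dd f w u) (dd n w v) = Re (\<zeta> u w * cnj (\<eta> v w))"
  unfolding dd_f[OF w] dd_n[OF w] mink_sl2_act[OF det_1[OF w]] Re_mc_11[OF w]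
  unfolding mink_def vec4_of_entry by (simp add: algebra_simps)

text \<open>At the base point f and n are the first two basis vectors, and the determinant reduces
  to the Jacobian of \<zeta> on the two remaining directions.\<close>

lemma orientation_pos:
  assumes w: "w \<in> W"
  shows "Im (cnj (\<zeta> 1 w) * \<zeta> \<i> w) > 0"
proof -
  have "det (rows4 (f w) (dd f w 1) (dd f w \<i>) (n w)) = Im (cnj (\<zeta> 1 w) * \<zeta> \<i> w)"
    unfolding dd_f[OF w] frame_f[OF w, symmetric] frame_n[OF w, symmetric] det_rows4_sl2_act[OF det_1[OF w]]
    unfolding Re_mc_11[OF w] det_4
    by (simp add: rows4_def axis_entry algebra_simps)
  then show ?thesis using oriented W_sub w by force
qed

text \<open>The coefficients of \<open>dz\<close> and \<open>d\<bar>z\<close> in the off-diagonal entries of the Maurer--Cartan form; the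
  formula for \<open>m\<close> solves \<open>s = m \<bar>p\<close>.\<close>

definition p :: "complex \<Rightarrow> complex" where "p z = (mc \<Phi> 1 1 2 z - \<i> * mc \<Phi> \<i> 1 2 z) / 2"
definition q :: "complex \<Rightarrow> complex" where "q z = (mc \<Phi> 1 1 2 z + \<i> * mc \<Phi> \<i> 1 2 z) / 2"
definition r :: "complex \<Rightarrow> complex" where "r z = (mc \<Phi> 1 2 1 z - \<i> * mc \<Phi> \<i> 2 1 z) / 2"
definition s :: "complex \<Rightarrow> complex" where "s z = (mc \<Phi> 1 2 1 z + \<i> * mc \<Phi> \<i> 2 1 z) / 2"
definition m :: "complex \<Rightarrow> real" where "m z = Re (s z * p z) / (cmod (p z))\<^sup>2"

lemma mc_pqrs: "mc \<Phi> 1 1 2 z = p z + q z" "mc \<Phi> \<i> 1 2 z = \<i> * (p z - q z)"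
  "mc \<Phi> 1 2 1 z = r z + s z" "mc \<Phi> \<i> 2 1 z = \<i> * (r z - s z)"
  by (simp_all add: p_def q_def r_def s_def field_simps)

lemma second_form_values:
  assumes w: "w \<in> W"
  obtains \<rho> where "\<rho> > 0" "Re (\<zeta> 1 w * cnj (\<eta> 1 w)) = - \<rho>" "Re (\<zeta> \<i> w * cnj (\<eta> \<i> w)) = - \<rho>"
    "Re (\<zeta> 1 w * cnj (\<eta> \<i> w)) = 0" "Re (\<zeta> \<i> w * cnj (\<eta> 1 w)) = 0"
proof -
  from conformal W_sub w obtain \<rho> where "\<rho> > 0" "\<And>u v. - mink (dd f w u) (dd n w v) = \<rho> * (u \<bullet> v)"
    by blast
  then have e: "Re (\<zeta> u w * cnj (\<eta> v w)) = - \<rho> * (u \<bullet> v)" for u v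
    using second_fundamental[OF w, of u v] by (metis minus_minus mult_minus_left)
  from that[of \<rho>] show ?thesis
    using e[of 1 1] e[of 1 \<i>] e[of \<i> 1] e[of \<i> \<i>] \<open>\<rho> > 0\<close> by (simp add: inner_complex_def)
qed

lemma coefficients:
  assumes w: "w \<in> W"
  shows "s w = m w * cnj (p w)" "q w = m w * cnj (r w)" "\<bar>m w\<bar> < 1" "cmod (r w) < cmod (p w)"
proof -
  obtain \<rho> where \<rho>: "\<rho> > 0" "Re (\<zeta> 1 w * cnj (\<eta> 1 w)) = - \<rho>" "Re (\<zeta> \<i> w * cnj (\<eta> \<i> w)) = - \<rho>"
    "Re (\<zeta> 1 w * cnj (\<eta> \<i> w)) = 0" "Re (\<zeta> \<i> w * cnj (\<eta> 1 w)) = 0"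
    using second_form_values[OF w] .
  note \<rho>' = \<rho>[unfolded mc_pqrs]
  \<comment> \<open>The dz^2-coefficient of the second form: equal diagonal values give the real
    part, and the vanishing sum of the mixed values gives the imaginary part.\<close>
  have 1: "p w * cnj (q w) = r w * cnj (s w)"
  proof (rule complex_eqI)
    show "Re (p w * cnj (q w)) = Re (r w * cnj (s w))"
      using \<rho>'(2,3) by (simp add: algebra_simps)
    show "Im (p w * cnj (q w)) = Im (r w * cnj (s w))"
      using \<rho>'(4,5) by (simp add: algebra_simps)
  qed
  \<comment> \<open>The difference of the two mixed values, hence the symmetry of the second
    form.\<close>
  have 2: "Im (p w * s w - q w * r w) = 0"
    using \<rho>'(4,5) by (simp add: algebra_simps)
  have 3: "(cmod (p w))\<^sup>2 + (cmod (q w))\<^sup>2 - (cmod (r w))\<^sup>2 - (cmod (s w))\<^sup>2 > 0"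
    using \<rho>'(1-3) unfolding cmod_power2 by (simp add: power2_eq_square algebra_simps)
  have "(cmod (p w + cnj (s w)))\<^sup>2 > (cmod (q w + cnj (r w)))\<^sup>2"
    using orientation_pos[OF w, unfolded mc_pqrs] unfolding cmod_power2 by (simp add: power2_eq_square algebra_simps)
  then have 4: "cmod (p w + cnj (s w)) > cmod (q w + cnj (r w))"
    by (rule power2_less_imp_less) simp
  from conformal_coefficients[OF 1 2 3 4]
  show "s w = m w * cnj (p w)" "q w = m w * cnj (r w)" "\<bar>m w\<bar> < 1" "cmod (r w) < cmod (p w)"
    by (simp_all add: m_def)
qed

text \<open>With D = |p|^2 - |r|^2 the second form is (1 - m^2) D times the Euclidean one, while the
  area density of the first form is (1 + m)^2 D. In the quotient of determinants D cancels.\<close>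

lemma ext_curvature_eq:
  assumes w: "w \<in> W"
  shows "ext_curvature w = ((1 - m w) / (1 + m w))\<^sup>2"
proof -
  obtain \<rho> where \<rho>: "\<rho> > 0" "Re (\<zeta> 1 w * cnj (\<eta> 1 w)) = - \<rho>" "Re (\<zeta> \<i> w * cnj (\<eta> \<i> w)) = - \<rho>"
    "Re (\<zeta> 1 w * cnj (\<eta> \<i> w)) = 0" "Re (\<zeta> \<i> w * cnj (\<eta> 1 w)) = 0"
    using second_form_values[OF w] .
  define D where "D = (cmod (p w))\<^sup>2 - (cmod (r w))\<^sup>2"
  have D: "D > 0" using coefficients(4)[OF w] power_strict_mono[of "cmod (r w)" "cmod (p w)" 2] by (simp add: D_def)
  have "\<rho> = (1 - (m w)\<^sup>2) * D"
    using \<rho>(2,3) unfolding mc_pqrs coefficients(1,2)[OF w] D_def cmod_power2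
    by (simp add: power2_eq_square algebra_simps)
  moreover have "det (form_matrix (\<lambda>u v. - mink (dd f w u) (dd n w v))) = \<rho>\<^sup>2"
    by (simp add: form_matrix_def det_2 second_fundamental[OF w] \<rho>(2-5) power2_eq_square
        del: times_complex.sel complex_cnj_add complex_cnj_diff)
  moreover have "det (form_matrix (\<lambda>u v. mink (dd f w u) (dd f w v))) = (Im (cnj (\<zeta> 1 w) * \<zeta> \<i> w))\<^sup>2"
    by (simp add: form_matrix_def det_2 first_fundamental[OF w] power2_eq_square algebra_simps)
  moreover have "Im (cnj (\<zeta> 1 w) * \<zeta> \<i> w) = (1 + m w)\<^sup>2 * D"
    unfolding mc_pqrs coefficients(1,2)[OF w] D_def cmod_power2
    by (simp add: power2_eq_square algebra_simps)
  ultimately have "ext_curvature w = ((1 - (m w)\<^sup>2) * D)\<^sup>2 / ((1 + m w)\<^sup>2 * D)\<^sup>2"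
    by (simp add: ext_curvature_def)
  also have "\<dots> = ((1 - m w) / (1 + m w))\<^sup>2"
  proof -
    have "1 + m w \<noteq> 0" using coefficients(3)[OF w] by auto
    then have "((1 - (m w)\<^sup>2) * D) / ((1 + m w)\<^sup>2 * D) = (1 - m w) / (1 + m w)"
      using D by (simp add: frac_eq_eq) (simp add: power2_eq_square algebra_simps)
    then show ?thesis by (simp only: power_divide[symmetric])
  qed
  finally show ?thesis .
qed

text \<open>This is the dz^2-coefficient of |\<zeta>|^2, namely (p + cnj s) (r + cnj q); the
  relations for q and s turn each factor into a multiple by 1 + m.\<close>

lemma klotz_coeff_eq:
  assumes w: "w \<in> W"
  shows "klotz_coeff w = (1 + of_real (m w))\<^sup>2 * p w * r w"
proof -
  have "klotz_coeff w = (of_real (mink (dd f w 1) (dd f w 1)) - of_real (mink (dd f w \<i>) (dd f w \<i>))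
     - 2 * \<i> * of_real (mink (dd f w 1) (dd f w \<i>))) / 4"
    unfolding klotz_coeff_def mink_def wirtinger_def
    by (simp add: complex_eq_iff field_simps)
  then show ?thesis
    unfolding first_fundamental[OF w] mc_pqrs coefficients(1,2)[OF w]
    by (simp add: complex_eq_iff power2_eq_square field_simps)
qed

end

section \<open>Derivatives of the coefficients and the Cauchy-Riemann equation\<close>

lemma dd_cnj: "h differentiable at w \<Longrightarrow> dd (\<lambda>z. cnj (h z)) w u = cnj (dd h w u)"
  by (rule dd_bounded_linear[OF bounded_linear_cnj])

lemma dd_of_real: "h differentiable at w \<Longrightarrow> dd (\<lambda>z. complex_of_real (h z)) w u = of_real (dd h w u)"
  by (rule dd_bounded_linear[OF bounded_linear_of_real])

lemma differentiable_cnj: "h differentiable at w \<Longrightarrow> (\<lambda>z. cnj (h z)) differentiable at w"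
  using bounded_linear.has_derivative[OF bounded_linear_cnj] unfolding differentiable_def by blast

lemma differentiable_of_real: "h differentiable at w \<Longrightarrow> (\<lambda>z. complex_of_real (h z)) differentiable at w"
  using bounded_linear.has_derivative[OF bounded_linear_of_real] unfolding differentiable_def by blast

lemma differentiable_Re: "h differentiable at w \<Longrightarrow> (\<lambda>z. Re (h z)) differentiable at w"
  using bounded_linear.has_derivative[OF bounded_linear_Re] unfolding differentiable_def by blast

lemma field_differentiable_iff_dd:
  fixes g :: "complex \<Rightarrow> complex"
  assumes "g differentiable at w"
  shows "g field_differentiable at w \<longleftrightarrow> dd g w 1 + \<i> * dd g w \<i> = 0"
proof
  assume "g field_differentiable at w"
  then obtain D where "(g has_derivative (*) D) (at w)"
    by (auto simp: field_differentiable_def has_field_derivative_def)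
  then show "dd g w 1 + \<i> * dd g w \<i> = 0"
    by (simp add: dd_eq[where v=1] dd_eq[where v=\<i>] complex_eq_iff)
next
  assume "dd g w 1 + \<i> * dd g w \<i> = 0"
  then have "\<i> * (dd g w 1 + \<i> * dd g w \<i>) = 0" by simp
  then have i: "dd g w \<i> = \<i> * dd g w 1" by (simp add: distrib_left flip: mult.assoc)
  have "dd g w u = dd g w 1 * u" for u
    unfolding dd_coordinates[OF assms, of u] i by (simp add: complex_eq_iff)
  then have "dd g w = (*) (dd g w 1)" by (rule ext)
  then have "(g has_field_derivative dd g w 1) (at w)"
    unfolding has_field_derivative_def using has_derivative_dd[OF assms] by metis
  then show "g field_differentiable at w" by (auto simp: field_differentiable_def)
qed

context legendrian_frame
begin

lemma diff_p: "w \<in> W \<Longrightarrow> p differentiable at w"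
  and diff_r: "w \<in> W \<Longrightarrow> r differentiable at w"
  and diff_s: "w \<in> W \<Longrightarrow> s differentiable at w"
  unfolding p_def r_def s_def divide_inverse
  by (intro differentiable_mult differentiable_diff differentiable_add differentiable_const diff_mc; assumption)+

lemma diff_m:
  assumes w: "w \<in> W"
  shows "m differentiable at w"
proof -
  have "p w \<noteq> 0" using coefficients(4)[OF w] by auto
  then show ?thesis
    unfolding m_def cmod_power2 using diff_p[OF w] diff_s[OF w]
    by (intro differentiable_divide differentiable_Re differentiable_mult differentiable_add differentiable_power)
      (auto simp: sum_power2_eq_zero_iff complex_eq_iff intro!: bounded_linear.has_derivative[OF bounded_linear_Im] differentiableI
        bounded_linear.has_derivative[OF bounded_linear_Re] has_derivative_dd)
qed

definition \<mu> :: "complex \<Rightarrow> complex" where "\<mu> w = of_real (dd m w 1) + \<i> * of_real (dd m w \<i>)"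

text \<open>Twice the covariant dbar-derivative. The isotropy group acts on the (1,2)- and
  (2,1)-entries with opposite weights, hence the opposite signs of the connection terms in
  \<open>dbar_p\<close> and \<open>dbar_r\<close>.\<close>

definition dbar_p :: "complex \<Rightarrow> complex" where
  "dbar_p w = dd p w 1 + \<i> * dd p w \<i> + 2 * (mc \<Phi> 1 1 1 w + \<i> * mc \<Phi> \<i> 1 1 w) * p w"

definition dbar_r :: "complex \<Rightarrow> complex" where
  "dbar_r w = dd r w 1 + \<i> * dd r w \<i> - 2 * (mc \<Phi> 1 1 1 w + \<i> * mc \<Phi> \<i> 1 1 w) * r w"

text \<open>The relations for q and s hold throughout \<open>W\<close> and may therefore be
  differentiated; this is how dm enters the structure equations.\<close>

lemma dd_mc:
  assumes w: "w \<in> W"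
  shows "dd (mc \<Phi> 1 1 2) w u = dd p w u + (of_real (m w) * cnj (dd r w u) + of_real (dd m w u) * cnj (r w))"
    and "dd (mc \<Phi> \<i> 1 2) w u = \<i> * (dd p w u - (of_real (m w) * cnj (dd r w u) + of_real (dd m w u) * cnj (r w)))"
    and "dd (mc \<Phi> 1 2 1) w u = dd r w u + (of_real (m w) * cnj (dd p w u) + of_real (dd m w u) * cnj (p w))"
    and "dd (mc \<Phi> \<i> 2 1) w u = \<i> * (dd r w u - (of_real (m w) * cnj (dd p w u) + of_real (dd m w u) * cnj (p w)))"
proof -
  note d = diff_p[OF w] diff_r[OF w] diff_m[OF w]
  have "dd (mc \<Phi> 1 1 2) w = dd (\<lambda>z. p z + of_real (m z) * cnj (r z)) w"
    by (rule dd_cong[OF open_W w]) (simp add: mc_pqrs coefficients)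
  then show "dd (mc \<Phi> 1 1 2) w u = dd p w u + (of_real (m w) * cnj (dd r w u) + of_real (dd m w u) * cnj (r w))"
    using d by (simp add: dd_add dd_mult dd_of_real dd_cnj differentiable_mult differentiable_cnj differentiable_of_real)
  have "dd (mc \<Phi> \<i> 1 2) w = dd (\<lambda>z. \<i> * (p z - of_real (m z) * cnj (r z))) w"
    by (rule dd_cong[OF open_W w]) (simp add: mc_pqrs coefficients)
  then show "dd (mc \<Phi> \<i> 1 2) w u = \<i> * (dd p w u - (of_real (m w) * cnj (dd r w u) + of_real (dd m w u) * cnj (r w)))"
    using d by (simp add: dd_diff dd_mult dd_of_real dd_cnj differentiable_mult differentiable_diff differentiable_cnj differentiable_of_real)
  have "dd (mc \<Phi> 1 2 1) w = dd (\<lambda>z. r z + of_real (m z) * cnj (p z)) w"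
    by (rule dd_cong[OF open_W w]) (simp add: mc_pqrs coefficients)
  then show "dd (mc \<Phi> 1 2 1) w u = dd r w u + (of_real (m w) * cnj (dd p w u) + of_real (dd m w u) * cnj (p w))"
    using d by (simp add: dd_add dd_mult dd_of_real dd_cnj differentiable_mult differentiable_cnj differentiable_of_real)
  have "dd (mc \<Phi> \<i> 2 1) w = dd (\<lambda>z. \<i> * (r z - of_real (m z) * cnj (p z))) w"
    by (rule dd_cong[OF open_W w]) (simp add: mc_pqrs coefficients)
  then show "dd (mc \<Phi> \<i> 2 1) w u = \<i> * (dd r w u - (of_real (m w) * cnj (dd p w u) + of_real (dd m w u) * cnj (p w)))"
    using d by (simp add: dd_diff dd_mult dd_of_real dd_cnj differentiable_mult differentiable_diff differentiable_cnj differentiable_of_real)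
qed

lemma cnj_mc_11: "w \<in> W \<Longrightarrow> cnj (mc \<Phi> u 1 1 w) = - mc \<Phi> u 1 1 w"
  using Re_mc_11[of w u] by (simp add: complex_eq_iff)

text \<open>The structure equations equate the covariant dbar-derivative of p with the covariant
  dz-derivative of q, and likewise for s and r with their roles exchanged. Inserting q = m cnj r and
  s = m cnj p, with m real and an imaginary connection, turns the dz-derivatives into conjugates of
  dbar-derivatives. Each tension is the sum of the two equal sides.\<close>

lemma dbar_equations:
  assumes w: "w \<in> W"
  shows "dbar_p w = cnj (\<mu> w * r w + of_real (m w) * dbar_r w)"
    and "dbar_r w = cnj (\<mu> w * p w + of_real (m w) * dbar_p w)"
    and "tension12 w = 2 * dbar_p w"
    and "tension21 w = 2 * dbar_r w"
proof -
  have i: "\<i> * \<i> = - 1" by simp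
  note e = structure_equations[OF w, unfolded dd_mc[OF w], unfolded mc_pqrs coefficients(1,2)[OF w]]
  show 1: "dbar_p w = cnj (\<mu> w * r w + of_real (m w) * dbar_r w)"
    unfolding dbar_p_def dbar_r_def \<mu>_def complex_cnj_add complex_cnj_mult complex_cnj_diff complex_cnj_complex_of_real
      cnj_mc_11[OF w] complex_cnj_i complex_cnj_numeral
    using e(1) i by algebra
  show 2: "dbar_r w = cnj (\<mu> w * p w + of_real (m w) * dbar_p w)"
    unfolding dbar_p_def dbar_r_def \<mu>_def complex_cnj_add complex_cnj_mult complex_cnj_diff complex_cnj_complex_of_real
      cnj_mc_11[OF w] complex_cnj_i complex_cnj_numeral
    using e(2) i by algebra
  show "tension12 w = 2 * dbar_p w"
    unfolding dbar_p_def tension12_def dd_mc[OF w]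
    unfolding mc_pqrs coefficients(1,2)[OF w]
    using e(1) i by algebra
  show "tension21 w = 2 * dbar_r w"
    unfolding dbar_r_def tension21_def dd_mc[OF w]
    unfolding mc_pqrs coefficients(1,2)[OF w]
    using e(2) i by algebra
qed

text \<open>On -1 < m < 1 the function ((1 - m) / (1 + m))^2 has nonzero derivative
  \<open>c\<close>, so K + 1 and m have the same critical points.\<close>

lemma stationary_iff:
  assumes w: "w \<in> W"
  shows "stationary w \<longleftrightarrow> \<mu> w = 0"
proof -
  have m: "\<bar>m w\<bar> < 1" by (rule coefficients(3)[OF w])
  define c where "c = 2 * (- 2 / ((1 + m w) * (1 + m w)) * ((1 - m w) / (1 + m w)))"
  have c: "c \<noteq> 0" using m by (auto simp: c_def)
  have "((\<lambda>x. ((1 - x) / (1 + x))\<^sup>2) has_real_derivative c) (at (m w))"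
  proof -
    have "1 + m w \<noteq> 0" using m by auto
    then have "((\<lambda>x. (1 - x) / (1 + x)) has_real_derivative - 2 / ((1 + m w) * (1 + m w))) (at (m w))"
      by (auto intro!: derivative_eq_intros)
    from DERIV_power[OF this, of 2] show ?thesis by (simp add: c_def)
  qed
  then have "((\<lambda>z. ((1 - m z) / (1 + m z))\<^sup>2) has_derivative (\<lambda>u. c * dd m w u)) (at w)"
    using diff_chain_at[OF has_derivative_dd[OF diff_m[OF w]]]
    unfolding has_field_derivative_def o_def by blast
  then have D: "(ext_curvature has_derivative (\<lambda>u. c * dd m w u)) (at w)"
    by (rule has_derivative_transform_within_open[OF _ open_W w]) (simp add: ext_curvature_eq)
  have "stationary w \<longleftrightarrow> (\<forall>u. dd m w u = 0)"
  proof
    assume "stationary w"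
    then have "(\<lambda>u. c * dd m w u) = (\<lambda>_. 0)"
      unfolding stationary_def by (rule has_derivative_unique[OF D])
    from fun_cong[OF this] c show "\<forall>u. dd m w u = 0" by simp
  next
    assume "\<forall>u. dd m w u = 0"
    then show "stationary w" using D by (simp add: stationary_def)
  qed
  also have "\<dots> \<longleftrightarrow> dd m w 1 = 0 \<and> dd m w \<i> = 0"
  proof (intro iffI allI)
    fix u assume "dd m w 1 = 0 \<and> dd m w \<i> = 0"
    then show "dd m w u = 0" by (subst dd_coordinates[OF diff_m[OF w]]) simp
  qed simp
  also have "\<dots> \<longleftrightarrow> \<mu> w = 0" by (simp add: \<mu>_def complex_eq_iff)
  finally show ?thesis .
qed

lemma tension_iff_stationary:
  assumes w: "w \<in> W"
  shows "tension12 w = 0 \<and> tension21 w = 0 \<longleftrightarrow> stationary w"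
  unfolding stationary_iff[OF w] dbar_equations(3,4)[OF w]
  using structure_equations_rigidity(1)[OF dbar_equations(1,2)[OF w] coefficients(3,4)[OF w]] by simp

lemma klotz_coeff_differentiable:
  assumes w: "w \<in> W"
  shows "klotz_coeff field_differentiable at w \<longleftrightarrow> stationary w"
proof -
  note d = diff_p[OF w] diff_r[OF w] diff_m[OF w]
  define g where "g = (\<lambda>z. (1 + of_real (m z)) * (1 + of_real (m z)) * p z * r z)"
  have g: "klotz_coeff z = g z" if "z \<in> W" for z using klotz_coeff_eq[OF that] by (simp add: g_def power2_eq_square)
  have dg: "g differentiable at w"
    unfolding g_def using d by (intro differentiable_mult differentiable_add differentiable_const differentiable_of_real)
  have dh: "klotz_coeff differentiable at w"
    using has_derivative_transform_within_open[OF has_derivative_dd[OF dg] open_W w] g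
    unfolding differentiable_def by metis
  have dgu: "dd g w u = 2 * (1 + of_real (m w)) * of_real (dd m w u) * p w * r w
     + (1 + of_real (m w))\<^sup>2 * (dd p w u * r w + p w * dd r w u)" for u
    unfolding g_def using d
    by (simp add: dd_mult dd_add dd_of_real differentiable_mult differentiable_add differentiable_of_real)
       (simp add: power2_eq_square algebra_simps)
  have "dd klotz_coeff w = dd g w" by (rule dd_cong[OF open_W w g])
  \<comment> \<open>In the product p r the connection terms of the two covariant derivatives cancel,
    so ordinary derivatives may be replaced by \<open>dbar_p\<close> and
    \<open>dbar_r\<close>.\<close>
  then have "dd klotz_coeff w 1 + \<i> * dd klotz_coeff w \<i> =
     2 * (1 + of_real (m w)) * \<mu> w * p w * r w + (1 + of_real (m w))\<^sup>2 * (dbar_r w * p w + r w * dbar_p w)"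
    by (simp add: dgu \<mu>_def dbar_p_def dbar_r_def algebra_simps)
  then show ?thesis
    unfolding field_differentiable_iff_dd[OF dh] stationary_iff[OF w]
    using structure_equations_rigidity(2)[OF dbar_equations(1,2)[OF w] coefficients(3,4)[OF w]] by simp
qed

end

section \<open>Harmonicity on a conformal patch\<close>

lemma p_part_UH3: "p_part UH3 (mat2_of a b c (- a)) = mat2_of (of_real (Re a)) b c (- of_real (Re a))"
  unfolding p_part_def
proof (rule the_equality)
  have "mat2_of a b c (- a) - mat2_of (of_real (Re a)) b c (- of_real (Re a)) =
      vector [vector [\<i> * of_real (Im a), 0], vector [0, - \<i> * of_real (Im a)]]"
    by (simp add: mat2_eq_iff) (simp add: complex_eq_iff)
  then show "mat2_of (of_real (Re a)) b c (- of_real (Re a)) \<in> reductive_complement UH3 \<and>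
      mat2_of a b c (- a) - mat2_of (of_real (Re a)) b c (- of_real (Re a)) \<in> isotropy_algebra UH3"
    by (auto simp: UH3_def trace_def UNIV_2 forall_2)
next
  fix Y assume "Y \<in> reductive_complement UH3 \<and> mat2_of a b c (- a) - Y \<in> isotropy_algebra UH3"
  then obtain t :: real where t: "mat2_of a b c (- a) - Y = mat2_of (\<i> * t) 0 0 (- \<i> * t)"
    and Y: "Y $ 1 $ 1 \<in> \<real>"
    by (auto simp: UH3_def mat2_of_def)
  have e: "a - Y $ 1 $ 1 = \<i> * t" "b = Y $ 1 $ 2" "c = Y $ 2 $ 1" "- a - Y $ 2 $ 2 = - \<i> * t"
    using arg_cong[OF t, of "\<lambda>M. M $ 1 $ 1"] arg_cong[OF t, of "\<lambda>M. M $ 1 $ 2"]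
      arg_cong[OF t, of "\<lambda>M. M $ 2 $ 1"] arg_cong[OF t, of "\<lambda>M. M $ 2 $ 2"] by simp_all
  have Y1: "Y $ 1 $ 1 = of_real (Re a)"
    using e(1) Y by (auto simp: complex_eq_iff complex_is_Real_iff)
  have "Y $ 2 $ 2 = - (Y $ 1 $ 1)" using e(1,4) by (simp add: eq_neg_iff_add_eq_0 algebra_simps)
  then show "Y = mat2_of (of_real (Re a)) b c (- of_real (Re a))"
    using Y1 e by (simp add: mat2_eq_iff)
qed

lemma p_part_Geo: "p_part Geo (mat2_of a b c (- a)) = mat2_of 0 b c 0"
  unfolding p_part_def
proof (rule the_equality)
  have "mat2_of a b c (- a) - mat2_of 0 b c 0 = vector [vector [a, 0], vector [0, - a]]"
    by (simp add: mat2_eq_iff)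
  then show "mat2_of 0 b c 0 \<in> reductive_complement Geo \<and>
      mat2_of a b c (- a) - mat2_of 0 b c 0 \<in> isotropy_algebra Geo"
    by (auto simp: Geo_def forall_2)
next
  fix Y assume Y: "Y \<in> reductive_complement Geo \<and> mat2_of a b c (- a) - Y \<in> isotropy_algebra Geo"
  then obtain t where t: "mat2_of a b c (- a) - Y = mat2_of t 0 0 (- t)"
    by (auto simp: Geo_def mat2_of_def)
  show "Y = mat2_of 0 b c 0"
    using Y arg_cong[OF t, of "\<lambda>M. M $ 1 $ 2"] arg_cong[OF t, of "\<lambda>M. M $ 2 $ 1"]
    by (simp add: mat2_eq_iff Geo_def)
qed

context sl2_map
begin

lemma maurer_cartan_mat2_of:
  "z \<in> W \<Longrightarrow> maurer_cartan \<Phi> z u = mat2_of (mc \<Phi> u 1 1 z) (mc \<Phi> u 1 2 z) (mc \<Phi> u 2 1 z) (- mc \<Phi> u 1 1 z)"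
  by (simp add: mat2_eq_iff trace_maurer_cartan)

lemma harmonic_frame_Geo_iff: "harmonic_frame Geo W \<Phi> \<longleftrightarrow> (\<forall>w\<in>W. tension12 w = 0 \<and> tension21 w = 0)"
proof (rule harmonic_frame_iff_tension)
  show "p_part Geo (maurer_cartan \<Phi> z u) = mat2_of 0 (mc \<Phi> u 1 2 z) (mc \<Phi> u 2 1 z) 0" if "z \<in> W" for z u
    by (subst maurer_cartan_mat2_of[OF that]) (rule p_part_Geo)
  show "p_part Geo (mat2_of d 0 0 (- d)) = 0" for d
    by (simp add: p_part_Geo mat2_eq_iff)
qed

text \<open>The derivatives of \<open>k\<^sup>2\<close> and \<open>l\<^sup>2\<close> cancel against the change of the diagonal entry of the
  Maurer--Cartan form.\<close>

lemma gauge: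
  assumes l: "smooth_on l W" and k: "smooth_on k W" and lk: "\<And>z. z \<in> W \<Longrightarrow> l z * k z = 1"
  defines "\<Psi> \<equiv> \<lambda>z. mat2_of (\<Phi> z $ 1 $ 1 * l z) (\<Phi> z $ 1 $ 2 * k z) (\<Phi> z $ 2 $ 1 * l z) (\<Phi> z $ 2 $ 2 * k z)"
  shows "sl2_map W \<Psi>"
    and "w \<in> W \<Longrightarrow> sl2_map.tension12 \<Psi> w = k w * k w * tension12 w"
    and "w \<in> W \<Longrightarrow> sl2_map.tension21 \<Psi> w = l w * l w * tension21 w"
proof -
  show "sl2_map W \<Psi>"
  proof
    show "open W" by (rule open_W)
    show "smooth_on \<Psi> W" unfolding \<Psi>_def by (intro smooth_intros open_W smooth l k)
    fix z assume z: "z \<in> W"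
    have "det (\<Psi> z) = (\<Phi> z $ 1 $ 1 * \<Phi> z $ 2 $ 2 - \<Phi> z $ 1 $ 2 * \<Phi> z $ 2 $ 1) * (l z * k z)"
      by (simp add: \<Psi>_def det_2 algebra_simps)
    then show "det (\<Psi> z) = 1" using det_entries[OF z] lk[OF z] by simp
  qed
  then interpret \<Psi>: sl2_map W \<Psi> .
  have dl: "l differentiable at z" "k differentiable at z" if "z \<in> W" for z
    using l k that smooth_on_differentiable by blast+
  have dlk: "l z * dd k z u + dd l z u * k z = 0" if "z \<in> W" for z u
  proof -
    have "dd (\<lambda>z. l z * k z) z = dd (\<lambda>z. 1) z" by (rule dd_cong[OF open_W that lk])
    from fun_cong[OF this, of u] show ?thesis using dl[OF that] by (simp add: dd_mult)
  qed
  have e: "mc \<Psi> u 1 1 z = mc \<Phi> u 1 1 z + k z * dd l z u"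
    "mc \<Psi> u 1 2 z = k z * k z * mc \<Phi> u 1 2 z"
    "mc \<Psi> u 2 1 z = l z * l z * mc \<Phi> u 2 1 z" if z: "z \<in> W" for z u
  proof -
    have d0: "(\<lambda>z. \<Phi> z $ i $ j) differentiable at z" for i j
      using smooth_entry z smooth_on_differentiable by blast
    have dP: "dd \<Psi> z u = mat2_of (\<Phi> z $ 1 $ 1 * dd l z u + dd \<Phi> z u $ 1 $ 1 * l z)
       (\<Phi> z $ 1 $ 2 * dd k z u + dd \<Phi> z u $ 1 $ 2 * k z)
       (\<Phi> z $ 2 $ 1 * dd l z u + dd \<Phi> z u $ 2 $ 1 * l z)
       (\<Phi> z $ 2 $ 2 * dd k z u + dd \<Phi> z u $ 2 $ 2 * k z)"
      unfolding \<Psi>_def using d0 dl[OF z] diff[OF z]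
      by (simp add: dd_mat2_of dd_mult differentiable_mult dd_entry)
    note x = \<Psi>.maurer_cartan_eq[OF z, of u, unfolded dP adj2_def] maurer_cartan_eq[OF z, of u, unfolded adj2_def]
    show "mc \<Psi> u 1 1 z = mc \<Phi> u 1 1 z + k z * dd l z u"
      unfolding x mult2_entry mat2_of_entry unfolding \<Psi>_def mat2_of_entry
      using lk[OF z] det_entries[OF z] by algebra
    show "mc \<Psi> u 1 2 z = k z * k z * mc \<Phi> u 1 2 z"
      unfolding x mult2_entry mat2_of_entry unfolding \<Psi>_def mat2_of_entry
      by (simp add: algebra_simps)
    show "mc \<Psi> u 2 1 z = l z * l z * mc \<Phi> u 2 1 z"
      unfolding x mult2_entry mat2_of_entry unfolding \<Psi>_def mat2_of_entry
      by (simp add: algebra_simps)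
  qed
  show "sl2_map.tension12 \<Psi> w = k w * k w * tension12 w" if w: "w \<in> W"
  proof -
    have d: "dd (mc \<Psi> v 1 2) w u = k w * k w * dd (mc \<Phi> v 1 2) w u + 2 * k w * dd k w u * mc \<Phi> v 1 2 w" for u v
    proof -
      have "dd (mc \<Psi> v 1 2) w = dd (\<lambda>z. k z * k z * mc \<Phi> v 1 2 z) w"
        by (rule dd_cong[OF open_W w e(2)])
      then show ?thesis using dl[OF w] diff_mc[OF w]
        by (simp add: dd_mult differentiable_mult algebra_simps)
    qed
    show ?thesis
      unfolding tension12_def \<Psi>.tension12_def d
      unfolding e[OF w] using dlk[OF w, of 1] dlk[OF w, of \<i>] lk[OF w] by algebra
  qed
  show "sl2_map.tension21 \<Psi> w = l w * l w * tension21 w" if w: "w \<in> W"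
  proof -
    have d: "dd (mc \<Psi> v 2 1) w u = l w * l w * dd (mc \<Phi> v 2 1) w u + 2 * l w * dd l w u * mc \<Phi> v 2 1 w" for u v
    proof -
      have "dd (mc \<Psi> v 2 1) w = dd (\<lambda>z. l z * l z * mc \<Phi> v 2 1 z) w"
        by (rule dd_cong[OF open_W w e(3)])
      then show ?thesis using dl[OF w] diff_mc[OF w]
        by (simp add: dd_mult differentiable_mult algebra_simps)
    qed
    show ?thesis
      unfolding tension21_def \<Psi>.tension21_def d
      unfolding e[OF w] using dlk[OF w, of 1] dlk[OF w, of \<i>] lk[OF w] by algebra
  qed
qed

end

lemma (in legendrian_frame) harmonic_frame_UH3_iff: "harmonic_frame UH3 W \<Phi> \<longleftrightarrow> (\<forall>w\<in>W. stationary w)"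
proof -
  have "harmonic_frame UH3 W \<Phi> \<longleftrightarrow> (\<forall>w\<in>W. tension12 w = 0 \<and> tension21 w = 0)"
  proof (rule harmonic_frame_iff_tension)
    show "p_part UH3 (maurer_cartan \<Phi> z u) = mat2_of 0 (mc \<Phi> u 1 2 z) (mc \<Phi> u 2 1 z) 0" if "z \<in> W" for z u
      by (subst maurer_cartan_mat2_of[OF that]) (simp add: p_part_UH3 Re_mc_11[OF that])
    fix z t d assume z: "z \<in> W"
      and d: "d = of_real t * (mc \<Phi> 1 1 2 z * mc \<Phi> \<i> 2 1 z - mc \<Phi> \<i> 1 2 z * mc \<Phi> 1 2 1 z)"
    \<comment> \<open>Up to a real factor \<open>d\<close> is 2i (q r - p s), and q r - p s = m
      (|r|^2 - |p|^2) is real. An imaginary trace-free diagonal matrix lies in the isotropy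
      algebra.\<close>
    have "Re d = 0"
      unfolding d mc_pqrs coefficients(1,2)[OF z] by (simp add: algebra_simps)
    then show "p_part UH3 (mat2_of d 0 0 (- d)) = 0"
      by (simp add: p_part_UH3 mat2_eq_iff)
  qed
  then show ?thesis using tension_iff_stationary by blast
qed

section \<open>Frames of the Lagrangian Gauss map\<close>

lemma sl2_act_plane: "(\<lambda>(x, v). (sl2_act g x, sl2_act g v)) ` oriented_plane x v = oriented_plane (sl2_act g x) (sl2_act g v)"
proof -
  have "(\<lambda>(x, v). (sl2_act g x, sl2_act g v)) ` oriented_plane x v =
    {(sl2_act g (a *\<^sub>R x + b *\<^sub>R v), sl2_act g (c *\<^sub>R x + d *\<^sub>R v)) | a b c d. a * d - b * c > 0}"
    unfolding oriented_plane_def by (auto simp: image_iff, metis+)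
  then show ?thesis by (simp add: oriented_plane_def sl2_act_add sl2_act_scaleR)
qed

lemma action_Geo: "action Geo g (base_point Geo) = oriented_plane (sl2_act g (axis 0 1)) (sl2_act g (axis 1 1))"
  by (simp add: Geo_def sl2_act_plane)

text \<open>Both pairs are Lorentz orthonormal bases of one plane, so the base change preserves
  diag(-1, 1). Equal orientation and two future-pointing timelike vectors leave only the hyperbolic
  rotations, with a = cosh and b = sinh of one parameter.\<close>

lemma boost:
  fixes f n x v :: vec4
  assumes f: "mink f f = - 1" "f $ 0 > 0" "mink n n = 1" "mink n f = 0"
    and x: "mink x x = - 1" "x $ 0 > 0" "mink v v = 1" "mink v x = 0"
    and plane: "oriented_plane x v = oriented_plane f n"
  shows "\<exists>a b. x = a *\<^sub>R f + b *\<^sub>R n \<and> v = b *\<^sub>R f + a *\<^sub>R n \<and> a\<^sup>2 = 1 + b\<^sup>2 \<and> a > 0"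
proof -
  have "(x, v) \<in> oriented_plane f n"
    unfolding plane[symmetric] unfolding oriented_plane_def
    by (rule CollectI, rule exI[of _ 1], rule exI[of _ 0], rule exI[of _ 0], rule exI[of _ 1]) simp
  then obtain a b c d where e: "x = a *\<^sub>R f + b *\<^sub>R n" "v = c *\<^sub>R f + d *\<^sub>R n" and pos: "a * d - b * c > 0"
    unfolding oriented_plane_def by blast
  have g: "a\<^sup>2 = 1 + b\<^sup>2" "d\<^sup>2 = 1 + c\<^sup>2" "a * c = b * d"
    using x f mink_commute[of f n] unfolding e
    by (simp_all add: mink_add_left mink_add_right mink_scaleR_left mink_scaleR_right power2_eq_square algebra_simps)
  have ab: "\<bar>b\<bar> < \<bar>a\<bar>" using g(1) abs_le_square_iff[of a b] by linarith
  have a: "a > 0"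
  proof (rule ccontr)
    assume "\<not> a > 0"
    with ab have "a < 0" by auto
    have "\<bar>b\<bar> * \<bar>n $ 0\<bar> \<le> \<bar>a\<bar> * f $ 0"
      using ab timelike_dominates[OF f] by (intro mult_mono) auto
    then have "b * n $ 0 \<le> - (a * f $ 0)"
      using abs_le_D1[of "b * n $ 0"] \<open>a < 0\<close> by (simp add: abs_mult)
    with x(2) e(1) show False by simp
  qed
  have d: "d = a"
  proof -
    \<comment> \<open>Since a c = b d, the left side is d (a^2 - b^2) = d; the positive determinant
      thus fixes the sign of \<open>d\<close>.\<close>
    have "a * (a * d - b * c) = d"
      using g by algebra
    with a pos have "d > 0" by (metis mult_pos_pos)
    have "a\<^sup>2 * d\<^sup>2 = a\<^sup>2 + (a * c)\<^sup>2" unfolding g(2) by (simp add: algebra_simps power_mult_distrib)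
    also have "\<dots> = a\<^sup>2 + b\<^sup>2 * d\<^sup>2" by (simp add: g(3) power_mult_distrib)
    finally have "d\<^sup>2 = a\<^sup>2" using g(1) by (simp add: algebra_simps)
    with a \<open>d > 0\<close> show ?thesis by (simp add: power2_eq_iff_nonneg)
  qed
  with g(3) a have "c = b" by simp
  with d e g a show ?thesis by blast
qed

lemma sl2_act_axis0_time:
  "2 * sl2_act g (axis 0 1) $ 0 = (cmod (g $ 1 $ 1))\<^sup>2 + (cmod (g $ 1 $ 2))\<^sup>2 + (cmod (g $ 2 $ 1))\<^sup>2 + (cmod (g $ 2 $ 2))\<^sup>2"
  and sl2_act_axis1_time:
  "2 * sl2_act g (axis 1 1) $ 0 = (cmod (g $ 1 $ 1))\<^sup>2 - (cmod (g $ 1 $ 2))\<^sup>2 + (cmod (g $ 2 $ 1))\<^sup>2 - (cmod (g $ 2 $ 2))\<^sup>2"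
proof -
  have t: "complex_of_real (2 * x $ 0) = herm x $ 1 $ 1 + herm x $ 2 $ 2" for x by (simp add: herm_entry)
  have "complex_of_real (2 * sl2_act g (axis 0 1) $ 0) =
    of_real ((cmod (g $ 1 $ 1))\<^sup>2 + (cmod (g $ 1 $ 2))\<^sup>2 + (cmod (g $ 2 $ 1))\<^sup>2 + (cmod (g $ 2 $ 2))\<^sup>2)"
    unfolding t of_real_add of_real_diff complex_norm_square using sl2_act_axis0_iff[of g "sl2_act g (axis 0 1)"] by simp
  then show "2 * sl2_act g (axis 0 1) $ 0 = (cmod (g $ 1 $ 1))\<^sup>2 + (cmod (g $ 1 $ 2))\<^sup>2 + (cmod (g $ 2 $ 1))\<^sup>2 + (cmod (g $ 2 $ 2))\<^sup>2"
    unfolding of_real_eq_iff .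
  have "complex_of_real (2 * sl2_act g (axis 1 1) $ 0) =
    of_real ((cmod (g $ 1 $ 1))\<^sup>2 - (cmod (g $ 1 $ 2))\<^sup>2 + (cmod (g $ 2 $ 1))\<^sup>2 - (cmod (g $ 2 $ 2))\<^sup>2)"
    unfolding t of_real_add of_real_diff complex_norm_square using sl2_act_axis1_iff[of g "sl2_act g (axis 1 1)"] by simp
  then show "2 * sl2_act g (axis 1 1) $ 0 = (cmod (g $ 1 $ 1))\<^sup>2 - (cmod (g $ 1 $ 2))\<^sup>2 + (cmod (g $ 2 $ 1))\<^sup>2 - (cmod (g $ 2 $ 2))\<^sup>2"
    unfolding of_real_eq_iff .
qed

section \<open>The equivalences within one coordinate patch\<close>

context conformal_patch
begin

lemma legendrian_frameI:
  assumes "open W" "W \<subseteq> U" "local_frame UH3 (\<lambda>z. (f z, n z)) W \<Phi>"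
  shows "legendrian_frame U f n W \<Phi>"
  using assms unfolding local_frame_def action_UH3_iff by unfold_locales auto

lemma ex_frame:
  assumes "w \<in> U"
  shows "\<exists>W \<Phi>. open W \<and> w \<in> W \<and> W \<subseteq> U \<and> local_frame UH3 (\<lambda>z. (f z, n z)) W \<Phi>"
  using ex_legendrian_frame[OF open_U smooth_f smooth_n mink_ff f0_pos mink_nn mink_nf assms] by blast

lemma harmonic_on_UH3_iff: "harmonic_on UH3 (\<lambda>z. (f z, n z)) U \<longleftrightarrow> (\<forall>w\<in>U. stationary w)"
proof
  assume h: "harmonic_on UH3 (\<lambda>z. (f z, n z)) U"
  show "\<forall>w\<in>U. stationary w"
  proof
    fix w assume "w \<in> U"
    then obtain W \<Phi> where W: "open W" "w \<in> W" "W \<subseteq> U" "local_frame UH3 (\<lambda>z. (f z, n z)) W \<Phi>"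
      using ex_frame by blast
    interpret legendrian_frame U f n W \<Phi> by (rule legendrian_frameI[OF W(1,3,4)])
    show "stationary w" using h W harmonic_frame_UH3_iff unfolding harmonic_on_def by blast
  qed
next
  assume st: "\<forall>w\<in>U. stationary w"
  show "harmonic_on UH3 (\<lambda>z. (f z, n z)) U"
    unfolding harmonic_on_def
  proof (intro conjI ballI allI impI)
    fix w assume "w \<in> U"
    from ex_frame[OF this] show "\<exists>W. open W \<and> w \<in> W \<and> W \<subseteq> U \<and> (\<exists>\<Phi>. local_frame UH3 (\<lambda>z. (f z, n z)) W \<Phi>)" by metis
  next
    fix W \<Phi> assume W: "open W \<and> W \<subseteq> U \<and> local_frame UH3 (\<lambda>z. (f z, n z)) W \<Phi>"
    then have "harmonic_frame UH3 W \<Phi> \<longleftrightarrow> (\<forall>w\<in>W. stationary w)"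
      by (intro legendrian_frame.harmonic_frame_UH3_iff[OF legendrian_frameI]) auto
    then show "harmonic_frame UH3 W \<Phi>" using st W by auto
  qed
qed

lemma klotz_coeff_holomorphic_iff: "klotz_coeff holomorphic_on U \<longleftrightarrow> (\<forall>w\<in>U. stationary w)"
proof -
  have "klotz_coeff field_differentiable at w \<longleftrightarrow> stationary w" if w: "w \<in> U" for w
  proof -
    obtain W \<Phi> where W: "open W" "w \<in> W" "W \<subseteq> U" "local_frame UH3 (\<lambda>z. (f z, n z)) W \<Phi>"
      using ex_frame w by blast
    interpret legendrian_frame U f n W \<Phi> by (rule legendrian_frameI[OF W(1,3,4)])
    show ?thesis using klotz_coeff_differentiable W(2) .
  qed
  then show ?thesis
    unfolding holomorphic_on_def using at_within_open[OF _ open_U] by auto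
qed

text \<open>A frame of the oriented plane carries the base point to some pair (x, v) which is a
  boost of (f, n). Undoing the boost by a diagonal gauge gives a Legendrian frame, and the tensions
  change only by the nonvanishing factors k^2 and l^2.\<close>

lemma harmonic_frame_Geo_iff_stationary:
  assumes W: "open W" "W \<subseteq> U" and fr: "local_frame Geo (\<lambda>z. oriented_plane (f z) (n z)) W \<Phi>"
  shows "harmonic_frame Geo W \<Phi> \<longleftrightarrow> (\<forall>w\<in>W. stationary w)"
proof -
  interpret sl2_map W \<Phi> using W fr unfolding local_frame_def by unfold_locales auto
  define c1 where "c1 = (\<lambda>z. (cmod (\<Phi> z $ 1 $ 1))\<^sup>2 + (cmod (\<Phi> z $ 2 $ 1))\<^sup>2)"
  \<comment> \<open>The scaling has to be smooth, so it is given explicitly: x + v = (a + b) (f +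
    n), and \<open>c1\<close> is the time component of x + v, whence t = 1 / (a + b) = a - b.
    Scaling the first column by the square root of \<open>t\<close> turns x + v into f + n.\<close>
  define t where "t = (\<lambda>z. (f z $ 0 + n z $ 0) * c1 z powr (- 1))"
  define l where "l = (\<lambda>z. complex_of_real (t z powr (1/2)))"
  define k where "k = (\<lambda>z. complex_of_real (t z powr (-1/2)))"
  have c1_pos: "c1 z > 0" if "z \<in> W" for z
    using det_entries[OF that] unfolding c1_def
    by (metis add_pos_nonneg add_nonneg_pos diff_0_right mult_zero_left mult_zero_right zero_le_power2
        zero_less_norm_iff zero_less_power zero_neq_one)
  have t_pos: "t z > 0" if z: "z \<in> W" for z
  proof -
    have "z \<in> U" using z W(2) by auto
    from timelike_dominates[OF mink_ff[OF this] f0_pos[OF this] mink_nn[OF this] mink_nf[OF this]] c1_pos[OF z]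
    show ?thesis unfolding t_def by (intro mult_pos_pos) auto
  qed
  have smooth_c1: "smooth_on c1 W"
  proof -
    have "c1 = (\<lambda>z. Re (\<Phi> z $ 1 $ 1 * cnj (\<Phi> z $ 1 $ 1) + \<Phi> z $ 2 $ 1 * cnj (\<Phi> z $ 2 $ 1)))"
      unfolding c1_def by (simp add: complex_mult_cnj cmod_power2)
    then show ?thesis
      by (simp only:) (intro smooth_on_bounded_linear[OF bounded_linear_Re] smooth_intros open_W smooth)
  qed
  have smooth_t: "smooth_on t W"
    unfolding t_def by (intro smooth_intros smooth_on_powr open_W smooth_c1 c1_pos
        smooth_on_subset[OF smooth_f W(2)] smooth_on_subset[OF smooth_n W(2)])
  have sl: "smooth_on l W" and sk: "smooth_on k W"
    unfolding l_def k_def by (intro smooth_on_of_real smooth_on_powr smooth_t t_pos open_W; assumption)+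
  have lk: "l z * k z = 1" if "z \<in> W" for z
    using t_pos[OF that] by (simp add: l_def k_def flip: of_real_mult powr_add)
  define \<Psi> where "\<Psi> = (\<lambda>z. mat2_of (\<Phi> z $ 1 $ 1 * l z) (\<Phi> z $ 1 $ 2 * k z) (\<Phi> z $ 2 $ 1 * l z) (\<Phi> z $ 2 $ 2 * k z))"
  have g1: "sl2_map W \<Psi>"
    unfolding \<Psi>_def by (rule gauge(1)[OF sl sk]) (rule lk)
  have g2: "sl2_map.tension12 \<Psi> w = k w * k w * tension12 w" "sl2_map.tension21 \<Psi> w = l w * l w * tension21 w"
    if "w \<in> W" for w
    unfolding \<Psi>_def by (rule gauge(2,3)[OF sl sk]; use lk that in auto)+
  have "sl2_act (\<Psi> z) (axis 0 1) = f z \<and> sl2_act (\<Psi> z) (axis 1 1) = n z" if z: "z \<in> W" for z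
  proof -
    have zU: "z \<in> U" using z W(2) by auto
    define x where "x = sl2_act (\<Phi> z) (axis 0 1)"
    define v where "v = sl2_act (\<Phi> z) (axis 1 1)"
    have tx: "2 * x $ 0 = (cmod (\<Phi> z $ 1 $ 1))\<^sup>2 + (cmod (\<Phi> z $ 1 $ 2))\<^sup>2 + (cmod (\<Phi> z $ 2 $ 1))\<^sup>2 + (cmod (\<Phi> z $ 2 $ 2))\<^sup>2"
      and tv: "2 * v $ 0 = (cmod (\<Phi> z $ 1 $ 1))\<^sup>2 - (cmod (\<Phi> z $ 1 $ 2))\<^sup>2 + (cmod (\<Phi> z $ 2 $ 1))\<^sup>2 - (cmod (\<Phi> z $ 2 $ 2))\<^sup>2"
      unfolding x_def v_def by (rule sl2_act_axis0_time sl2_act_axis1_time)+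
    have "x $ 0 > 0"
    proof -
      have "2 * x $ 0 = c1 z + (cmod (\<Phi> z $ 1 $ 2))\<^sup>2 + (cmod (\<Phi> z $ 2 $ 2))\<^sup>2" using tx by (simp add: c1_def)
      moreover have "(cmod (\<Phi> z $ 1 $ 2))\<^sup>2 + (cmod (\<Phi> z $ 2 $ 2))\<^sup>2 \<ge> 0" by simp
      ultimately show ?thesis using c1_pos[OF z] by linarith
    qed
    moreover have "mink x x = - 1" "mink v v = 1" "mink v x = 0"
      unfolding x_def v_def by (simp_all add: mink_sl2_act det_1[OF z] mink_axis)
    moreover have "oriented_plane x v = oriented_plane (f z) (n z)"
      using fr z unfolding local_frame_def action_Geo x_def v_def by blast
    ultimately obtain a b where ab: "x = a *\<^sub>R f z + b *\<^sub>R n z" "v = b *\<^sub>R f z + a *\<^sub>R n z" "a\<^sup>2 = 1 + b\<^sup>2" "a > 0"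
      using boost[OF mink_ff[OF zU] f0_pos[OF zU] mink_nn[OF zU] mink_nf[OF zU]] by blast
    have "c1 z = (a + b) * (f z $ 0 + n z $ 0)"
      using tx tv ab(1,2) by (simp add: c1_def algebra_simps)
    moreover have "f z $ 0 + n z $ 0 > 0"
      using timelike_dominates[OF mink_ff[OF zU] f0_pos[OF zU] mink_nn[OF zU] mink_nf[OF zU]] by auto
    ultimately have t: "t z * (a + b) = 1"
      using c1_pos[OF z] by (simp add: t_def powr_minus field_simps)
    then have t': "t z = a - b"
      using ab(3) by algebra
    have ll: "l z * l z = of_real (a - b)"
      using t_pos[OF z] by (simp add: l_def t' flip: of_real_mult powr_add of_real_diff)
    have kk: "k z * k z = of_real (a + b)"
    proof -
      have "complex_of_real (a - b) * of_real (a + b) = 1"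
        using arg_cong[OF t[unfolded t'], of complex_of_real] by simp
      then show ?thesis using lk[OF z] ll by algebra
    qed
    have cl: "cnj (l z) = l z" "cnj (k z) = k z" by (simp_all add: l_def k_def)
    have fz: "f z = a *\<^sub>R x - b *\<^sub>R v" and nz: "n z = a *\<^sub>R v - b *\<^sub>R x"
      unfolding ab(1,2) using ab(3)
      by (simp_all add: scaleR_right_distrib scaleR_right_diff_distrib power2_eq_square scaleR_left_distrib algebra_simps)
    have hx: "herm x $ i $ j = \<Phi> z $ i $ 1 * cnj (\<Phi> z $ j $ 1) + \<Phi> z $ i $ 2 * cnj (\<Phi> z $ j $ 2)"
      and hv: "herm v $ i $ j = \<Phi> z $ i $ 1 * cnj (\<Phi> z $ j $ 1) - \<Phi> z $ i $ 2 * cnj (\<Phi> z $ j $ 2)" for i j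
      unfolding x_def v_def herm_sl2_act mult2_entry
      by (simp_all add: forall_2 herm_entry(1-4)[of "axis _ _"] axis_entry)
    have "linear herm" using bounded_linear_herm by (rule bounded_linear.linear)
    then have hf: "herm (f z) $ i $ j = of_real (a - b) * (\<Phi> z $ i $ 1 * cnj (\<Phi> z $ j $ 1)) + of_real (a + b) * (\<Phi> z $ i $ 2 * cnj (\<Phi> z $ j $ 2))"
      and hn: "herm (n z) $ i $ j = of_real (a - b) * (\<Phi> z $ i $ 1 * cnj (\<Phi> z $ j $ 1)) - of_real (a + b) * (\<Phi> z $ i $ 2 * cnj (\<Phi> z $ j $ 2))" for i j
      unfolding fz nz by (simp_all add: linear_diff linear_cmul hx hv, simp_all add: scaleR_conv_of_real algebra_simps)
    show ?thesis
      unfolding sl2_act_axis0_iff sl2_act_axis1_iff hf hn \<Psi>_def mat2_of_entry complex_cnj_mult cl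
        ll[symmetric] kk[symmetric]
      by (simp add: mult_ac)
  qed
  then have "local_frame UH3 (\<lambda>z. (f z, n z)) W \<Psi>"
    using g1 unfolding local_frame_def action_UH3_iff sl2_map_def by blast
  then interpret F: legendrian_frame U f n W \<Psi> by (rule legendrian_frameI[OF W])
  have "tension12 w = 0 \<and> tension21 w = 0 \<longleftrightarrow> stationary w" if w: "w \<in> W" for w
    using F.tension_iff_stationary[OF w] g2[OF w] lk[OF w] by auto
  then show ?thesis unfolding harmonic_frame_Geo_iff by blast
qed

lemma harmonic_on_Geo_iff: "harmonic_on Geo (\<lambda>z. oriented_plane (f z) (n z)) U \<longleftrightarrow> (\<forall>w\<in>U. stationary w)"
proof -
  have ex: "\<exists>W \<Phi>. open W \<and> w \<in> W \<and> W \<subseteq> U \<and> local_frame Geo (\<lambda>z. oriented_plane (f z) (n z)) W \<Phi>" if w: "w \<in> U" for w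
  proof -
    obtain W \<Phi> where W: "open W" "w \<in> W" "W \<subseteq> U" "local_frame UH3 (\<lambda>z. (f z, n z)) W \<Phi>"
      using ex_frame w by blast
    have "local_frame Geo (\<lambda>z. oriented_plane (f z) (n z)) W \<Phi>"
      using W(4) unfolding local_frame_def action_UH3_iff action_Geo by simp
    with W show ?thesis by blast
  qed
  show ?thesis
  proof
    assume h: "harmonic_on Geo (\<lambda>z. oriented_plane (f z) (n z)) U"
    show "\<forall>w\<in>U. stationary w"
    proof
      fix w assume "w \<in> U"
      then obtain W \<Phi> where W: "open W" "w \<in> W" "W \<subseteq> U" "local_frame Geo (\<lambda>z. oriented_plane (f z) (n z)) W \<Phi>"
        using ex by blast
      then show "stationary w" using h harmonic_frame_Geo_iff_stationary[OF W(1,3,4)] unfolding harmonic_on_def by blast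
    qed
  next
    assume st: "\<forall>w\<in>U. stationary w"
    show "harmonic_on Geo (\<lambda>z. oriented_plane (f z) (n z)) U"
      unfolding harmonic_on_def
    proof (intro conjI ballI allI impI)
      fix w assume "w \<in> U"
      from ex[OF this] show "\<exists>W. open W \<and> w \<in> W \<and> W \<subseteq> U \<and> (\<exists>\<Phi>. local_frame Geo (\<lambda>z. oriented_plane (f z) (n z)) W \<Phi>)" by metis
    next
      fix W \<Phi> assume W: "open W \<and> W \<subseteq> U \<and> local_frame Geo (\<lambda>z. oriented_plane (f z) (n z)) W \<Phi>"
      then have "harmonic_frame Geo W \<Phi> \<longleftrightarrow> (\<forall>w\<in>W. stationary w)"
        by (intro harmonic_frame_Geo_iff_stationary) auto
      then show "harmonic_frame Geo W \<Phi>" using st W by auto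
    qed
  qed
qed

end

section \<open>Charts\<close>

lemma is_chart_inj: "is_chart X c \<Longrightarrow> inj_on (snd c) (fst c)"
  unfolding is_chart_def
  by (metis homeomorphic_imp_injective_map openin_subset topspace_subtopology_subset)

lemma in_chart_apply: "is_chart X c \<Longrightarrow> p \<in> fst c \<Longrightarrow> in_chart c g (snd c p) = g p"
  by (simp add: in_chart_def is_chart_inj inv_into_f_f)

lemma open_chart_image_of:
  assumes c: "is_chart X c" and V: "openin X V" "V \<subseteq> fst c"
  shows "open (snd c ` V)"
proof -
  have "openin (subtopology X (fst c)) V" using V by (meson openin_subset_topspace_eq openin_open_subtopology c is_chart_def)
  moreover have "open_map (subtopology X (fst c)) (top_of_set (chart_image c)) (snd c)"
    using c by (simp add: is_chart_def homeomorphic_imp_open_map)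
  ultimately have "openin (top_of_set (chart_image c)) (snd c ` V)" by (simp add: open_map_def)
  then show ?thesis using c by (auto simp: is_chart_def intro: openin_open_trans)
qed

lemma openin_chart_preimage:
  assumes c: "is_chart X c" and B: "open B"
  shows "openin X {p \<in> fst c. snd c p \<in> B}"
proof -
  have sub: "fst c \<subseteq> topspace X" using c openin_subset by (auto simp: is_chart_def)
  have "continuous_map (subtopology X (fst c)) (top_of_set (chart_image c)) (snd c)"
    using c by (simp add: is_chart_def homeomorphic_imp_continuous_map)
  moreover have "openin (top_of_set (chart_image c)) (chart_image c \<inter> B)"
    using B by (simp add: openin_open_Int)
  ultimately have "openin (subtopology X (fst c)) {p \<in> topspace (subtopology X (fst c)). snd c p \<in> chart_image c \<inter> B}"
    by (rule openin_continuous_map_preimage)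
  moreover have "{p \<in> topspace (subtopology X (fst c)). snd c p \<in> chart_image c \<inter> B} = {p \<in> fst c. snd c p \<in> B}"
    using sub by (auto simp: chart_image_def)
  ultimately show ?thesis using c by (simp add: is_chart_def openin_open_subtopology)
qed

text \<open>The transition from \<open>c\<close> to \<open>d\<close> is the map \<open>in_chart c (snd d)\<close>, defined on the overlap as seen in \<open>c\<close>.\<close>

lemma chart_overlap:
  assumes c: "is_chart X c" and d: "is_chart X d"
  shows "open (snd c ` (fst c \<inter> fst d))"
    and "in_chart c (snd d) ` (snd c ` (fst c \<inter> fst d)) \<subseteq> chart_image d"
    and "z \<in> snd c ` (fst c \<inter> fst d) \<Longrightarrow> in_chart c g z = in_chart d g (in_chart c (snd d) z)"
proof -
  have "openin X (fst c \<inter> fst d)" using c d by (auto simp: is_chart_def)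
  then show "open (snd c ` (fst c \<inter> fst d))" by (rule open_chart_image_of[OF c]) simp
  show "in_chart c (snd d) ` (snd c ` (fst c \<inter> fst d)) \<subseteq> chart_image d"
    using in_chart_apply[OF c] by (auto simp: chart_image_def)
  show "in_chart c g z = in_chart d g (in_chart c (snd d) z)" if "z \<in> snd c ` (fst c \<inter> fst d)"
    using that by (auto simp: in_chart_apply[OF c] in_chart_apply[OF d])
qed

lemma smooth_on_in_chart:
  assumes c: "is_chart X c" and d: "is_chart X d" and t: "smooth_transition c d"
    and g: "smooth_on (in_chart d g) (chart_image d)"
  shows "smooth_on (in_chart c g) (snd c ` (fst c \<inter> fst d))"
proof (rule smooth_on_cong[OF chart_overlap(1)[OF c d]])
  show "smooth_on (\<lambda>z. in_chart d g (in_chart c (snd d) z)) (snd c ` (fst c \<inter> fst d))"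
    using d t by (intro smooth_on_compose[OF chart_overlap(1)[OF c d] _ chart_overlap(2)[OF c d] g])
      (auto simp: is_chart_def smooth_transition_def)
qed (rule chart_overlap(3)[OF c d, symmetric])

lemma dd_in_chart:
  assumes c: "is_chart X c" and d: "is_chart X d" and t: "smooth_transition c d"
    and g: "smooth_on (in_chart d g) (chart_image d)" and p: "p \<in> fst c" "p \<in> fst d"
  shows "dd (in_chart c g) (snd c p) u = dd (in_chart d g) (snd d p) (dd (in_chart c (snd d)) (snd c p) u)"
proof -
  let ?V = "snd c ` (fst c \<inter> fst d)"
  have w: "snd c p \<in> ?V" using p by auto
  have e: "in_chart c (snd d) (snd c p) = snd d p" by (rule in_chart_apply[OF c p(1)])
  have 1: "in_chart c (snd d) differentiable at (snd c p)"
    using t w smooth_on_differentiable by (auto simp: smooth_transition_def)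
  have 2: "in_chart d g differentiable at (snd d p)"
    using g p smooth_on_differentiable by (fastforce simp: chart_image_def)
  have "dd (in_chart c g) (snd c p) = dd (\<lambda>z. in_chart d g (in_chart c (snd d) z)) (snd c p)"
    by (rule dd_cong[OF chart_overlap(1)[OF c d] w chart_overlap(3)[OF c d]])
  also have "\<dots> = dd (in_chart d g) (snd d p) \<circ> dd (in_chart c (snd d)) (snd c p)"
    using frechet_derivative_compose[OF 1, of "in_chart d g"] 2 unfolding e o_def by simp
  finally show ?thesis by simp
qed

lemma det_form_matrix_pullback:
  fixes F G :: "complex \<Rightarrow> vec4" and L :: "complex \<Rightarrow> complex"
  assumes "linear F" "linear G"
  shows "det (form_matrix (\<lambda>u v. mink (F (L u)) (G (L v)))) =
     (Re (L 1) * Im (L \<i>) - Im (L 1) * Re (L \<i>))\<^sup>2 * det (form_matrix (\<lambda>u v. mink (F u) (G v)))"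
proof -
  have e: "H x = Re x *\<^sub>R H 1 + Im x *\<^sub>R H \<i>" if "linear H" for H :: "complex \<Rightarrow> vec4" and x
  proof -
    have "H x = H (Re x *\<^sub>R 1 + Im x *\<^sub>R \<i>)" by (rule arg_cong[of _ _ H]) (simp add: complex_eq_iff)
    then show ?thesis using that by (simp add: linear_add linear_cmul)
  qed
  have "mink (F (L u)) (G (L v)) = Re (L u) * Re (L v) * mink (F 1) (G 1) + Re (L u) * Im (L v) * mink (F 1) (G \<i>)
     + Im (L u) * Re (L v) * mink (F \<i>) (G 1) + Im (L u) * Im (L v) * mink (F \<i>) (G \<i>)" for u v
    by (subst e[OF assms(1)], subst e[OF assms(2)])
      (simp add: mink_add_left mink_add_right mink_scaleR_left mink_scaleR_right algebra_simps)
  then show ?thesis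
    by (simp add: form_matrix_def det_2 power2_eq_square) (simp add: algebra_simps)
qed

lemma det_form_matrix_minus: "det (form_matrix (\<lambda>u v. - B u v)) = det (form_matrix B)"
  by (simp add: form_matrix_def det_2)

lemma det_matrix_inv_mult:
  fixes M N :: "real ^ 'n ^ 'n"
  assumes "det M \<noteq> 0"
  shows "det (matrix_inv M ** N) = det N / det M"
proof -
  have "matrix_inv M ** M = mat 1" using assms by (intro matrix_inv_left) (simp add: invertible_det_nz)
  then have "det (matrix_inv M) * det M = 1" by (metis det_I det_mul)
  then show ?thesis using assms by (simp add: det_mul field_simps)
qed

lemma (in conformal_patch) det_first_form_nonzero:
  assumes "w \<in> U"
  shows "det (form_matrix (\<lambda>u v. mink (dd f w u) (dd f w v))) \<noteq> 0"
proof -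
  obtain W \<Phi> where W: "open W" "w \<in> W" "W \<subseteq> U" "local_frame UH3 (\<lambda>z. (f z, n z)) W \<Phi>"
    using ex_frame assms by blast
  interpret legendrian_frame U f n W \<Phi> by (rule legendrian_frameI[OF W(1,3,4)])
  have "det (form_matrix (\<lambda>u v. mink (dd f w u) (dd f w v))) = (Im (cnj (\<zeta> 1 w) * \<zeta> \<i> w))\<^sup>2"
    by (simp add: form_matrix_def det_2 first_fundamental[OF W(2)] power2_eq_square algebra_simps)
  then show ?thesis using orientation_pos[OF W(2)] by simp
qed

lemma connected_space_locally_constant:
  fixes K :: "'a \<Rightarrow> 'b"
  assumes "connected_space X"
    and loc: "\<And>p. p \<in> topspace X \<Longrightarrow> \<exists>V. openin X V \<and> p \<in> V \<and> (\<forall>q\<in>V. K q = K p)"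
  shows "\<exists>k. \<forall>p\<in>topspace X. K p = k"
proof (cases "topspace X = {}")
  case False
  then obtain p0 where p0: "p0 \<in> topspace X" by blast
  \<comment> \<open>An arbitrary predicate, so that the level set and its complement are open by the
    same argument.\<close>
  have op: "openin X {q \<in> topspace X. P (K q)}" for P
  proof (subst openin_subopen, intro ballI)
    fix q assume "q \<in> {q \<in> topspace X. P (K q)}"
    then obtain V where V: "openin X V" "q \<in> V" "\<And>x. x \<in> V \<Longrightarrow> K x = K q" and "P (K q)" using loc[of q] by blast
    moreover have "V \<subseteq> {q \<in> topspace X. P (K q)}"
    proof
      fix x assume "x \<in> V"
      then show "x \<in> {q \<in> topspace X. P (K q)}"
        using V(3)[of x] \<open>P (K q)\<close> openin_subset[OF V(1)] by auto
    qed
    ultimately show "\<exists>T. openin X T \<and> q \<in> T \<and> T \<subseteq> {q \<in> topspace X. P (K q)}"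
      by blast
  qed
  have "topspace X - {q \<in> topspace X. K q = K p0} = {q \<in> topspace X. K q \<noteq> K p0}" by auto
  then have "closedin X {q \<in> topspace X. K q = K p0}"
    unfolding closedin_def using op[of "\<lambda>k. k \<noteq> K p0"] by auto
  from assms(1)[unfolded connected_space_clopen_in, rule_format, OF conjI[OF op[of "\<lambda>k. k = K p0"] this]]
  have "{q \<in> topspace X. K q = K p0} = {} \<or> {q \<in> topspace X. K q = K p0} = topspace X" .
  with p0 have "{q \<in> topspace X. K q = K p0} = topspace X" by auto
  then show ?thesis by (intro exI[of _ "K p0"]) auto
qed simp

section \<open>From coordinate patches to the whole surface\<close>

locale surface =
  fixes X :: "'a topology" and A C :: "'a chart set" and f n :: "'a \<Rightarrow> vec4"
  assumes surf: "connected_smooth_surface X A"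
    and imm: "immersed_surface X A f"
    and nor: "unit_normal X A f n"
    and conf: "second_conformal_structure X A f n C"
begin

lemma chart_A: "d \<in> A \<Longrightarrow> is_chart X d" and cover_A: "p \<in> topspace X \<Longrightarrow> \<exists>d\<in>A. p \<in> fst d"
  using surf unfolding connected_smooth_surface_def covering_charts_def by auto

lemma chart_C: "c \<in> C \<Longrightarrow> is_chart X c" and cover_C: "p \<in> topspace X \<Longrightarrow> \<exists>c\<in>C. p \<in> fst c"
  using conf unfolding second_conformal_structure_def complex_structure_def covering_charts_def by auto

lemma in_topspace: "is_chart X c \<Longrightarrow> p \<in> fst c \<Longrightarrow> p \<in> topspace X"
  using openin_subset by (auto simp: is_chart_def)

lemma transition: "c \<in> C \<Longrightarrow> d \<in> A \<Longrightarrow> smooth_transition c d"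
  using conf unfolding second_conformal_structure_def complex_structure_def by auto

lemma smooth_f_A: "d \<in> A \<Longrightarrow> smooth_on (in_chart d f) (chart_image d)"
  and smooth_n_A: "d \<in> A \<Longrightarrow> smooth_on (in_chart d n) (chart_image d)"
  using imm nor unfolding immersed_surface_def unit_normal_def smooth_map_def by auto

lemma smooth_on_C:
  assumes c: "c \<in> C" and g: "\<And>d. d \<in> A \<Longrightarrow> smooth_on (in_chart d g) (chart_image d)"
  shows "smooth_on (in_chart c g) (chart_image c)"
proof (rule smooth_on_local)
  fix w assume "w \<in> chart_image c"
  then obtain p where p: "p \<in> fst c" "w = snd c p" by (auto simp: chart_image_def)
  then obtain d where d: "d \<in> A" "p \<in> fst d" using cover_A in_topspace[OF chart_C[OF c]] by blast
  show "\<exists>T. open T \<and> w \<in> T \<and> smooth_on (in_chart c g) T"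
    using smooth_on_in_chart[OF chart_C[OF c] chart_A[OF d(1)] transition[OF c d(1)] g[OF d(1)]]
      chart_overlap(1)[OF chart_C[OF c] chart_A[OF d(1)]] p d(2)
    by (intro exI[of _ "snd c ` (fst c \<inter> fst d)"]) auto
qed

lemma patch:
  assumes c: "c \<in> C"
  shows "conformal_patch (chart_image c) (in_chart c f) (in_chart c n)"
proof
  note ch = chart_C[OF c]
  show "open (chart_image c)" using ch by (simp add: is_chart_def)
  show "smooth_on (in_chart c f) (chart_image c)" "smooth_on (in_chart c n) (chart_image c)"
    by (intro smooth_on_C[OF c] smooth_f_A smooth_n_A; assumption)+
  fix w assume w: "w \<in> chart_image c"
  then obtain p where p: "p \<in> fst c" "w = snd c p" by (auto simp: chart_image_def)
  have pX: "p \<in> topspace X" using in_topspace[OF ch p(1)] .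
  have fp: "in_chart c f w = f p" "in_chart c n w = n p" unfolding p(2) by (rule in_chart_apply[OF ch p(1)])+
  have "f p \<in> hyperbolic3" using imm pX by (auto simp: immersed_surface_def)
  then show "mink (in_chart c f w) (in_chart c f w) = - 1" "0 < in_chart c f w $ 0"
    unfolding fp hyperbolic3_iff by auto
  show "mink (in_chart c n w) (in_chart c n w) = 1" "mink (in_chart c n w) (in_chart c f w) = 0"
    using nor pX unfolding fp unit_normal_def by auto
  show "\<exists>r>0. \<forall>u v. - mink (dd (in_chart c f) w u) (dd (in_chart c n) w v) = r * (u \<bullet> v)"
    using conf c w unfolding second_conformal_structure_def conformal_chart_def second_form_def by blast
  show "0 < det (rows4 (in_chart c f w) (dd (in_chart c f) w 1) (dd (in_chart c f) w \<i>) (in_chart c n w))"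
    using conf c w unfolding second_conformal_structure_def oriented_chart_def rows4_def by blast
  fix u
  obtain d where d: "d \<in> A" "p \<in> fst d" using cover_A pX by blast
  have "in_chart d n (snd d p) = n p" by (rule in_chart_apply[OF chart_A[OF d(1)] d(2)])
  moreover have "snd d p \<in> chart_image d" using d by (auto simp: chart_image_def)
  ultimately have "mink (n p) (dd (in_chart d f) (snd d p) v) = 0" for v
    using nor d(1) unfolding unit_normal_def by metis
  then show "mink (in_chart c n w) (dd (in_chart c f) w u) = 0"
    unfolding fp unfolding p(2)
    by (simp add: dd_in_chart[OF ch chart_A[OF d(1)] transition[OF c d(1)] smooth_f_A[OF d(1)] p(1) d(2)])
qed

text \<open>Curvature is defined in charts of \<open>A\<close>, whereas the analysis takes place in
  the conformal charts of \<open>C\<close>. The squared Jacobian of the transition appears in both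
  determinants and cancels.\<close>

lemma gauss_curvature_eq:
  assumes c: "c \<in> C" and d: "d \<in> A" and p: "p \<in> fst c" "p \<in> fst d"
  shows "gauss_curvature d f n p = - 1 + conformal_patch.ext_curvature (in_chart c f) (in_chart c n) (snd c p)"
proof -
  interpret P: conformal_patch "chart_image c" "in_chart c f" "in_chart c n" by (rule patch[OF c])
  let ?L = "dd (in_chart c (snd d)) (snd c p)"
  define J where "J = Re (?L 1) * Im (?L \<i>) - Im (?L 1) * Re (?L \<i>)"
  have w: "snd c p \<in> chart_image c" "snd d p \<in> chart_image d" using p by (auto simp: chart_image_def)
  have F: "linear (dd (in_chart d f) (snd d p))" and N: "linear (dd (in_chart d n) (snd d p))"
    using smooth_f_A[OF d] smooth_n_A[OF d] w(2) smooth_on_differentiable linear_frechet_derivative by blast+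
  note D = dd_in_chart[OF chart_C[OF c] chart_A[OF d] transition[OF c d] smooth_f_A[OF d] p]
    dd_in_chart[OF chart_C[OF c] chart_A[OF d] transition[OF c d] smooth_n_A[OF d] p]
  have 1: "det (form_matrix (\<lambda>u v. mink (dd (in_chart c f) (snd c p) u) (dd (in_chart c f) (snd c p) v))) =
      J\<^sup>2 * det (form_matrix (first_form d f (snd d p)))"
    unfolding D det_form_matrix_pullback[OF F F, of ?L] J_def first_form_def ..
  have 2: "det (form_matrix (\<lambda>u v. - mink (dd (in_chart c f) (snd c p) u) (dd (in_chart c n) (snd c p) v))) =
      J\<^sup>2 * det (form_matrix (second_form d f n (snd d p)))"
    unfolding det_form_matrix_minus D det_form_matrix_pullback[OF F N, of ?L] J_def second_form_def ..
  \<comment> \<open>The transition need not be inverted: the left side of \<open>1\<close> is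
    nonzero, so both factors on its right are.\<close>
  have nz: "J \<noteq> 0" "det (form_matrix (first_form d f (snd d p))) \<noteq> 0"
    using P.det_first_form_nonzero[OF w(1)] unfolding 1 by auto
  show ?thesis
    unfolding gauss_curvature_def P.ext_curvature_def 1 2 det_matrix_inv_mult[OF nz(2)] using nz by simp
qed

abbreviation all_stationary :: bool where
  "all_stationary \<equiv> \<forall>c\<in>C. \<forall>w\<in>chart_image c. conformal_patch.stationary (in_chart c f) (in_chart c n) w"

lemma constant_gauss_curvature_iff: "constant_gauss_curvature A f n \<longleftrightarrow> all_stationary"
proof
  assume "constant_gauss_curvature A f n"
  then obtain k where k: "\<And>d p. d \<in> A \<Longrightarrow> p \<in> fst d \<Longrightarrow> gauss_curvature d f n p = k"
    by (auto simp: constant_gauss_curvature_def)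
  show all_stationary
  proof (intro ballI)
    fix c w assume c: "c \<in> C" and w: "w \<in> chart_image c"
    interpret P: conformal_patch "chart_image c" "in_chart c f" "in_chart c n" by (rule patch[OF c])
    have e: "k + 1 = P.ext_curvature z" if "z \<in> chart_image c" for z
    proof -
      from that obtain p where p: "p \<in> fst c" "z = snd c p" by (auto simp: chart_image_def)
      obtain d where d: "d \<in> A" "p \<in> fst d" using cover_A in_topspace[OF chart_C[OF c] p(1)] by blast
      show ?thesis using gauss_curvature_eq[OF c d(1) p(1) d(2)] k[OF d] p(2) by simp
    qed
    show "P.stationary w"
      unfolding P.stationary_def
      by (rule has_derivative_transform_within_open[OF has_derivative_const P.open_U w e])
  qed
next
  assume st: all_stationary
  \<comment> \<open>Choosing a chart at each point turns the chartwise curvature into a function on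
    the surface; the value in any conformal chart shows that the choice does not matter.\<close>
  define K where "K p = gauss_curvature (SOME d. d \<in> A \<and> p \<in> fst d) f n p" for p
  have K: "K p = - 1 + conformal_patch.ext_curvature (in_chart c f) (in_chart c n) (snd c p)" if "c \<in> C" "p \<in> fst c" for c p
  proof -
    have "\<exists>d. d \<in> A \<and> p \<in> fst d" using cover_A in_topspace[OF chart_C[OF that(1)] that(2)] by blast
    from someI_ex[OF this] show ?thesis unfolding K_def using gauss_curvature_eq that by blast
  qed
  have "\<exists>k. \<forall>p\<in>topspace X. K p = k"
  proof (rule connected_space_locally_constant)
    show "connected_space X" using surf by (simp add: connected_smooth_surface_def)
    fix p assume "p \<in> topspace X"
    then obtain c where c: "c \<in> C" "p \<in> fst c" using cover_C by blast
    interpret P: conformal_patch "chart_image c" "in_chart c f" "in_chart c n" by (rule patch[OF c(1)])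
    have "snd c p \<in> chart_image c" using c by (auto simp: chart_image_def)
    then obtain e where e: "e > 0" "ball (snd c p) e \<subseteq> chart_image c"
      using P.open_U open_contains_ball by blast
    \<comment> \<open>A chart image may be disconnected, so the vanishing derivative is integrated
      on a convex ball.\<close>
    have "\<exists>k. \<forall>z\<in>ball (snd c p) e. P.ext_curvature z = k"
    proof (rule has_derivative_zero_constant)
      fix z assume "z \<in> ball (snd c p) e"
      then have "P.stationary z" using st c(1) e(2) by auto
      then show "(P.ext_curvature has_derivative (\<lambda>_. 0)) (at z within ball (snd c p) e)"
        unfolding P.stationary_def by (rule has_derivative_at_withinI)
    qed simp
    then obtain k where k: "\<And>z. z \<in> ball (snd c p) e \<Longrightarrow> P.ext_curvature z = k" by blast
    let ?V = "{q \<in> fst c. snd c q \<in> ball (snd c p) e}"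
    have "openin X ?V" by (rule openin_chart_preimage[OF chart_C[OF c(1)] open_ball])
    moreover have "p \<in> ?V" using c e by simp
    moreover have "K q = K p" if "q \<in> ?V" for q
      using that K[OF c] K[OF c(1)] k k[of "snd c p"] e(1) by auto
    ultimately show "\<exists>V. openin X V \<and> p \<in> V \<and> (\<forall>q\<in>V. K q = K p)" by blast
  qed
  then obtain k where k: "\<And>p. p \<in> topspace X \<Longrightarrow> K p = k" by blast
  have "gauss_curvature d f n p = k" if d: "d \<in> A" "p \<in> fst d" for d p
  proof -
    have pX: "p \<in> topspace X" using in_topspace[OF chart_A[OF d(1)] d(2)] .
    then obtain c where c: "c \<in> C" "p \<in> fst c" using cover_C by blast
    show ?thesis using gauss_curvature_eq[OF c(1) d(1) c(2) d(2)] K[OF c] k[OF pX] by simp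
  qed
  then show "constant_gauss_curvature A f n"
    unfolding constant_gauss_curvature_def by (intro exI[of _ k] ballI)
qed

lemma harmonic_legendrian_iff: "harmonic_map UH3 C (legendrian_gauss_map f n) \<longleftrightarrow> all_stationary"
proof -
  have "in_chart c (legendrian_gauss_map f n) = (\<lambda>z. (in_chart c f z, in_chart c n z))" for c
    by (simp add: in_chart_def legendrian_gauss_map_def fun_eq_iff)
  then show ?thesis by (simp add: harmonic_map_def conformal_patch.harmonic_on_UH3_iff[OF patch])
qed

lemma harmonic_lagrangian_iff: "harmonic_map Geo C (lagrangian_gauss_map f n) \<longleftrightarrow> all_stationary"
proof -
  have "in_chart c (lagrangian_gauss_map f n) = (\<lambda>z. oriented_plane (in_chart c f z) (in_chart c n z))" for c
    by (simp add: in_chart_def lagrangian_gauss_map_def fun_eq_iff)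
  then show ?thesis by (simp add: harmonic_map_def conformal_patch.harmonic_on_Geo_iff[OF patch])
qed

lemma klotz_holomorphic_iff: "klotz_holomorphic C f \<longleftrightarrow> all_stationary"
proof -
  have "klotz c f = conformal_patch.klotz_coeff (in_chart c f)" if "c \<in> C" for c
    by (rule ext) (simp add: klotz_def conformal_patch.klotz_coeff_def[OF patch[OF that]])
  then show ?thesis by (simp add: klotz_holomorphic_def conformal_patch.klotz_coeff_holomorphic_iff[OF patch])
qed

end

theorem theorem1:
  fixes X :: "'a topology" and A C :: "'a chart set" and f n :: "'a \<Rightarrow> vec4"
  assumes "connected_smooth_surface X A"
    and "immersed_surface X A f"
    and "unit_normal X A f n"
    and "\<forall>c\<in>A. \<forall>p\<in>fst c. gauss_curvature c f n p > - 1"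
    and "second_form_pos_def A f n"
    and "second_conformal_structure X A f n C"
  shows "(constant_gauss_curvature A f n \<longleftrightarrow> harmonic_map UH3 C (legendrian_gauss_map f n)) \<and>
         (harmonic_map UH3 C (legendrian_gauss_map f n) \<longleftrightarrow>
            harmonic_map Geo C (lagrangian_gauss_map f n)) \<and>
         (harmonic_map Geo C (lagrangian_gauss_map f n) \<longleftrightarrow> klotz_holomorphic C f)"
proof -
  interpret surface X A C f n using assms(1-3,6) by unfold_locales
  show ?thesis
    unfolding constant_gauss_curvature_iff harmonic_legendrian_iff harmonic_lagrangian_iff klotz_holomorphic_iff
    by simp
qed

end
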